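(* Let $\mathbb{H}=\{(z_1,z_2)\in\mathbb{C}^2 : |z_1|<|z_2|<1\}$. Let $s'\in\mathbb{R}$, written uniquely as $s'=s+2k$ with $k\in\mathbb{Z}$ and $s\in(0,2]$, and let $\mathcal{B}_{\mathbb{H},s'}$ be the weighted Bergman projection on $\mathbb{H}$ with the weight $|z_2|^{s'}$, $z\in\mathbb{H}$. Assume that $p>1$, $k\ge-1$, and $t\in\mathbb{R}$. Then $\mathcal{B}_{\mathbb{H},s'}$ is bounded from $L^p(\mathbb{H},|z_2|^{s'})$ to $L^p(\mathbb{H},|z_2|^{t})$ if $p\in\left(\frac{s+2k+4}{s+k+2},\frac{t+4}{k+2}\right)$. In addition, if $t-s'\le(2-s)p$, then $\mathcal{B}_{\mathbb{H},s'}$ is bounded from $L^p(\mathbb{H},|z_2|^{s'})$ to $L^p(\mathbb{H},|z_2|^{t})$ if and only if $p\in\left(\frac{s+2k+4}{s+k+2},\frac{t+4}{k+2}\right)$. On the other hand, if $p\le\frac{s+2k+4}{s+k+2}$, then $\mathcal{B}_{\mathbb{H},s'}$ is unbounded from $L^p(\mathbb{H},|z_2|^{s'})$ to $L^p(\mathbb{H},|z_2|^{t})$ for all $t\in\mathbb{R}$.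
   Context: An interval $(a,b)$ with $a\ge b$ is empty. For a domain $\Omega\subset\mathbb{C}^n$ and a continuous non-vanishing weight $\mu>0$ on $\Omega$, $L^p(\Omega,\mu)$ is the space of measurable $f$ with $\|f\|_{L^p(\Omega,\mu)}=\left(\int_\Omega|f|^p\mu\,dV\right)^{1/p}<\infty$; $A^2(\Omega,\mu)$ is the closed subspace of holomorphic functions in $L^2(\Omega,\mu)$; the weighted Bergman projection on $\Omega$ with the weight $\mu$ is the orthogonal projection from $L^2(\Omega,\mu)$ onto $A^2(\Omega,\mu)$. It is bounded from $L^p(\Omega,\mu)$ to $L^p(\Omega,\nu)$ if, as usual, there is a constant $C$ such that $\|Tf\|_{L^p(\Omega,\nu)}\le C\|f\|_{L^p(\Omega,\mu)}$ for all $f\in L^p(\Omega,\mu)\cap L^2(\Omega,\mu)$, where $T$ denotes the projection; otherwise it is unbounded. *)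

theory Defs
  imports "HOL-Analysis.Analysis"
begin

text \<open>Frechet differentiability with complex-linear derivative; meant for open \<open>\<Omega>\<close>.\<close>

definition holomorphic_several_on ::
  "(complex ^ 'n \<Rightarrow> complex) \<Rightarrow> (complex ^ 'n) set \<Rightarrow> bool" where
  "holomorphic_several_on f \<Omega> \<longleftrightarrow>
     (\<forall>z\<in>\<Omega>. \<exists>D. (f has_derivative D) (at z) \<and> (\<forall>c v. D (c *s v) = c * D v))"

text \<open>Functions are not identified almost everywhere, and their values outside \<open>\<Omega>\<close> play no role.\<close>

definition Lp_space ::
  "real \<Rightarrow> (complex ^ 'n) set \<Rightarrow> (complex ^ 'n \<Rightarrow> real) \<Rightarrow> (complex ^ 'n \<Rightarrow> complex) set" where
  "Lp_space p \<Omega> \<mu> =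
     {f. f \<in> borel_measurable (lebesgue_on \<Omega>) \<and>
         integrable (lebesgue_on \<Omega>) (\<lambda>z. norm (f z) powr p * \<mu> z)}"

definition Lp_norm ::
  "real \<Rightarrow> (complex ^ 'n) set \<Rightarrow> (complex ^ 'n \<Rightarrow> real) \<Rightarrow> (complex ^ 'n \<Rightarrow> complex) \<Rightarrow> real" where
  "Lp_norm p \<Omega> \<mu> f = (LINT z|lebesgue_on \<Omega>. norm (f z) powr p * \<mu> z) powr (1 / p)"

definition L2_inner ::
  "(complex ^ 'n) set \<Rightarrow> (complex ^ 'n \<Rightarrow> real) \<Rightarrow>
   (complex ^ 'n \<Rightarrow> complex) \<Rightarrow> (complex ^ 'n \<Rightarrow> complex) \<Rightarrow> complex" where
  "L2_inner \<Omega> \<mu> f g = (LINT z|lebesgue_on \<Omega>. f z * cnj (g z) * complex_of_real (\<mu> z))"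

definition bergman_space ::
  "(complex ^ 'n) set \<Rightarrow> (complex ^ 'n \<Rightarrow> real) \<Rightarrow> (complex ^ 'n \<Rightarrow> complex) set" where
  "bergman_space \<Omega> \<mu> = {f \<in> Lp_space 2 \<Omega> \<mu>. holomorphic_several_on f \<Omega>}"

text \<open>
  For a continuous positive weight on a domain, the weighted Bergman space is closed in
  the weighted \<open>L\<^sup>2\<close> space, so an element \<open>g\<close> as below exists; two such elements agree on \<open>\<Omega>\<close>,
  and the choice operator only selects the irrelevant values outside \<open>\<Omega>\<close>.
\<close>

definition bergman_projection ::
  "(complex ^ 'n) set \<Rightarrow> (complex ^ 'n \<Rightarrow> real) \<Rightarrow>
   (complex ^ 'n \<Rightarrow> complex) \<Rightarrow> (complex ^ 'n \<Rightarrow> complex)" where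
  "bergman_projection \<Omega> \<mu> f =
     (SOME g. g \<in> bergman_space \<Omega> \<mu> \<and>
        (\<forall>h \<in> bergman_space \<Omega> \<mu>. L2_inner \<Omega> \<mu> (\<lambda>z. f z - g z) h = 0))"

text \<open>
  \<open>Lp_norm\<close> is a Bochner integral, which is 0 when \<open>\<parallel>T f\<parallel>\<close> is infinite; hence the explicit
  membership condition.
\<close>

definition bergman_projection_bounded ::
  "real \<Rightarrow> (complex ^ 'n) set \<Rightarrow> (complex ^ 'n \<Rightarrow> real) \<Rightarrow> (complex ^ 'n \<Rightarrow> real) \<Rightarrow> bool" where
  "bergman_projection_bounded p \<Omega> \<mu> \<nu> \<longleftrightarrow>
     (\<exists>C. \<forall>f \<in> Lp_space p \<Omega> \<mu> \<inter> Lp_space 2 \<Omega> \<mu>.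
        bergman_projection \<Omega> \<mu> f \<in> Lp_space p \<Omega> \<nu> \<and>
        Lp_norm p \<Omega> \<nu> (bergman_projection \<Omega> \<mu> f) \<le> C * Lp_norm p \<Omega> \<mu> f)"

definition hartogs_triangle :: "(complex ^ 2) set" where
  "hartogs_triangle = {z. norm (z $ 1) < norm (z $ 2) \<and> norm (z $ 2) < 1}"

definition power_weight :: "real \<Rightarrow> complex ^ 2 \<Rightarrow> real" where
  "power_weight r z = norm (z $ 2) powr r"

end

theory Submission
  imports Defs "HOL-Complex_Analysis.Conformal_Mappings"
begin

text \<open>
  In the coordinates \<open>(z\<^sub>1/z\<^sub>2, z\<^sub>2)\<close> the Hartogs triangle becomes \<open>D \<times> (D - {0})\<close> with an additional
  Jacobian \<open>|z\<^sub>2|\<^sup>2\<close>. Put \<open>m = k + 2\<close>. After multiplication by \<open>z\<^sub>2\<^sup>m\<close>, the weighted Bergman space is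
  that of the bidisc with the weight \<open>|z\<^sub>2|\<close> to the power \<open>s - 2\<close>, because \<open>0 < s \<le> 2\<close> makes
  square-integrable holomorphic functions extend across \<open>z\<^sub>2 = 0\<close>. Its kernel is explicit, and
  bounded by a constant times the product of two factors \<open>|1 - z \<zeta>\<^sup>*|\<close> to the power \<open>-2\<close>, so the Schur
  test gives the \<open>L\<^sup>p\<close> bounds in the stated range. Averaging over rotations proves the
  reproducing property (by Cauchy's formula) and reduces all estimates to one-dimensional integrals.
  Conversely, the projection of \<open>\<phi>(|z\<^sub>2|) / z\<^sub>2\<^sup>m\<close> is a multiple of \<open>1 / z\<^sub>2\<^sup>m\<close>. This function has to
  lie in the target space, which is the upper bound on \<open>p\<close>, and pairing with it has to be bounded
  on the source space, which is the lower bound.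
\<close>

section \<open>Planar Lebesgue measure\<close>

text \<open>Near \<open>z\<^sub>2 = 0\<close> the kernel factor in the second variable is bounded,
  so all singular behaviour there sits in the measures. After multiplication by the
  \<open>m\<close>-th power of \<open>z\<^sub>2\<close>, three exponents of
  \<open>|z\<^sub>2|\<close> compete: \<open>s - 2\<close> for the kernel,
  \<open>q = s - 2 + 2 * m - m * p\<close> for the source norm and \<open>t + 2 - m * p\<close> for
  the target norm. An exponent above -2 means integrability at the origin. The upper bound on
  \<open>p\<close> says that the target exponent exceeds -2. The lower bound is the dual condition:
  the power \<open>s - 2 - q\<close> of \<open>|z\<^sub>2|\<close> is locally in the conjugate
  Lebesgue space of the source. Hence the Schur test is set up with different measures on its two
  sides and with a power of \<open>|z\<^sub>2|\<close> in one test function only; this reaches the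
  exact endpoints.

  The projection is given by a choice operator on functions that are merely Lebesgue measurable. An
  explicit integral operator on Borel representatives is therefore shown to agree with it almost
  everywhere, and all estimates are made for that operator.\<close>

lemma lborel_complex:
  "lborel = distr (lborel \<Otimes>\<^sub>M lborel) borel (\<lambda>(x, y). Complex x y)"
proof (rule lborel_eqI)
  have [measurable]: "(\<lambda>(x, y). Complex x y) \<in> borel_measurable (borel \<Otimes>\<^sub>M borel)"
    unfolding Complex_eq case_prod_beta by measurable
  fix l u :: complex
  assume *: "\<And>b. b \<in> Basis \<Longrightarrow> l \<bullet> b \<le> u \<bullet> b"
  have le: "Re l \<le> Re u" "Im l \<le> Im u"
    using *[of 1] *[of \<i>] by (auto simp: Basis_complex_def inner_complex_def)
  have "emeasure (distr (lborel \<Otimes>\<^sub>M lborel) borel (\<lambda>(x, y). Complex x y)) (box l u)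
      = emeasure (lborel \<Otimes>\<^sub>M lborel) (box (Re l) (Re u) \<times> box (Im l) (Im u))"
    by (subst emeasure_distr)
       (auto simp: space_pair_measure in_box_complex_iff box_real intro!: arg_cong2[where f=emeasure])
  also have "\<dots> = emeasure lborel (box (Re l) (Re u)) * emeasure lborel (box (Im l) (Im u))"
    by (intro lborel.emeasure_pair_measure_Times) auto
  also have "\<dots> = (\<Prod>b\<in>Basis. (u - l) \<bullet> b)"
    using le by (simp add: Basis_complex_def inner_complex_def ennreal_mult' complex_eq_iff)
  finally show "emeasure (distr (lborel \<Otimes>\<^sub>M lborel) borel (\<lambda>(x, y). Complex x y)) (box l u)
    = (\<Prod>b\<in>Basis. (u - l) \<bullet> b)" .
qed simp

text \<open>Both orders of integration are kept because the two shears below substitute in different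
  coordinates.\<close>

lemma nn_integral_lborel_complex:
  assumes [measurable]: "f \<in> borel_measurable borel"
  shows "(\<integral>\<^sup>+z. f z \<partial>lborel) = (\<integral>\<^sup>+x. \<integral>\<^sup>+y. f (Complex x y) \<partial>lborel \<partial>lborel)"
    and "(\<integral>\<^sup>+z. f z \<partial>lborel) = (\<integral>\<^sup>+y. \<integral>\<^sup>+x. f (Complex x y) \<partial>lborel \<partial>lborel)"
proof -
  have [measurable]: "(\<lambda>(x, y). Complex x y) \<in> borel_measurable (borel \<Otimes>\<^sub>M borel)"
    unfolding Complex_eq case_prod_beta by measurable
  have "(\<integral>\<^sup>+z. f z \<partial>lborel) = (\<integral>\<^sup>+w. f (case w of (x, y) \<Rightarrow> Complex x y) \<partial>(lborel \<Otimes>\<^sub>M lborel))"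
    by (subst lborel_complex, subst nn_integral_distr) auto
  then show "(\<integral>\<^sup>+z. f z \<partial>lborel) = (\<integral>\<^sup>+x. \<integral>\<^sup>+y. f (Complex x y) \<partial>lborel \<partial>lborel)"
    and "(\<integral>\<^sup>+z. f z \<partial>lborel) = (\<integral>\<^sup>+y. \<integral>\<^sup>+x. f (Complex x y) \<partial>lborel \<partial>lborel)"
    using lborel_pair.Fubini'[of "\<lambda>x y. f (Complex x y)"]
    by (simp_all add: lborel.nn_integral_fst[symmetric] case_prod_beta)
qed

text \<open>The map is the product of two shears, each of which is handled by a one-dimensional
  substitution.\<close>

lemma nn_integral_lborel_complex_mult_aux:
  assumes [measurable]: "f \<in> borel_measurable borel" and a: "a \<noteq> 0"
  shows "ennreal (a\<^sup>2 + b\<^sup>2) * (\<integral>\<^sup>+z. f (Complex a b * z) \<partial>lborel) = (\<integral>\<^sup>+z. f z \<partial>lborel)"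
proof -
  have [measurable]: "(\<lambda>x. Complex (g x) (h x)) \<in> borel_measurable M"
    if "g \<in> borel_measurable M" "h \<in> borel_measurable M" for g h :: "'x \<Rightarrow> real" and M
    using that unfolding Complex_eq by measurable
  define n where "n = a\<^sup>2 + b\<^sup>2"
  have n: "n > 0" using a by (auto simp: n_def sum_power2_gt_zero_iff)
  have "(\<integral>\<^sup>+z. f (Complex a b * z) \<partial>lborel) =
      (\<integral>\<^sup>+y. \<integral>\<^sup>+x. f (Complex (a * x - b * y) (a * y + b * x)) \<partial>lborel \<partial>lborel)"
    by (subst nn_integral_lborel_complex(2)) (simp_all add: complex_mult)
  \<comment> \<open>With \<open>u = a * x - b * y\<close> as the new first coordinate, the second
    one, \<open>a * y + b * x\<close>, becomes \<open>(n * y + b * u) / a\<close>. What remains is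
    affine in \<open>y\<close> for fixed \<open>u\<close>. The two Jacobians \<open>1 / a\<close>
    and \<open>a / n\<close> multiply to \<open>1 / n\<close>.\<close>
  also have "\<dots> = (\<integral>\<^sup>+y. ennreal \<bar>1 / a\<bar> * (\<integral>\<^sup>+u. f (Complex u (n / a * y + b / a * u)) \<partial>lborel) \<partial>lborel)"
  proof (rule nn_integral_cong)
    fix y :: real
    have "a * (a * b * y / (a * a) + u / a) - b * y = u"
      "n * y / a + b * u / a = a * y + b * (a * b * y / (a * a) + u / a)" for u
      using a by (auto simp: field_simps n_def power2_eq_square)
    then show "(\<integral>\<^sup>+x. f (Complex (a * x - b * y) (a * y + b * x)) \<partial>lborel) =
        ennreal \<bar>1 / a\<bar> * (\<integral>\<^sup>+u. f (Complex u (n / a * y + b / a * u)) \<partial>lborel)"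
      using a by (subst nn_integral_real_affine[where c="1/a" and t="a * b * y / (a * a)"]) simp_all
  qed
  also have "\<dots> = ennreal \<bar>1 / a\<bar> * (\<integral>\<^sup>+u. \<integral>\<^sup>+y. f (Complex u (n / a * y + b / a * u)) \<partial>lborel \<partial>lborel)"
    by (subst nn_integral_cmult) (auto intro!: arg_cong2[where f="(*)"] lborel_pair.Fubini')
  also have "(\<integral>\<^sup>+u. \<integral>\<^sup>+y. f (Complex u (n / a * y + b / a * u)) \<partial>lborel \<partial>lborel)
      = (\<integral>\<^sup>+u. ennreal \<bar>a / n\<bar> * (\<integral>\<^sup>+v. f (Complex u v) \<partial>lborel) \<partial>lborel)"
  proof (rule nn_integral_cong)
    fix u :: real
    have "n * (- (b * u / n) + a * v / n) / a + b * u / a = v" for v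
      using a n by (auto simp: field_simps)
    then show "(\<integral>\<^sup>+y. f (Complex u (n / a * y + b / a * u)) \<partial>lborel) =
        ennreal \<bar>a / n\<bar> * (\<integral>\<^sup>+v. f (Complex u v) \<partial>lborel)"
      using a n by (subst nn_integral_real_affine[where c="a/n" and t="- (b * u / n)"]) simp_all
  qed
  also have "\<dots> = ennreal \<bar>a / n\<bar> * (\<integral>\<^sup>+z. f z \<partial>lborel)"
    by (subst nn_integral_cmult) (auto simp: nn_integral_lborel_complex(1))
  finally have "ennreal n * (\<integral>\<^sup>+z. f (Complex a b * z) \<partial>lborel) =
      ennreal n * (ennreal \<bar>1 / a\<bar> * (ennreal \<bar>a / n\<bar> * (\<integral>\<^sup>+z. f z \<partial>lborel)))" by simp
  also have "\<dots> = ennreal (n * (\<bar>1 / a\<bar> * \<bar>a / n\<bar>)) * (\<integral>\<^sup>+z. f z \<partial>lborel)"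
    using n by (simp only: ennreal_mult zero_le_mult_iff abs_ge_zero less_imp_le simp_thms) (simp add: mult_ac)
  also have "n * (\<bar>1 / a\<bar> * \<bar>a / n\<bar>) = 1"
    using n a by (simp add: field_simps abs_divide)
  finally show ?thesis by (simp add: n_def)
qed

text \<open>The shear argument divides by the real part of the multiplier. A purely imaginary
  \<open>c\<close> is therefore written as \<open>1 + \<i>\<close> times \<open>d\<close>, two
  factors with nonzero real part.\<close>

lemma nn_integral_lborel_complex_mult:
  assumes [measurable]: "f \<in> borel_measurable borel" and c: "c \<noteq> 0"
  shows "ennreal ((cmod c)\<^sup>2) * (\<integral>\<^sup>+z. f (c * z) \<partial>lborel) = (\<integral>\<^sup>+z. f z \<partial>lborel)"
proof (cases "Re c = 0")
  case False
  then show ?thesis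
    using nn_integral_lborel_complex_mult_aux[of f "Re c" "Im c"] by (simp add: cmod_power2)
next
  case True
  define d where "d = c / (1 + \<i>)"
  have cd: "c = Complex 1 1 * d" "Re d \<noteq> 0"
    using c True by (auto simp: d_def complex_eq_iff Re_divide Im_divide)
  have "(\<integral>\<^sup>+z. f z \<partial>lborel) = ennreal 2 * (\<integral>\<^sup>+z. f (Complex 1 1 * z) \<partial>lborel)"
    using nn_integral_lborel_complex_mult_aux[of f 1 1] by simp
  also have "\<dots> = ennreal 2 * (ennreal ((cmod d)\<^sup>2) * (\<integral>\<^sup>+z. f (Complex 1 1 * (d * z)) \<partial>lborel))"
    using nn_integral_lborel_complex_mult_aux[of "\<lambda>z. f (Complex 1 1 * z)" "Re d" "Im d"] cd(2)
    by (simp add: cmod_power2)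
  also have "\<dots> = ennreal (2 * (cmod d)\<^sup>2) * (\<integral>\<^sup>+z. f (c * z) \<partial>lborel)"
    using cd(1) by (simp add: ennreal_mult mult.assoc)
  also have "2 * (cmod d)\<^sup>2 = (cmod c)\<^sup>2"
    by (simp add: cd(1) norm_mult power_mult_distrib cmod_def[of "Complex 1 1"])
  finally show ?thesis ..
qed

section \<open>Power weights on the unit disc\<close>

lemma measurable_ball [measurable]: "ball (a :: 'a :: euclidean_space) r \<in> sets borel"
  by simp

text \<open>The exponent is an arbitrary real; for \<open>r \<le> -2\<close> the mass near the
  origin is infinite, which is what the unboundedness proofs exploit. Since
  \<open>0 powr r = 0\<close> for every \<open>r\<close>, including 0, the density vanishes at the
  origin and exponents add up there without exception.\<close>

definition disc_measure :: "real \<Rightarrow> complex measure" where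
  "disc_measure r = density lborel (\<lambda>z. ennreal (indicator (ball 0 1) z * cmod z powr r))"

lemma sets_disc_measure [simp, measurable_cong]: "sets (disc_measure r) = sets borel"
  and space_disc_measure [simp]: "space (disc_measure r) = UNIV"
  by (simp_all add: disc_measure_def)

lemma sigma_finite_disc_measure: "sigma_finite_measure (disc_measure r)"
  unfolding disc_measure_def
  by (subst sigma_finite_measure.sigma_finite_iff_density_finite[OF sigma_finite_lborel]) auto

lemma nn_integral_disc_measure:
  assumes [measurable]: "f \<in> borel_measurable borel"
  shows "(\<integral>\<^sup>+z. f z \<partial>disc_measure r) =
    (\<integral>\<^sup>+z. ennreal (indicator (ball 0 1) z * cmod z powr r) * f z \<partial>lborel)"
  unfolding disc_measure_def by (subst nn_integral_density) auto

lemma AE_disc_measure: "AE z in disc_measure r. z \<in> ball 0 1 - {0}"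
proof -
  have "AE z in lborel. z \<noteq> (0::complex)" by (rule AE_lborel_singleton)
  then show ?thesis unfolding disc_measure_def
    by (subst AE_density) (auto elim!: eventually_mono split: split_indicator_asm)
qed

lemma density_disc_measure:
  "density (disc_measure r) (\<lambda>z. ennreal (cmod z powr q)) = disc_measure (r + q)"
  unfolding disc_measure_def
  by (subst density_density_eq) (auto intro!: arg_cong2[where f=density] ext simp: powr_add ennreal_mult'[symmetric] mult_ac)

lemma disc_measure_rotate:
  assumes c: "cmod c = 1"
  shows "distr (disc_measure r) borel ((*) c) = disc_measure r"
proof (rule measure_eqI)
  fix A :: "complex set" assume "A \<in> sets (distr (disc_measure r) borel ((*) c))"
  then have [measurable]: "A \<in> sets borel" by simp
  have [measurable]: "((*) c) \<in> disc_measure r \<rightarrow>\<^sub>M borel" by measurable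
  have c0: "c \<noteq> 0" using c by auto
  have meas: "(\<lambda>z. ennreal (indicator (ball 0 1) z * cmod z powr r) * indicator A z) \<in> borel_measurable borel"
    by measurable
  have "emeasure (distr (disc_measure r) borel ((*) c)) A = (\<integral>\<^sup>+z. indicator A z \<partial>distr (disc_measure r) borel ((*) c))"
    by simp
  also have "\<dots> = (\<integral>\<^sup>+z. indicator A (c * z) \<partial>disc_measure r)"
    by (subst nn_integral_distr) auto
  also have "\<dots> = (\<integral>\<^sup>+z. ennreal (indicator (ball 0 1) (c * z) * cmod (c * z) powr r) * indicator A (c * z) \<partial>lborel)"
    using c by (subst nn_integral_disc_measure) (auto simp: norm_mult intro!: nn_integral_cong split: split_indicator)
  also have "\<dots> = (\<integral>\<^sup>+z. ennreal (indicator (ball 0 1) z * cmod z powr r) * indicator A z \<partial>lborel)"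
    using nn_integral_lborel_complex_mult[OF meas c0] c by simp
  also have "\<dots> = (\<integral>\<^sup>+z. indicator A z \<partial>disc_measure r)"
    by (subst nn_integral_disc_measure) auto
  finally show "emeasure (distr (disc_measure r) borel ((*) c)) A = emeasure (disc_measure r) A"
    by simp
qed simp

text \<open>Polar coordinates with the angle integrated out. In the variable
  \<open>u = |z|\<^sup>2\<close> the planar measure is uniform, because the annulus
  \<open>x < |z|\<^sup>2 < 1\<close> has area \<open>pi * (1 - x)\<close>. Only the exponent 0 needs
  this computation; the others follow by a density that is a function of \<open>u\<close>.\<close>

lemma distr_disc_measure_cmod_square:
  "distr (disc_measure r) borel (\<lambda>z. (cmod z)\<^sup>2) =
   density lborel (\<lambda>u. ennreal (pi * indicator {0<..<1} u * u powr (r / 2)))"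
proof -
  have 0: "distr (disc_measure 0) borel (\<lambda>z. (cmod z)\<^sup>2) = density lborel (\<lambda>u. ennreal (pi * indicator {0<..<1} u))"
  \<comment> \<open>Measures on the line with finite mass on right half-lines are determined by
    those masses, so areas of discs suffice.\<close>
  proof (rule measure_eqI_lessThan)
    fix x :: real
    let ?S = "\<lambda>x. {z :: complex. sqrt x < cmod z \<and> cmod z < 1 \<and> z \<noteq> 0}"
    have "emeasure (distr (disc_measure 0) borel (\<lambda>z. (cmod z)\<^sup>2)) {x<..} =
        emeasure (disc_measure 0) {z. x < (cmod z)\<^sup>2}"
      by (subst emeasure_distr) (auto intro!: arg_cong2[where f=emeasure])
    also have "\<dots> = (\<integral>\<^sup>+z. indicator (ball 0 1 \<inter> {z. x < (cmod z)\<^sup>2}) z \<partial>lborel)"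
      unfolding disc_measure_def
    proof (subst emeasure_density, goal_cases)
      case 3 then show ?case
      proof (rule nn_integral_cong_AE, goal_cases)
        case 1
        have "AE z in lborel. z \<noteq> (0::complex)" by (rule AE_lborel_singleton)
        then show ?case by eventually_elim (auto split: split_indicator)
      qed
    qed auto
    also have "\<dots> = emeasure lborel (ball 0 1 \<inter> {z :: complex. x < (cmod z)\<^sup>2})"
      by simp
    also have "\<dots> = ennreal (pi * (1 - min 1 (max 0 x)))"
    proof (cases "x < 0")
      case True
      then have "{z :: complex. x < (cmod z)\<^sup>2} = UNIV" by (auto intro: less_le_trans)
      then show ?thesis using True by (simp add: emeasure_ball unit_ball_vol_2)
    next
      case x: False
      show ?thesis
      proof (cases "x < 1")
        case False
        have "(cmod z)\<^sup>2 < 1" if "cmod z < 1" for z using that by (simp add: power_less_one_iff abs_square_less_1)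
        then have "ball 0 1 \<inter> {z :: complex. x < (cmod z)\<^sup>2} = {}" using False by force
        then show ?thesis using False by simp
      next
        case True
        have "ball 0 1 \<inter> {z :: complex. x < (cmod z)\<^sup>2} = ball 0 1 - cball 0 (sqrt x)"
        proof -
          have "x < (cmod z)\<^sup>2 \<longleftrightarrow> sqrt x < cmod z" for z
            by (metis norm_ge_zero real_sqrt_less_iff real_sqrt_unique)
          then have "ball 0 1 \<inter> {z :: complex. x < (cmod z)\<^sup>2} = ball 0 1 \<inter> {z. sqrt x < cmod z}"
            by (intro arg_cong2[where f="(\<inter>)"] refl Collect_cong)
          also have "\<dots> = ball 0 1 - cball 0 (sqrt x)"
            unfolding set_eq_iff Int_iff Diff_iff mem_cball mem_Collect_eq dist_0_norm not_le by (rule allI refl)+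
          finally show ?thesis .
        qed
        also have "emeasure lborel \<dots> = emeasure lborel (ball 0 1 :: complex set) - emeasure lborel (cball 0 (sqrt x) :: complex set)"
        proof (rule emeasure_Diff)
          have "sqrt x < 1" using True by simp
          then show "cball 0 (sqrt x) \<subseteq> (ball 0 1 :: complex set)"
            unfolding subset_iff mem_cball mem_ball by (blast intro: le_less_trans)
        qed (use x in \<open>auto simp: emeasure_cball\<close>)
        also have "\<dots> = ennreal (pi * (1 - min 1 (max 0 x)))"
          using x True by (simp add: emeasure_ball emeasure_cball unit_ball_vol_2 ennreal_minus algebra_simps)
        finally show ?thesis .
      qed
    qed
    finally have *: "emeasure (distr (disc_measure 0) borel (\<lambda>z. (cmod z)\<^sup>2)) {x<..} = ennreal (pi * (1 - min 1 (max 0 x)))" .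
    then show "emeasure (distr (disc_measure 0) borel (\<lambda>z. (cmod z)\<^sup>2)) {x<..} < \<infinity>" by simp
    have "emeasure (density lborel (\<lambda>u. ennreal (pi * indicator {0<..<1} u))) {x<..}
        = (\<integral>\<^sup>+u. ennreal pi * indicator {min 1 (max 0 x)<..<1} u \<partial>lborel)"
      by (subst emeasure_density) (auto intro!: nn_integral_cong split: split_indicator)
    also have "\<dots> = ennreal (pi * (1 - min 1 (max 0 x)))"
      by (subst nn_integral_cmult_indicator) (auto simp: ennreal_mult' )
    finally show "emeasure (distr (disc_measure 0) borel (\<lambda>z. (cmod z)\<^sup>2)) {x<..} =
        emeasure (density lborel (\<lambda>u. ennreal (pi * indicator {0<..<1} u))) {x<..}"
      using * by simp
  qed auto
  have "distr (disc_measure r) borel (\<lambda>z. (cmod z)\<^sup>2) =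
      distr (density (disc_measure 0) (\<lambda>z. ennreal (((cmod z)\<^sup>2) powr (r/2)))) borel (\<lambda>z. (cmod z)\<^sup>2)"
  proof -
    have "((cmod z)\<^sup>2) powr (r/2) = cmod z powr r" for z
      by (cases "z = 0") (auto simp: powr_powr simp flip: powr_numeral)
    then show ?thesis by (simp add: density_disc_measure)
  qed
  also have "\<dots> = density (distr (disc_measure 0) borel (\<lambda>z. (cmod z)\<^sup>2)) (\<lambda>u. ennreal (u powr (r/2)))"
    by (subst density_distr) auto
  also have "\<dots> = density lborel (\<lambda>u. ennreal (pi * indicator {0<..<1} u * u powr (r / 2)))"
    unfolding 0 by (subst density_density_eq) (auto simp: ennreal_mult')
  finally show ?thesis .
qed

lemma nn_integral_disc_measure_radial:
  assumes [measurable]: "f \<in> borel_measurable borel"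
  shows "(\<integral>\<^sup>+z. f ((cmod z)\<^sup>2) \<partial>disc_measure r) =
    (\<integral>\<^sup>+u. ennreal (pi * indicator {0<..<1} u * u powr (r / 2)) * f u \<partial>lborel)"
proof -
  have "(\<integral>\<^sup>+z. f ((cmod z)\<^sup>2) \<partial>disc_measure r) = (\<integral>\<^sup>+u. f u \<partial>distr (disc_measure r) borel (\<lambda>z. (cmod z)\<^sup>2))"
    by (subst nn_integral_distr) auto
  then show ?thesis
    unfolding distr_disc_measure_cmod_square by (simp add: nn_integral_density)
qed

section \<open>Circle means and the reproducing property\<close>

text \<open>Angles are measured in full turns: this matches the parametrization of
  \<open>circlepath\<close> by the unit interval, and the total mass 1 makes integration an
  average.\<close>

definition unit_lborel :: "real measure" where
  "unit_lborel = density lborel (\<lambda>x. ennreal (indicator {0..1} x))"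

lemma sets_unit_lborel [simp, measurable_cong]: "sets unit_lborel = sets borel"
  and space_unit_lborel [simp]: "space unit_lborel = UNIV"
  by (simp_all add: unit_lborel_def)

lemma emeasure_unit_lborel: "emeasure unit_lborel UNIV = 1"
  by (simp add: unit_lborel_def emeasure_density ennreal_indicator)

lemma finite_measure_unit_lborel: "finite_measure unit_lborel"
  by (rule finite_measureI) (simp add: emeasure_unit_lborel)

definition unit_cis :: "real \<Rightarrow> complex" where
  "unit_cis \<theta> = cis (2 * pi * \<theta>)"

lemma norm_unit_cis [simp]: "cmod (unit_cis \<theta>) = 1"
  by (simp add: unit_cis_def)

lemma unit_cis_nonzero [simp]: "unit_cis \<theta> \<noteq> 0"
  by (simp add: unit_cis_def)

lemma continuous_on_unit_cis [continuous_intros]: "continuous_on A unit_cis"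
  unfolding unit_cis_def by (intro continuous_intros)

lemma measurable_unit_cis [measurable]: "unit_cis \<in> borel_measurable borel"
  by (intro borel_measurable_continuous_onI continuous_intros)

lemma measurable_cnj [measurable]: "cnj \<in> borel_measurable borel"
  by (intro borel_measurable_continuous_onI continuous_intros)

text \<open>On the unit circle \<open>d\<xi> / \<xi>\<close> is \<open>2 * pi * \<i>\<close> times
  the normalized angle, so a contour integral evaluated by Cauchy's formula becomes a mean over
  rotations.\<close>

lemma circle_mean:
  fixes f :: "complex \<Rightarrow> complex"
  assumes [measurable]: "f \<in> borel_measurable borel" and cont: "continuous_on (sphere 0 1) f"
    and int: "((\<lambda>\<xi>. f \<xi> / \<xi>) has_contour_integral (2 * pi * \<i> * I)) (circlepath 0 1)"
  shows "integrable unit_lborel (\<lambda>\<theta>. f (unit_cis \<theta>))"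
    and "(\<integral>\<theta>. f (unit_cis \<theta>) \<partial>unit_lborel) = I"
proof -
  have c: "continuous_on {0..1} (\<lambda>\<theta>. f (unit_cis \<theta>))"
    by (rule continuous_on_compose2[OF cont]) (auto intro!: continuous_intros)
  have si: "set_integrable lborel {0..1} (\<lambda>\<theta>. f (unit_cis \<theta>))"
    by (rule borel_integrable_atLeastAtMost'[OF c])
  then show "integrable unit_lborel (\<lambda>\<theta>. f (unit_cis \<theta>))"
    unfolding unit_lborel_def set_integrable_def
    by (subst integrable_density) auto
  have cp: "circlepath 0 1 x = unit_cis x" for x
    by (simp add: circlepath unit_cis_def cis_conv_exp mult_ac)
  have "((\<lambda>x. (2 * pi * \<i>) * f (unit_cis x)) has_integral (2 * pi * \<i>) * I) {0..1}"
  proof (rule has_integral_eq)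
    show "((\<lambda>x. f (circlepath 0 1 x) / circlepath 0 1 x *
        vector_derivative (circlepath 0 1) (at x within {0..1})) has_integral 2 * pi * \<i> * I) {0..1}"
      using int by (simp add: has_contour_integral_def)
    fix x :: real assume "x \<in> {0..1}"
    then have "vector_derivative (circlepath 0 1) (at x within {0..1}) = 2 * pi * \<i> * unit_cis x"
      by (subst vector_derivative_circlepath01) (auto simp: unit_cis_def cis_conv_exp mult_ac)
    then show "f (circlepath 0 1 x) / circlepath 0 1 x *
        vector_derivative (circlepath 0 1) (at x within {0..1}) = 2 * pi * \<i> * f (unit_cis x)"
      by (simp add: cp)
  qed
  from has_integral_mult_right[OF this, of "1 / (2 * pi * \<i>)"]
  have "((\<lambda>x. f (unit_cis x)) has_integral I) {0..1}" by simp
  then have "integral {0..1} (\<lambda>x. f (unit_cis x)) = I" by (rule integral_unique)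
  then show "(\<integral>\<theta>. f (unit_cis \<theta>) \<partial>unit_lborel) = I"
    using set_borel_integral_eq_integral(2)[OF si]
    unfolding unit_lborel_def set_lebesgue_integral_def
    by (subst integral_density) auto
qed

text \<open>For each fixed angle the rotated integrand has the same integral; Tonelli then moves the
  average over angles inside.\<close>

lemma nn_integral_disc_measure_average:
  assumes [measurable]: "g \<in> borel_measurable borel"
  shows "(\<integral>\<^sup>+\<zeta>. g \<zeta> \<partial>disc_measure r) =
    (\<integral>\<^sup>+\<zeta>. (\<integral>\<^sup>+\<theta>. g (unit_cis \<theta> * \<zeta>) \<partial>unit_lborel) \<partial>disc_measure r)"
proof -
  interpret D: sigma_finite_measure "disc_measure r" by (rule sigma_finite_disc_measure)
  interpret U: finite_measure unit_lborel by (rule finite_measure_unit_lborel)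
  interpret pair_sigma_finite unit_lborel "disc_measure r" ..
  have rot: "(\<integral>\<^sup>+\<zeta>. g (unit_cis \<theta> * \<zeta>) \<partial>disc_measure r) = (\<integral>\<^sup>+\<zeta>. g \<zeta> \<partial>disc_measure r)" for \<theta>
    by (subst (2) disc_measure_rotate[symmetric, of "unit_cis \<theta>"], simp, subst nn_integral_distr) auto
  have "(\<integral>\<^sup>+\<zeta>. (\<integral>\<^sup>+\<theta>. g (unit_cis \<theta> * \<zeta>) \<partial>unit_lborel) \<partial>disc_measure r) =
      (\<integral>\<^sup>+\<theta>. (\<integral>\<^sup>+\<zeta>. g (unit_cis \<theta> * \<zeta>) \<partial>disc_measure r) \<partial>unit_lborel)"
    by (rule Fubini') (simp add: case_prod_beta)
  also have "\<dots> = (\<integral>\<^sup>+\<zeta>. g \<zeta> \<partial>disc_measure r)"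
    using emeasure_unit_lborel by (simp add: rot)
  finally show ?thesis ..
qed

lemma integral_disc_measure_average:
  fixes g :: "complex \<Rightarrow> complex"
  assumes g: "integrable (disc_measure r) g"
  shows "integrable (disc_measure r) (\<lambda>\<zeta>. \<integral>\<theta>. g (unit_cis \<theta> * \<zeta>) \<partial>unit_lborel)"
    and "(\<integral>\<zeta>. g \<zeta> \<partial>disc_measure r) =
      (\<integral>\<zeta>. (\<integral>\<theta>. g (unit_cis \<theta> * \<zeta>) \<partial>unit_lborel) \<partial>disc_measure r)"
proof -
  have [measurable]: "g \<in> borel_measurable borel"
    using borel_measurable_integrable[OF g] by (simp cong: measurable_cong_sets)
  interpret D: sigma_finite_measure "disc_measure r" by (rule sigma_finite_disc_measure)
  interpret U: finite_measure unit_lborel by (rule finite_measure_unit_lborel)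
  interpret pair_sigma_finite unit_lborel "disc_measure r" ..
  have d: "distr (disc_measure r) borel ((*) (unit_cis \<theta>)) = disc_measure r" for \<theta>
    by (rule disc_measure_rotate) simp
  have rot: "(\<integral>\<zeta>. h (unit_cis \<theta> * \<zeta>) \<partial>disc_measure r) = (\<integral>\<zeta>. h \<zeta> \<partial>disc_measure r)"
    if [measurable]: "h \<in> borel_measurable borel" for \<theta> and h :: "complex \<Rightarrow> 'b :: {banach, second_countable_topology}"
    by (subst (2) d[symmetric, of \<theta>], subst integral_distr) auto
  have roti: "integrable (disc_measure r) (\<lambda>\<zeta>. g (unit_cis \<theta> * \<zeta>))" for \<theta>
    using g by (subst (asm) d[symmetric, of \<theta>], subst (asm) integrable_distr_eq) auto
  \<comment> \<open>Absolute integrability on the product: all rotations of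
    \<open>norm (g z)\<close> have the same integral, and the angles have finite total mass.\<close>
  have int: "integrable (unit_lborel \<Otimes>\<^sub>M disc_measure r) (case_prod (\<lambda>\<theta> \<zeta>. g (unit_cis \<theta> * \<zeta>)))"
  proof (rule Fubini_integrable)
    show "(\<lambda>(\<theta>, \<zeta>). g (unit_cis \<theta> * \<zeta>)) \<in> borel_measurable (unit_lborel \<Otimes>\<^sub>M disc_measure r)"
      by (simp add: case_prod_beta)
  qed (simp_all add: rot[of "\<lambda>z. norm (g z)"] roti)
  show "integrable (disc_measure r) (\<lambda>\<zeta>. \<integral>\<theta>. g (unit_cis \<theta> * \<zeta>) \<partial>unit_lborel)"
    by (rule integrable_snd[OF int])
  have "(\<integral>\<zeta>. (\<integral>\<theta>. g (unit_cis \<theta> * \<zeta>) \<partial>unit_lborel) \<partial>disc_measure r) =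
      (\<integral>\<theta>. (\<integral>\<zeta>. g (unit_cis \<theta> * \<zeta>) \<partial>disc_measure r) \<partial>unit_lborel)"
    by (rule Fubini_integral[OF int])
  also have "\<dots> = (\<integral>\<zeta>. g \<zeta> \<partial>disc_measure r)"
    using emeasure_unit_lborel by (simp add: rot measure_def)
  finally show "(\<integral>\<zeta>. g \<zeta> \<partial>disc_measure r) =
      (\<integral>\<zeta>. (\<integral>\<theta>. g (unit_cis \<theta> * \<zeta>) \<partial>unit_lborel) \<partial>disc_measure r)" ..
qed

text \<open>With \<open>x = z \<zeta>\<^sup>*\<close> (conjugate), this is \<open>\<pi>\<close> times the Bergman kernel of the disc with the weight
  \<open>|\<zeta>|\<close> to the power \<open>s - 2\<close>: the sum of \<open>(n + s/2) x\<^sup>n\<close> over \<open>n \<ge> 0\<close>.\<close>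

definition disc_kernel :: "real \<Rightarrow> complex \<Rightarrow> complex" where
  "disc_kernel s x = (x + of_real (s / 2) * (1 - x)) / (1 - x)\<^sup>2"

lemma measurable_disc_kernel [measurable]: "disc_kernel s \<in> borel_measurable borel"
  unfolding disc_kernel_def by measurable

lemma disc_kernel_cnj: "cnj (disc_kernel s x) = disc_kernel s (cnj x)"
  by (simp add: disc_kernel_def)

text \<open>The constant is 1 + 2: the numerator is at most \<open>|x|\<close> plus
  \<open>s / 2\<close> times \<open>|1 - x|\<close>, where \<open>s / 2 \<le> 1\<close> and
  \<open>|1 - x| \<le> 2\<close>.\<close>

lemma norm_disc_kernel_le:
  assumes "0 < s" "s \<le> 2" "cmod x < 1"
  shows "cmod (disc_kernel s x) \<le> 3 / (cmod (1 - x))\<^sup>2"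
proof -
  have "cmod (1 - x) \<le> 1 + cmod x" using norm_triangle_ineq4[of 1 x] by simp
  then have "s / 2 * cmod (1 - x) \<le> 1 * 2"
    using assms by (intro mult_mono) auto
  then have "cmod (x + of_real (s / 2) * (1 - x)) \<le> 3"
    using norm_triangle_ineq[of x "of_real (s / 2) * (1 - x)"] assms by (simp add: norm_mult)
  then show ?thesis
    by (simp add: disc_kernel_def norm_divide norm_power divide_right_mono)
qed

lemma norm_mult_cnj_less_1:
  assumes "z \<in> ball 0 1" "\<zeta> \<in> ball 0 1"
  shows "cmod (z * cnj \<zeta>) < 1"
  using mult_strict_mono'[of "cmod z" 1 "cmod \<zeta>" 1] assms by (simp add: norm_mult)

text \<open>A bound independent of \<open>\<zeta>\<close>. It is too crude for norm estimates but
  shows that, for fixed \<open>z\<close>, the kernel times an integrable function is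
  integrable.\<close>

lemma norm_disc_kernel_le':
  assumes "0 < s" "s \<le> 2" "z \<in> ball 0 1" "\<zeta> \<in> ball 0 1"
  shows "cmod (disc_kernel s (z * cnj \<zeta>)) \<le> 3 / (1 - cmod z)\<^sup>2"
proof -
  have "cmod z * cmod \<zeta> \<le> cmod z"
    using assms by (intro mult_left_le) auto
  then have "1 - cmod z \<le> cmod (1 - z * cnj \<zeta>)"
    using norm_triangle_ineq2[of 1 "z * cnj \<zeta>"] by (simp add: norm_mult)
  then have "3 / (cmod (1 - z * cnj \<zeta>))\<^sup>2 \<le> 3 / (1 - cmod z)\<^sup>2"
    using assms by (intro divide_left_mono power_mono mult_pos_pos) (auto intro: less_le_trans)
  then show ?thesis
    using norm_disc_kernel_le[OF assms(1,2) norm_mult_cnj_less_1[OF assms(3,4)]] by linarith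
qed

text \<open>On the unit circle the conjugate of \<open>\<xi>\<close> is \<open>1 / \<xi>\<close>.
  With \<open>v = z * cnj \<zeta>\<close>, the kernel divided by \<open>\<xi>\<close> is therefore
  \<open>v / (\<xi> - v)\<^sup>2 + (s / 2) / (\<xi> - v)\<close>. Cauchy's formulas for the first
  derivative and for the value of \<open>\<gamma>\<close> at \<open>v\<close> give the two terms,
  and \<open>v * \<zeta> = w\<close>.\<close>

lemma disc_kernel_circle_mean:
  assumes z: "z \<in> ball 0 1" and \<zeta>: "\<zeta> \<in> ball 0 1" and g: "g holomorphic_on ball 0 1"
    and [measurable]: "g \<in> borel_measurable borel"
  defines "w \<equiv> z * of_real ((cmod \<zeta>)\<^sup>2)"
  shows "(\<integral>\<theta>. disc_kernel s (z * cnj (unit_cis \<theta> * \<zeta>)) * g (unit_cis \<theta> * \<zeta>) \<partial>unit_lborel) =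
    w * deriv g w + of_real (s / 2) * g w"
proof -
  define v where "v = z * cnj \<zeta>"
  define \<gamma> where "\<gamma> = (\<lambda>\<xi>. g (\<xi> * \<zeta>))"
  have v: "cmod v < 1" unfolding v_def by (rule norm_mult_cnj_less_1[OF z \<zeta>])
  have vz: "v * \<zeta> = w" by (simp add: v_def w_def mult_ac flip: complex_norm_square)
  have sub: "\<xi> * \<zeta> \<in> ball 0 1" if "cmod \<xi> \<le> 1" for \<xi>
    using mult_right_mono[OF that, of "cmod \<zeta>"] \<zeta> by (simp add: norm_mult)
  have hol: "\<gamma> holomorphic_on cball 0 1"
    unfolding \<gamma>_def using sub
    by (intro holomorphic_on_compose_gen[OF _ g, unfolded o_def] holomorphic_intros) auto
  have cont: "continuous_on (cball 0 1) \<gamma>" by (rule holomorphic_on_imp_continuous_on[OF hol])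
  have holb: "\<gamma> holomorphic_on ball 0 1" by (rule holomorphic_on_subset[OF hol]) auto
  have wb: "w \<in> ball 0 1" using sub[of v] v vz by simp
  have "(g has_field_derivative deriv g w) (at (v * \<zeta>))"
    unfolding vz using g wb by (intro holomorphic_derivI) auto
  then have "(\<gamma> has_field_derivative deriv g w * \<zeta>) (at v)"
    unfolding \<gamma>_def by (intro DERIV_chain2[where f=g]) (auto intro!: derivative_eq_intros)
  then have d: "deriv \<gamma> v = deriv g w * \<zeta>" by (rule DERIV_imp_deriv)
  have 1: "((\<lambda>u. \<gamma> u / (u - v)\<^sup>2) has_contour_integral (2 * pi * \<i> * (deriv g w * \<zeta>))) (circlepath 0 1)"
    using Cauchy_has_contour_integral_higher_derivative_circlepath[OF cont holb, of v 1] v d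
    by (simp add: numeral_2_eq_2)
  have 2: "((\<lambda>u. \<gamma> u / (u - v)) has_contour_integral (2 * pi * \<i> * g w)) (circlepath 0 1)"
    using Cauchy_integral_circlepath_simple[OF hol, of v] v by (simp add: \<gamma>_def vz)
  have "((\<lambda>u. v * (\<gamma> u / (u - v)\<^sup>2) + of_real (s / 2) * (\<gamma> u / (u - v))) has_contour_integral
      (v * (2 * pi * \<i> * (deriv g w * \<zeta>)) + of_real (s / 2) * (2 * pi * \<i> * g w))) (circlepath 0 1)"
    by (intro has_contour_integral_add has_contour_integral_lmul 1 2)
  also have "v * (2 * pi * \<i> * (deriv g w * \<zeta>)) + of_real (s / 2) * (2 * pi * \<i> * g w) =
      2 * pi * \<i> * (w * deriv g w + of_real (s / 2) * g w)"
    by (simp add: algebra_simps flip: vz)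
  finally have int: "((\<lambda>\<xi>. disc_kernel s (z * cnj (\<xi> * \<zeta>)) * g (\<xi> * \<zeta>) / \<xi>) has_contour_integral
      2 * pi * \<i> * (w * deriv g w + of_real (s / 2) * g w)) (circlepath 0 1)"
  proof (rule has_contour_integral_eq)
    fix \<xi> :: complex assume "\<xi> \<in> path_image (circlepath 0 1)"
    then have \<xi>: "cmod \<xi> = 1" by simp
    then have nz: "\<xi> \<noteq> 0" by auto
    have "\<xi> * cnj \<xi> = 1" using \<xi> by (simp flip: complex_norm_square)
    with nz have c: "cnj \<xi> = 1 / \<xi>" by (simp add: eq_divide_eq mult.commute)
    have "z * cnj (\<xi> * \<zeta>) = v / \<xi>" by (simp add: c v_def)
    moreover have "disc_kernel s (v / \<xi>) / \<xi> = v / (\<xi> - v)\<^sup>2 + of_real (s / 2) / (\<xi> - v)"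
    proof -
      define d where "d = \<xi> - v"
      define c where "c = complex_of_real (s / 2)"
      have "1 - v / \<xi> = d / \<xi>" using nz by (simp add: d_def diff_divide_distrib)
      then have "disc_kernel s (v / \<xi>) / \<xi> = (v / \<xi> + c * (d / \<xi>)) / (d / \<xi>)\<^sup>2 / \<xi>"
        unfolding disc_kernel_def c_def by simp
      also have "\<dots> = ((v + c * d) / \<xi>) / (d / \<xi>)\<^sup>2 / \<xi>" by (simp add: add_divide_distrib)
      also have "\<dots> = (v + c * d) / d\<^sup>2" using nz by (simp add: power2_eq_square)
      also have "\<dots> = v / d\<^sup>2 + c / d" by (simp add: add_divide_distrib power2_eq_square)
      finally show ?thesis unfolding d_def c_def .
    qed
    ultimately show "v * (\<gamma> \<xi> / (\<xi> - v)\<^sup>2) + of_real (s / 2) * (\<gamma> \<xi> / (\<xi> - v)) =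
        disc_kernel s (z * cnj (\<xi> * \<zeta>)) * g (\<xi> * \<zeta>) / \<xi>"
    proof -
      assume eq: "z * cnj (\<xi> * \<zeta>) = v / \<xi>"
        and *: "disc_kernel s (v / \<xi>) / \<xi> = v / (\<xi> - v)\<^sup>2 + of_real (s / 2) / (\<xi> - v)"
      have "disc_kernel s (z * cnj (\<xi> * \<zeta>)) * g (\<xi> * \<zeta>) / \<xi> = (disc_kernel s (v / \<xi>) / \<xi>) * \<gamma> \<xi>"
        unfolding eq by (simp add: \<gamma>_def)
      then show ?thesis unfolding * by (simp add: distrib_right)
    qed
  qed
  have "1 - z * cnj (\<xi> * \<zeta>) \<noteq> 0" if "cmod \<xi> = 1" for \<xi>
    using norm_mult_cnj_less_1[OF z sub, of \<xi>] that
    by (metis norm_one less_irrefl order_refl right_minus_eq)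
  then have "continuous_on (sphere 0 1) (\<lambda>\<xi>. disc_kernel s (z * cnj (\<xi> * \<zeta>)) * \<gamma> \<xi>)"
    unfolding disc_kernel_def
    by (intro continuous_intros continuous_on_subset[OF cont]) auto
  from circle_mean(2)[OF _ this[unfolded \<gamma>_def] int] show ?thesis by simp
qed

text \<open>With \<open>v = z * cnj \<zeta>\<close>, the integrand divided by \<open>\<xi>\<close>
  equals \<open>1 / ((1 - cnj v * \<xi>) * (\<xi> - v))\<close> on the unit circle. Cauchy's formula
  at \<open>v\<close> for the holomorphic factor \<open>1 / (1 - cnj v * \<xi>)\<close> yields
  \<open>1 / (1 - |v|\<^sup>2)\<close>.\<close>

lemma Poisson_circle_mean:
  assumes z: "z \<in> ball 0 1" and \<zeta>: "\<zeta> \<in> ball 0 1"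
  shows "(\<integral>\<^sup>+\<theta>. ennreal (1 / (cmod (1 - z * cnj (unit_cis \<theta> * \<zeta>)))\<^sup>2) \<partial>unit_lborel) =
    ennreal (1 / (1 - (cmod z)\<^sup>2 * (cmod \<zeta>)\<^sup>2))"
proof -
  define v where "v = z * cnj \<zeta>"
  define f where "f = (\<lambda>\<xi>. 1 / (cmod (1 - z * cnj (\<xi> * \<zeta>)))\<^sup>2)"
  have v: "cmod v < 1" unfolding v_def by (rule norm_mult_cnj_less_1[OF z \<zeta>])
  have nz1: "1 - cnj v * \<xi> \<noteq> 0" if "cmod \<xi> \<le> 1" for \<xi>
    using mult_left_mono[OF that, of "cmod v"] v norm_mult[of "cnj v" \<xi>] by force
  have "(\<lambda>\<xi>. 1 / (1 - cnj v * \<xi>)) holomorphic_on cball 0 1"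
    using nz1 by (intro holomorphic_intros) auto
  moreover have "cnj v * v = of_real ((cmod z)\<^sup>2 * (cmod \<zeta>)\<^sup>2)"
    by (simp add: v_def complex_norm_square mult_ac del: of_real_power)
  ultimately have "((\<lambda>\<xi>. 1 / (1 - cnj v * \<xi>) / (\<xi> - v)) has_contour_integral
      2 * pi * \<i> * of_real (1 / (1 - (cmod z)\<^sup>2 * (cmod \<zeta>)\<^sup>2))) (circlepath 0 1)"
    using Cauchy_integral_circlepath_simple[of "\<lambda>\<xi>. 1 / (1 - cnj v * \<xi>)" 0 1 v] v by simp
  then have int: "((\<lambda>\<xi>. of_real (f \<xi>) / \<xi>) has_contour_integral
      2 * pi * \<i> * of_real (1 / (1 - (cmod z)\<^sup>2 * (cmod \<zeta>)\<^sup>2))) (circlepath 0 1)"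
  proof (rule has_contour_integral_eq)
    fix \<xi> :: complex assume "\<xi> \<in> path_image (circlepath 0 1)"
    then have \<xi>: "cmod \<xi> = 1" by simp
    then have nz: "\<xi> \<noteq> 0" by auto
    have "\<xi> * cnj \<xi> = 1" using \<xi> by (simp flip: complex_norm_square)
    with nz have c: "cnj \<xi> = 1 / \<xi>" by (simp add: eq_divide_eq mult.commute)
    have "of_real ((cmod (1 - z * cnj (\<xi> * \<zeta>)))\<^sup>2) = (1 - z * cnj (\<xi> * \<zeta>)) * cnj (1 - z * cnj (\<xi> * \<zeta>))"
      by (rule complex_norm_square)
    also have "\<dots> = (1 - v / \<xi>) * (1 - cnj v * \<xi>)" by (simp add: v_def c)
    finally have "complex_of_real (f \<xi>) = 1 / ((1 - v / \<xi>) * (1 - cnj v * \<xi>))"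
      unfolding f_def by simp
    moreover have "1 - v / \<xi> = (\<xi> - v) / \<xi>" using nz by (simp add: field_simps)
    ultimately show "1 / (1 - cnj v * \<xi>) / (\<xi> - v) = complex_of_real (f \<xi>) / \<xi>"
      using nz by simp
  qed
  have "1 - z * cnj (\<xi> * \<zeta>) \<noteq> 0" if "cmod \<xi> = 1" for \<xi>
  proof -
    have "\<xi> * \<zeta> \<in> ball 0 1" using that \<zeta> by (simp add: norm_mult)
    from norm_mult_cnj_less_1[OF z this] show ?thesis
      by (metis norm_one less_irrefl right_minus_eq)
  qed
  then have "continuous_on (sphere 0 1) f"
    unfolding f_def by (intro continuous_intros) auto
  then have "continuous_on (sphere 0 1) (\<lambda>\<xi>. complex_of_real (f \<xi>))" by (intro continuous_intros)
  from circle_mean[OF _ this int]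
  have "integrable unit_lborel (\<lambda>\<theta>. f (unit_cis \<theta>))"
    and "(\<integral>\<theta>. f (unit_cis \<theta>) \<partial>unit_lborel) = 1 / (1 - (cmod z)\<^sup>2 * (cmod \<zeta>)\<^sup>2)"
    unfolding integral_complex_of_real of_real_eq_iff complex_of_real_integrable_eq
    by (simp_all add: f_def)
  then show ?thesis
    unfolding f_def by (subst nn_integral_eq_integral) auto
qed

text \<open>Averaging over rotations leaves a function of \<open>u = |\<zeta>|\<^sup>2\<close>
  alone, integrated against \<open>pi * u powr (s / 2 - 1)\<close>. The resulting integrand is
  \<open>pi\<close> times the derivative of \<open>u powr (s / 2) * g (u * z)\<close>, so the
  integral is \<open>pi * g z\<close> by the fundamental theorem of calculus.\<close>

lemma disc_kernel_reproducing:
  fixes g :: "complex \<Rightarrow> complex"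
  assumes s: "0 < s" "s \<le> 2" and z: "z \<in> ball 0 1" and g: "g holomorphic_on ball 0 1"
    and ig: "integrable (disc_measure (s - 2)) g"
  shows "integrable (disc_measure (s - 2)) (\<lambda>\<zeta>. disc_kernel s (z * cnj \<zeta>) * g \<zeta>)"
    and "(\<integral>\<zeta>. disc_kernel s (z * cnj \<zeta>) * g \<zeta> \<partial>disc_measure (s - 2)) = pi * g z"
proof -
  have [measurable]: "g \<in> borel_measurable borel"
    using borel_measurable_integrable[OF ig] by (simp cong: measurable_cong_sets)
  show int: "integrable (disc_measure (s - 2)) (\<lambda>\<zeta>. disc_kernel s (z * cnj \<zeta>) * g \<zeta>)"
  proof (rule Bochner_Integration.integrable_bound)
    show "integrable (disc_measure (s - 2)) (\<lambda>\<zeta>. complex_of_real (3 / (1 - cmod z)\<^sup>2) * g \<zeta>)"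
      using ig by (rule integrable_mult_right)
    show "AE \<zeta> in disc_measure (s - 2). cmod (disc_kernel s (z * cnj \<zeta>) * g \<zeta>)
        \<le> cmod (complex_of_real (3 / (1 - cmod z)\<^sup>2) * g \<zeta>)"
      using AE_disc_measure
    proof eventually_elim
      case (elim \<zeta>)
      then have "cmod (disc_kernel s (z * cnj \<zeta>)) \<le> 3 / (1 - cmod z)\<^sup>2"
        by (intro norm_disc_kernel_le' s z) auto
      then show ?case unfolding norm_mult norm_of_real by (intro mult_right_mono) auto
    qed
  qed measurable
  \<comment> \<open>The circle mean found above, with \<open>w = u * z\<close>.\<close>
  define \<Lambda> where "\<Lambda> = (\<lambda>u. of_real u * z * deriv g (of_real u * z) + of_real (s / 2) * g (of_real u * z))"
  define h where "h = (\<lambda>u :: real. indicator {0<..<1} u *\<^sub>R \<Lambda> u)"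
  have uz: "of_real u * z \<in> ball 0 1" if "0 \<le> u" "u \<le> 1" for u
    using mult_right_mono[OF that(2), of "cmod z"] that z by (simp add: norm_mult)
  have "deriv g holomorphic_on ball 0 1" using g by (intro holomorphic_deriv) auto
  then have cont_d: "continuous_on (ball 0 1) (deriv g)" by (rule holomorphic_on_imp_continuous_on)
  have cont_g: "continuous_on (ball 0 1) g" using g by (rule holomorphic_on_imp_continuous_on)
  have "continuous_on {0<..<1} \<Lambda>"
    unfolding \<Lambda>_def
    by (intro continuous_intros continuous_on_compose2[OF cont_d] continuous_on_compose2[OF cont_g])
      (use uz in auto)
  then have [measurable]: "h \<in> borel_measurable borel"
    unfolding h_def by (intro borel_measurable_continuous_on_indicator) auto
  have mean: "AE \<zeta> in disc_measure (s - 2).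
      (\<integral>\<theta>. disc_kernel s (z * cnj (unit_cis \<theta> * \<zeta>)) * g (unit_cis \<theta> * \<zeta>) \<partial>unit_lborel) = h ((cmod \<zeta>)\<^sup>2)"
    using AE_disc_measure
  proof eventually_elim
    case (elim \<zeta>)
    then have "cmod \<zeta> < 1" "\<zeta> \<noteq> 0" by auto
    then have "(cmod \<zeta>)\<^sup>2 \<in> {0<..<1}" by (simp add: abs_square_less_1)
    then show ?case
      using disc_kernel_circle_mean[OF z _ g, of \<zeta> s] elim
      by (simp add: h_def \<Lambda>_def mult.commute)
  qed
  note av = integral_disc_measure_average[OF int]
  have mav: "(\<lambda>\<zeta>. \<integral>\<theta>. disc_kernel s (z * cnj (unit_cis \<theta> * \<zeta>)) * g (unit_cis \<theta> * \<zeta>) \<partial>unit_lborel)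
      \<in> borel_measurable (disc_measure (s - 2))"
    by (rule borel_measurable_integrable[OF av(1)])
  have mh: "(\<lambda>\<zeta>. h ((cmod \<zeta>)\<^sup>2)) \<in> borel_measurable (disc_measure (s - 2))" by measurable
  have ih: "integrable (disc_measure (s - 2)) (\<lambda>\<zeta>. h ((cmod \<zeta>)\<^sup>2))"
    using av(1) by (subst (asm) integrable_cong_AE[OF mav mh mean])
  have eq1: "(\<integral>\<zeta>. disc_kernel s (z * cnj \<zeta>) * g \<zeta> \<partial>disc_measure (s - 2)) = (\<integral>\<zeta>. h ((cmod \<zeta>)\<^sup>2) \<partial>disc_measure (s - 2))"
    unfolding av(2) by (rule integral_cong_AE[OF mav mh mean])
  let ?\<rho> = "\<lambda>u. pi * indicator {0<..<1} u * u powr ((s - 2) / 2)"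
  have "integrable (distr (disc_measure (s - 2)) borel (\<lambda>\<zeta>. (cmod \<zeta>)\<^sup>2)) h"
    using ih by (subst integrable_distr_eq) auto
  then have i2: "integrable lborel (\<lambda>u. ?\<rho> u *\<^sub>R h u)"
    unfolding distr_disc_measure_cmod_square by (subst (asm) integrable_density) auto
  have "(\<integral>\<zeta>. h ((cmod \<zeta>)\<^sup>2) \<partial>disc_measure (s - 2)) = (\<integral>u. h u \<partial>distr (disc_measure (s - 2)) borel (\<lambda>\<zeta>. (cmod \<zeta>)\<^sup>2))"
    by (subst integral_distr) auto
  also have "\<dots> = (\<integral>u. ?\<rho> u *\<^sub>R h u \<partial>lborel)"
    unfolding distr_disc_measure_cmod_square by (subst integral_density) auto
  also have "\<dots> = integral UNIV (\<lambda>u. ?\<rho> u *\<^sub>R h u)"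
    using i2 by (rule integral_lborel[symmetric])
  also have "\<dots> = integral {0..1} (\<lambda>u. pi *\<^sub>R (u powr (s / 2 - 1) *\<^sub>R \<Lambda> u))"
  proof -
    have "integral UNIV (\<lambda>u. ?\<rho> u *\<^sub>R h u) = integral UNIV (\<lambda>u. if u \<in> {0<..<1} then pi *\<^sub>R (u powr (s / 2 - 1) *\<^sub>R \<Lambda> u) else 0)"
      by (rule arg_cong2[where f=integral]) (auto simp: h_def diff_divide_distrib)
    then show ?thesis
      by (subst (asm) integral_restrict_UNIV) (simp add: integral_open_interval_real)
  qed
  also have "\<dots> = pi *\<^sub>R g z"
  proof -
    have "((\<lambda>u. u powr (s / 2 - 1) *\<^sub>R \<Lambda> u) has_integral
        (1 powr (s / 2) *\<^sub>R g (of_real 1 * z) - 0 powr (s / 2) *\<^sub>R g (of_real 0 * z))) {0..1}"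
    \<comment> \<open>The interior version is used because \<open>u powr (s / 2)\<close> need not be
      differentiable at 0. It is continuous there with value 0, as \<open>s > 0\<close>, so the
      lower endpoint contributes nothing.\<close>
    proof (rule fundamental_theorem_of_calculus_interior)
      show "continuous_on {0..1} (\<lambda>u. u powr (s / 2) *\<^sub>R g (complex_of_real u * z))"
        using s uz by (intro continuous_intros continuous_on_powr' continuous_on_compose2[OF cont_g]) auto
      fix u :: real assume u: "u \<in> {0<..<1}"
      have dg: "(g has_field_derivative deriv g (of_real u * z)) (at (of_real u * z))"
        using g uz[of u] u by (intro holomorphic_derivI) auto
      have "((\<lambda>u. complex_of_real u * z) has_vector_derivative z) (at u)"
        by (auto intro!: derivative_eq_intros)
      from field_vector_diff_chain_at[OF this dg]
      have 1: "((\<lambda>u. g (complex_of_real u * z)) has_vector_derivative z * deriv g (of_real u * z)) (at u)"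
        by (simp add: o_def)
      have "((\<lambda>u. u powr (s / 2)) has_real_derivative (s / 2) * u powr (s / 2 - 1)) (at u)"
        using u by (auto intro!: derivative_eq_intros)
      then have 2: "((\<lambda>u. u powr (s / 2)) has_field_derivative (s / 2) * u powr (s / 2 - 1)) (at u)" .
      have "((\<lambda>u. u powr (s / 2) *\<^sub>R g (complex_of_real u * z)) has_vector_derivative
          (u powr (s / 2) *\<^sub>R (z * deriv g (of_real u * z)) + ((s / 2) * u powr (s / 2 - 1)) *\<^sub>R g (of_real u * z))) (at u)"
        by (rule has_vector_derivative_scaleR[OF 2 1])
      moreover have "u powr (s / 2) = u powr (s / 2 - 1) * u" using u by (simp add: powr_diff)
      ultimately show "((\<lambda>u. u powr (s / 2) *\<^sub>R g (complex_of_real u * z)) has_vector_derivative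
          u powr (s / 2 - 1) *\<^sub>R \<Lambda> u) (at u)"
        by (simp add: \<Lambda>_def scaleR_conv_of_real algebra_simps)
    qed simp
    then have "integral {0..1} (\<lambda>u. u powr (s / 2 - 1) *\<^sub>R \<Lambda> u) = g z"
      using s by (intro integral_unique) simp
    then show ?thesis by (simp only: integral_cmul)
  qed
  finally show "(\<integral>\<zeta>. disc_kernel s (z * cnj \<zeta>) * g \<zeta> \<partial>disc_measure (s - 2)) = pi * g z"
    using eq1 by (simp add: scaleR_conv_of_real)
qed

section \<open>Forelli-Rudin estimates and the Schur test\<close>

text \<open>Split at \<open>u = 1/2\<close>. On the left only \<open>u powr \<alpha>\<close> is
  singular, and it is integrable. On the right put \<open>v = 1 - u\<close> and
  \<open>d = 1 - r\<close>; then \<open>1 - r * u\<close> is at least both \<open>d\<close> and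
  \<open>v\<close>. Using \<open>d\<close> for \<open>v \<le> d\<close> leaves the power
  \<open>-a\<close>, integrable at 0 as \<open>a < 1\<close>; using \<open>v\<close> beyond leaves
  the power \<open>-a - 1\<close>, integrable at infinity as \<open>a > 0\<close>. Both pieces scale
  like \<open>d powr (-a)\<close>.\<close>

lemma powr_integral_estimate:
  fixes \<alpha> a :: real
  assumes \<alpha>: "\<alpha> > -1" and a: "0 < a" "a < 1"
  obtains C where "C > 0" "\<And>r. 0 \<le> r \<Longrightarrow> r < 1 \<Longrightarrow>
    (\<integral>\<^sup>+u. ennreal (indicator {0<..<1} u * (u powr \<alpha> * ((1 - u) powr (-a) / (1 - r * u)))) \<partial>lborel)
      \<le> ennreal (C * (1 - r) powr (-a))"
proof
  \<comment> \<open>\<open>K\<close> bounds the factor other than \<open>u powr \<alpha>\<close> for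
    \<open>u \<le> 1/2\<close>, and \<open>M\<close> bounds \<open>u powr \<alpha>\<close> for
    \<open>1/2 \<le> u < 1\<close>. \<open>A\<close> is the integral of
    \<open>u powr \<alpha>\<close> over the left half; \<open>B\<close> collects the two integrals
    of the right half, up to the factor \<open>d powr (-a)\<close>.\<close>
  define K where "K = 2 * (1/2) powr (-a)"
  define M where "M = max 1 ((1/2) powr \<alpha>)"
  define A where "A = (1/2) powr (\<alpha> + 1) / (\<alpha> + 1)"
  define B where "B = 1 / (1 - a) + 1 / a"
  have pos: "K > 0" "M > 0" "A > 0" "B > 0"
    using \<alpha> a by (auto simp: K_def M_def A_def B_def max_def intro!: add_pos_pos)
  show "K * A + M * B > 0" using pos by (simp add: add_pos_pos)
  fix r :: real assume r: "0 \<le> r" "r < 1"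
  define d where "d = 1 - r"
  have d: "0 < d" "d \<le> 1" using r by (auto simp: d_def)
  let ?f = "\<lambda>v. indicator {0..d} v * (v powr (-a)) / d + indicator {d..} v * v powr (-a - 1)"
  have bound: "indicator {0<..<1} u * (u powr \<alpha> * ((1 - u) powr (-a) / (1 - r * u))) \<le>
      K * (indicator {0..1/2} u * u powr \<alpha>) + M * ?f (1 - u)" for u
  proof (cases "u \<in> {0<..<1}")
    case u: True
    have ru: "r * u \<le> r" "r * u \<le> u" "r * u < 1"
      using u r mult_left_mono[of u 1 r] mult_right_mono[of r 1 u] by auto
    have f0: "?f (1 - u) \<ge> 0" using d by (intro add_nonneg_nonneg) auto
    show ?thesis
    proof (cases "u \<le> 1/2")
      case True
      have "(1 - u) powr (-a) \<le> (1/2) powr (-a)" using a u True by (intro powr_mono2') auto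
      moreover have "1/2 \<le> 1 - r * u" using True ru by linarith
      ultimately have "(1 - u) powr (-a) / (1 - r * u) \<le> (1/2) powr (-a) / (1/2)"
        by (intro frac_le) auto
      then have "u powr \<alpha> * ((1 - u) powr (-a) / (1 - r * u)) \<le> u powr \<alpha> * K"
        unfolding K_def by (intro mult_left_mono) auto
      moreover have "0 \<le> M * ?f (1 - u)" using f0 pos by (intro mult_nonneg_nonneg) auto
      ultimately have "u powr \<alpha> * ((1 - u) powr (-a) / (1 - r * u)) \<le> K * u powr \<alpha> + M * ?f (1 - u)"
        by (simp only: mult.commute[of K])
      then show ?thesis using u True by simp
    next
      case False
      have "u powr \<alpha> \<le> M"
      proof (cases "\<alpha> \<ge> 0")
        case True
        then have "u powr \<alpha> \<le> 1" using u powr_mono2[of \<alpha> u 1] by auto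
        then show ?thesis by (simp add: M_def)
      next
        case f: False
        have "u powr \<alpha> \<le> (1/2) powr \<alpha>" using f False by (intro powr_mono2') auto
        then show ?thesis by (simp add: M_def)
      qed
      moreover have "(1 - u) powr (-a) / (1 - r * u) \<le> ?f (1 - u)"
      proof (cases "1 - u \<le> d")
        case True
        have "(1 - u) powr (-a) / (1 - r * u) \<le> (1 - u) powr (-a) / d"
          using ru d by (intro divide_left_mono mult_pos_pos) (auto simp: d_def)
        also have "\<dots> \<le> ?f (1 - u)" using True u d by auto
        finally show ?thesis .
      next
        case c: False
        have "(1 - u) powr (-a) / (1 - r * u) \<le> (1 - u) powr (-a) / (1 - u)"
          using ru u by (intro divide_left_mono mult_pos_pos) auto
        also have "\<dots> = (1 - u) powr (-a - 1)" using u by (simp add: powr_diff)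
        also have "\<dots> \<le> ?f (1 - u)" using c d by auto
        finally show ?thesis .
      qed
      ultimately have "u powr \<alpha> * ((1 - u) powr (-a) / (1 - r * u)) \<le> M * ?f (1 - u)"
        using pos ru by (intro mult_mono) auto
      then show ?thesis using u False by simp
    qed
  next
    case False
    have "?f (1 - u) \<ge> 0" using d by (intro add_nonneg_nonneg) auto
    then have "0 \<le> M * ?f (1 - u)" by (rule mult_nonneg_nonneg[OF less_imp_le[OF pos(2)]])
    moreover have "0 \<le> K * (indicator {0..1/2} u * u powr \<alpha>)" using pos by simp
    ultimately have "0 \<le> K * (indicator {0..1/2} u * u powr \<alpha>) + M * ?f (1 - u)" by (rule add_nonneg_nonneg[rotated])
    then show ?thesis using False by simp
  qed
  have i1: "(\<integral>\<^sup>+u. ennreal (indicator {0..1/2} u * u powr \<alpha>) \<partial>lborel) = ennreal A"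
    using has_integral_powr_from_0[OF \<alpha>, of "1/2"]
    by (subst nn_integral_has_integral_lebesgue[where I=A]) (auto simp: A_def)
  have i2: "(\<integral>\<^sup>+u. ennreal (indicator {0..d} u * u powr (-a)) \<partial>lborel) = ennreal (d powr (-a + 1) / (-a + 1))"
    using has_integral_powr_from_0[of "-a" d] a d
    by (subst nn_integral_has_integral_lebesgue[where I="d powr (-a + 1) / (-a + 1)"]) auto
  have i3: "(\<integral>\<^sup>+u. ennreal (indicator {d..} u * u powr (-a - 1)) \<partial>lborel) = ennreal (d powr (-a) / a)"
    using has_integral_powr_to_inf[of "-a - 1" d] a d
    by (subst nn_integral_has_integral_lebesgue[where I="d powr (-a) / a"]) auto
  have i4: "(\<integral>\<^sup>+v. ennreal (?f v) \<partial>lborel) = ennreal (B * d powr (-a))"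
  proof -
    have "(\<integral>\<^sup>+v. ennreal (?f v) \<partial>lborel) =
        (\<integral>\<^sup>+v. ennreal (1 / d) * ennreal (indicator {0..d} v * v powr (-a)) + ennreal (indicator {d..} v * v powr (-a - 1)) \<partial>lborel)"
      using d by (intro nn_integral_cong) (simp flip: ennreal_mult' ennreal_plus)
    also have "\<dots> = ennreal (1 / d) * ennreal (d powr (-a + 1) / (-a + 1)) + ennreal (d powr (-a) / a)"
      by (subst nn_integral_add) (auto simp: nn_integral_cmult i2 i3)
    also have "\<dots> = ennreal (1 / d * (d powr (-a + 1) / (-a + 1)) + d powr (-a) / a)"
      using a d by (simp flip: ennreal_mult' ennreal_plus)
    also have "d powr (-a + 1) = d powr (-a) * d" by (subst powr_add) (use d in simp)
    also have "1 / d * (d powr (-a) * d / (-a + 1)) = d powr (-a) / (1 - a)" using d by simp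
    also have "d powr (-a) / (1 - a) + d powr (-a) / a = B * d powr (-a)"
      by (simp add: B_def algebra_simps)
    finally show ?thesis .
  qed
  have "(\<integral>\<^sup>+u. ennreal (indicator {0<..<1} u * (u powr \<alpha> * ((1 - u) powr (-a) / (1 - r * u)))) \<partial>lborel)
     \<le> (\<integral>\<^sup>+u. ennreal K * ennreal (indicator {0..1/2} u * u powr \<alpha>) + ennreal M * ennreal (?f (1 - u)) \<partial>lborel)"
  proof (rule nn_integral_mono)
    fix u
    have "?f (1 - u) \<ge> 0" using d by (intro add_nonneg_nonneg) auto
    then have "ennreal K * ennreal (indicator {0..1/2} u * u powr \<alpha>) + ennreal M * ennreal (?f (1 - u)) =
        ennreal (K * (indicator {0..1/2} u * u powr \<alpha>) + M * ?f (1 - u))"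
      using pos by (subst ennreal_plus) (auto simp: ennreal_mult')
    then show "ennreal (indicator {0<..<1} u * (u powr \<alpha> * ((1 - u) powr (-a) / (1 - r * u)))) \<le>
        ennreal K * ennreal (indicator {0..1/2} u * u powr \<alpha>) + ennreal M * ennreal (?f (1 - u))"
      using bound[of u] by (simp only: ennreal_leI)
  qed
  also have "\<dots> = ennreal K * ennreal A + ennreal M * (\<integral>\<^sup>+u. ennreal (?f (1 - u)) \<partial>lborel)"
    by (subst nn_integral_add) (auto simp: nn_integral_cmult i1)
  also have "(\<integral>\<^sup>+u. ennreal (?f (1 - u)) \<partial>lborel) = (\<integral>\<^sup>+v. ennreal (?f v) \<partial>lborel)"
    by (subst (2) nn_integral_real_affine[where c="-1" and t=1]) auto
  also have "ennreal K * ennreal A + ennreal M * (\<integral>\<^sup>+v. ennreal (?f v) \<partial>lborel) = ennreal (K * A + M * (B * d powr (-a)))"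
    unfolding i4 using pos d by (simp add: ennreal_mult')
  also have "\<dots> \<le> ennreal ((K * A + M * B) * (1 - r) powr (-a))"
  proof (rule ennreal_leI)
    \<comment> \<open>The left half contributes a constant, absorbed into the growing power of
      \<open>d \<le> 1\<close>.\<close>
    have "1 \<le> d powr (-a)" using d a powr_mono2'[of "-a" d 1] by auto
    then have "K * A * 1 \<le> K * A * d powr (-a)" using pos by (intro mult_left_mono) auto
    then show "K * A + M * (B * d powr (-a)) \<le> (K * A + M * B) * (1 - r) powr (-a)"
      by (simp add: d_def algebra_simps)
  qed
  finally show "(\<integral>\<^sup>+u. ennreal (indicator {0<..<1} u * (u powr \<alpha> * ((1 - u) powr (-a) / (1 - r * u)))) \<partial>lborel)
      \<le> ennreal ((K * A + M * B) * (1 - r) powr (-a))" .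
qed

text \<open>Only the squared modulus in the denominator depends on the angle of
  \<open>\<zeta>\<close>. Its mean is the Poisson mean computed above, which leaves the
  one-dimensional estimate with \<open>r = |z|\<^sup>2\<close> and exponent
  \<open>\<delta> / 2\<close>.\<close>

lemma Forelli_Rudin_disc:
  assumes \<delta>: "\<delta> > -2" and a: "0 < a" "a < 1"
  obtains C where "C > 0" "\<And>z. z \<in> ball 0 1 \<Longrightarrow>
    (\<integral>\<^sup>+\<zeta>. ennreal (1 / (cmod (1 - z * cnj \<zeta>))\<^sup>2 * (1 - (cmod \<zeta>)\<^sup>2) powr (-a)) \<partial>disc_measure \<delta>)
      \<le> ennreal (C * (1 - (cmod z)\<^sup>2) powr (-a))"
proof -
  have "\<delta> / 2 > -1" using \<delta> by simp
  from powr_integral_estimate[OF this a] obtain C where C: "C > 0" "\<And>r. 0 \<le> r \<Longrightarrow> r < 1 \<Longrightarrow>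
    (\<integral>\<^sup>+u. ennreal (indicator {0<..<1} u * (u powr (\<delta>/2) * ((1 - u) powr (-a) / (1 - r * u)))) \<partial>lborel)
      \<le> ennreal (C * (1 - r) powr (-a))" by blast
  show ?thesis
  proof
    show "pi * C > 0" using C by simp
    fix z :: complex assume z: "z \<in> ball 0 1"
    define r where "r = (cmod z)\<^sup>2"
    have r: "0 \<le> r" "r < 1" using z by (auto simp: r_def abs_square_less_1)
    have "(\<integral>\<^sup>+\<zeta>. ennreal (1 / (cmod (1 - z * cnj \<zeta>))\<^sup>2 * (1 - (cmod \<zeta>)\<^sup>2) powr (-a)) \<partial>disc_measure \<delta>) =
        (\<integral>\<^sup>+\<zeta>. (\<integral>\<^sup>+\<theta>. ennreal (1 / (cmod (1 - z * cnj (unit_cis \<theta> * \<zeta>)))\<^sup>2 *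
          (1 - (cmod (unit_cis \<theta> * \<zeta>))\<^sup>2) powr (-a)) \<partial>unit_lborel) \<partial>disc_measure \<delta>)"
      by (rule nn_integral_disc_measure_average) measurable
    also have "\<dots> = (\<integral>\<^sup>+\<zeta>. ennreal ((1 - (cmod \<zeta>)\<^sup>2) powr (-a) / (1 - r * (cmod \<zeta>)\<^sup>2)) \<partial>disc_measure \<delta>)"
    proof (rule nn_integral_cong_AE)
      show "AE \<zeta> in disc_measure \<delta>. (\<integral>\<^sup>+\<theta>. ennreal (1 / (cmod (1 - z * cnj (unit_cis \<theta> * \<zeta>)))\<^sup>2 *
          (1 - (cmod (unit_cis \<theta> * \<zeta>))\<^sup>2) powr (-a)) \<partial>unit_lborel) =
          ennreal ((1 - (cmod \<zeta>)\<^sup>2) powr (-a) / (1 - r * (cmod \<zeta>)\<^sup>2))"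
        using AE_disc_measure
      proof eventually_elim
        case (elim \<zeta>)
        then have \<zeta>: "\<zeta> \<in> ball 0 1" by auto
        have "(\<integral>\<^sup>+\<theta>. ennreal (1 / (cmod (1 - z * cnj (unit_cis \<theta> * \<zeta>)))\<^sup>2 *
            (1 - (cmod (unit_cis \<theta> * \<zeta>))\<^sup>2) powr (-a)) \<partial>unit_lborel) =
          (\<integral>\<^sup>+\<theta>. ennreal (1 / (cmod (1 - z * cnj (unit_cis \<theta> * \<zeta>)))\<^sup>2) *
            ennreal ((1 - (cmod \<zeta>)\<^sup>2) powr (-a)) \<partial>unit_lborel)"
        proof (rule nn_integral_cong)
          fix \<theta>
          have "cmod (unit_cis \<theta> * \<zeta>) = cmod \<zeta>" by (simp add: norm_mult)
          then show "ennreal (1 / (cmod (1 - z * cnj (unit_cis \<theta> * \<zeta>)))\<^sup>2 *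
              (1 - (cmod (unit_cis \<theta> * \<zeta>))\<^sup>2) powr (-a)) =
            ennreal (1 / (cmod (1 - z * cnj (unit_cis \<theta> * \<zeta>)))\<^sup>2) * ennreal ((1 - (cmod \<zeta>)\<^sup>2) powr (-a))"
            by (simp only:) (rule ennreal_mult', simp)
        qed
        also have "\<dots> = ennreal (1 / (1 - r * (cmod \<zeta>)\<^sup>2)) * ennreal ((1 - (cmod \<zeta>)\<^sup>2) powr (-a))"
          unfolding r_def Poisson_circle_mean[OF z \<zeta>, symmetric] by (rule nn_integral_multc) measurable
        also have "\<dots> = ennreal ((1 - (cmod \<zeta>)\<^sup>2) powr (-a) / (1 - r * (cmod \<zeta>)\<^sup>2))"
          by (simp flip: ennreal_mult'')
        finally show ?case .
      qed
    qed
    also have "\<dots> = (\<integral>\<^sup>+u. ennreal (pi * indicator {0<..<1} u * u powr (\<delta> / 2)) *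
        ennreal ((1 - u) powr (-a) / (1 - r * u)) \<partial>lborel)"
      by (rule nn_integral_disc_measure_radial) measurable
    also have "\<dots> = (\<integral>\<^sup>+u. ennreal pi * ennreal (indicator {0<..<1} u * (u powr (\<delta>/2) * ((1 - u) powr (-a) / (1 - r * u)))) \<partial>lborel)"
      by (intro nn_integral_cong) (auto simp: ennreal_mult'[symmetric] mult_ac split: split_indicator)
    also have "\<dots> = ennreal pi * (\<integral>\<^sup>+u. ennreal (indicator {0<..<1} u * (u powr (\<delta>/2) * ((1 - u) powr (-a) / (1 - r * u)))) \<partial>lborel)"
      by (rule nn_integral_cmult) measurable
    also have "\<dots> \<le> ennreal pi * ennreal (C * (1 - r) powr (-a))"
      by (intro mult_left_mono C r) auto
    also have "\<dots> = ennreal (pi * C * (1 - (cmod z)\<^sup>2) powr (-a))"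
      by (simp add: r_def mult.assoc flip: ennreal_mult')
    finally show "(\<integral>\<^sup>+\<zeta>. ennreal (1 / (cmod (1 - z * cnj \<zeta>))\<^sup>2 * (1 - (cmod \<zeta>)\<^sup>2) powr (-a)) \<partial>disc_measure \<delta>)
      \<le> ennreal (pi * C * (1 - (cmod z)\<^sup>2) powr (-a))" .
  qed
qed

text \<open>Stated with upper bounds \<open>A\<close> and \<open>B\<close> in place of the
  integrals, so that the Schur test can insert its hypotheses directly. Young's inequality is
  applied after normalizing by \<open>A powr (1 / p)\<close> and \<open>B powr (1 / q)\<close>;
  \<open>A = 0\<close> cannot be normalized and forces \<open>f = 0\<close> almost
  everywhere.\<close>

lemma Hoelder_nn_integral:
  fixes f g :: "'a \<Rightarrow> real"
  assumes p: "p > 1" "q > 1" "1 / p + 1 / q = 1"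
    and [measurable]: "f \<in> borel_measurable M" "g \<in> borel_measurable M"
    and nn: "\<And>x. 0 \<le> f x" "\<And>x. 0 \<le> g x"
    and A: "(\<integral>\<^sup>+x. ennreal (f x powr p) \<partial>M) \<le> ennreal A" "0 \<le> A"
    and B: "(\<integral>\<^sup>+x. ennreal (g x powr q) \<partial>M) \<le> ennreal B" "0 < B"
  shows "(\<integral>\<^sup>+x. ennreal (f x * g x) \<partial>M) \<le> ennreal (A powr (1 / p) * B powr (1 / q))"
proof (cases "A = 0")
  case True
  then have "(\<integral>\<^sup>+x. ennreal (f x powr p) \<partial>M) = 0" using A by simp
  then have "AE x in M. ennreal (f x powr p) = 0" by (subst (asm) nn_integral_0_iff_AE) auto
  then have "AE x in M. ennreal (f x * g x) = 0"
  proof eventually_elim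
    case (elim x)
    then have "f x powr p \<le> 0" by (simp add: ennreal_eq_0_iff)
    then have "f x = 0" by (metis powr_gt_zero not_le)
    then show ?case by simp
  qed
  then have "(\<integral>\<^sup>+x. ennreal (f x * g x) \<partial>M) = 0" by (subst nn_integral_0_iff_AE) auto
  then show ?thesis by simp
next
  case False
  with A have A0: "A > 0" by simp
  define A' where "A' = A powr (1 / p)"
  define B' where "B' = B powr (1 / q)"
  have pos: "A' > 0" "B' > 0" using A0 B by (auto simp: A'_def B'_def)
  have pw: "A' powr p = A" "B' powr q = B"
    using A0 B p by (auto simp: A'_def B'_def powr_powr)
  have "(\<integral>\<^sup>+x. ennreal (f x * g x) \<partial>M) \<le>
      (\<integral>\<^sup>+x. ennreal (A' * B' / (A * p)) * ennreal (f x powr p) + ennreal (A' * B' / (B * q)) * ennreal (g x powr q) \<partial>M)"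
  proof (rule nn_integral_mono)
    fix x
    have "f x / A' * (g x / B') \<le> (f x / A') powr p / p + (g x / B') powr q / q"
      using p pos nn by (intro Youngs_inequality) auto
    also have "(f x / A') powr p = f x powr p / A" using pos nn by (simp add: powr_divide pw)
    also have "(g x / B') powr q = g x powr q / B" using pos nn by (simp add: powr_divide pw)
    finally have "A' * B' * (f x / A' * (g x / B')) \<le> A' * B' * (f x powr p / A / p + g x powr q / B / q)"
      using pos by (intro mult_left_mono) auto
    then have "f x * g x \<le> A' * B' / (A * p) * f x powr p + A' * B' / (B * q) * g x powr q"
      using pos by (simp add: algebra_simps)
    then have "ennreal (f x * g x) \<le> ennreal (A' * B' / (A * p) * f x powr p + A' * B' / (B * q) * g x powr q)"
      by (rule ennreal_leI)
    also have "\<dots> = ennreal (A' * B' / (A * p)) * ennreal (f x powr p) + ennreal (A' * B' / (B * q)) * ennreal (g x powr q)"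
    proof -
      have "ennreal (c * v + d * w) = ennreal c * ennreal v + ennreal d * ennreal w"
        if "0 \<le> c" "0 \<le> d" "0 \<le> v" "0 \<le> w" for c d v w
        using that by (simp add: ennreal_mult)
      moreover have "0 \<le> A' * B' / (A * p)" "0 \<le> A' * B' / (B * q)" using pos A0 B p by auto
      ultimately show ?thesis using powr_ge_zero by blast
    qed
    finally show "ennreal (f x * g x) \<le>
      ennreal (A' * B' / (A * p)) * ennreal (f x powr p) + ennreal (A' * B' / (B * q)) * ennreal (g x powr q)" .
  qed
  also have "\<dots> = ennreal (A' * B' / (A * p)) * (\<integral>\<^sup>+x. ennreal (f x powr p) \<partial>M) +
      ennreal (A' * B' / (B * q)) * (\<integral>\<^sup>+x. ennreal (g x powr q) \<partial>M)"
    by (subst nn_integral_add) (auto simp: nn_integral_cmult)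
  also have "\<dots> \<le> ennreal (A' * B' / (A * p)) * ennreal A + ennreal (A' * B' / (B * q)) * ennreal B"
    by (intro add_mono mult_left_mono A B) auto
  also have "\<dots> = ennreal (A' * B' / p + A' * B' / q)"
    using pos A0 B p by (simp flip: ennreal_mult' ennreal_plus)
  also have "A' * B' / p + A' * B' / q = A' * B' * (1 / p + 1 / q)" by (simp add: algebra_simps)
  also have "\<dots> = A' * B'" using p by simp
  finally show ?thesis by (simp add: A'_def B'_def)
qed

text \<open>Hoelder in \<open>y\<close> is applied to the factors
  \<open>K powr (1/p) * F / h1\<close> and \<open>K powr (1/q) * h1\<close>. The first kernel
  condition bounds the second factor and leaves \<open>b x\<close>, the integral of
  \<open>K * F powr p * h1 powr (-p)\<close>. Integrating in \<open>x\<close> and exchanging the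
  order, the second condition cancels the power of \<open>h1\<close>. The operator enters only
  through a function \<open>J\<close> dominated by the integral of \<open>K * F\<close>, which also
  covers Bochner integrals that take their default value 0.\<close>

lemma Schur_test:
  fixes K :: "'a \<Rightarrow> 'b \<Rightarrow> real" and J h2 :: "'a \<Rightarrow> real" and F h1 :: "'b \<Rightarrow> real"
  assumes "sigma_finite_measure M" "sigma_finite_measure N"
    and p: "p > 1" "q > 1" "1 / p + 1 / q = 1"
    and [measurable]: "case_prod K \<in> borel_measurable (M \<Otimes>\<^sub>M N)" "F \<in> borel_measurable N"
      "h1 \<in> borel_measurable N" "h2 \<in> borel_measurable M"
    and nn: "\<And>x y. 0 \<le> K x y" "\<And>y. 0 \<le> F y" "\<And>x. 0 \<le> J x"
    and h1: "AE y in N. 0 < h1 y" and h2: "AE x in M. 0 < h2 x" and C: "0 < C" and D: "0 < D"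
    and K1: "AE x in M. (\<integral>\<^sup>+y. ennreal (K x y * h1 y powr q) \<partial>N) \<le> ennreal (C * h2 x powr q)"
    and K2: "AE y in N. (\<integral>\<^sup>+x. ennreal (K x y * h2 x powr p) \<partial>M) \<le> ennreal (D * h1 y powr p)"
    and J: "AE x in M. ennreal (J x) \<le> (\<integral>\<^sup>+y. ennreal (K x y * F y) \<partial>N)"
  shows "(\<integral>\<^sup>+x. ennreal (J x powr p) \<partial>M) \<le> ennreal (C powr (p / q) * D) * (\<integral>\<^sup>+y. ennreal (F y powr p) \<partial>N)"
proof -
  interpret M: sigma_finite_measure M by fact
  interpret N: sigma_finite_measure N by fact
  interpret pair_sigma_finite M N ..
  define b where "b x = (\<integral>\<^sup>+y. ennreal (K x y * (F y powr p * h1 y powr (-p))) \<partial>N)" for x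
  have [measurable]: "(\<lambda>y. K x y) \<in> borel_measurable N" if "x \<in> space M" for x
    using measurable_compose[OF measurable_Pair1'[OF that], of "case_prod K" N borel] by simp
  have main: "AE x in M. ennreal (J x powr p) \<le> ennreal (C powr (p / q) * h2 x powr p) * b x"
    using K1 J h2 AE_space
  proof eventually_elim
    case (elim x)
    have [measurable]: "(\<lambda>y. K x y) \<in> borel_measurable N" using elim by measurable
    show ?case
    \<comment> \<open>If \<open>b x\<close> is infinite, the right-hand side is infinite as well,
      since \<open>C\<close> and \<open>h2 x\<close> are positive.\<close>
    proof (cases "b x = \<infinity>")
      case True
      then show ?thesis using elim C by (simp add: ennreal_mult_top)
    next
      case False
      then obtain \<beta> where \<beta>: "0 \<le> \<beta>" "b x = ennreal \<beta>" by (cases "b x") auto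
      have "ennreal (J x) \<le> (\<integral>\<^sup>+y. ennreal (K x y * F y) \<partial>N)" by fact
      also have "\<dots> = (\<integral>\<^sup>+y. ennreal ((K x y powr (1/p) * (F y * inverse (h1 y))) * (K x y powr (1/q) * h1 y)) \<partial>N)"
      proof (rule nn_integral_cong_AE)
        show "AE y in N. ennreal (K x y * F y) = ennreal ((K x y powr (1/p) * (F y * inverse (h1 y))) * (K x y powr (1/q) * h1 y))"
          using h1
        proof eventually_elim
          case (elim y)
          have "K x y powr (1/p) * K x y powr (1/q) = K x y"
            using p nn(1)[of x y] by (simp flip: powr_add)
          then have "K x y * F y = K x y powr (1/p) * K x y powr (1/q) * F y * (inverse (h1 y) * h1 y)"
            using elim by simp
          then show ?case by (simp only: mult_ac)
        qed
      qed
      \<comment> \<open>\<open>h1\<close> is positive only almost everywhere, while Hoelder's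
        inequality above wants nonnegative functions everywhere; hence the absolute values.\<close>
      also have "\<dots> = (\<integral>\<^sup>+y. ennreal ((K x y powr (1/p) * (F y * inverse \<bar>h1 y\<bar>)) * (K x y powr (1/q) * \<bar>h1 y\<bar>)) \<partial>N)"
        using h1 by (intro nn_integral_cong_AE) (auto elim!: eventually_mono)
      also have "\<dots> \<le> ennreal (\<beta> powr (1/p) * (C * h2 x powr q) powr (1/q))"
      proof (rule Hoelder_nn_integral[OF p])
        have "(\<integral>\<^sup>+y. ennreal ((K x y powr (1/p) * (F y * inverse \<bar>h1 y\<bar>)) powr p) \<partial>N) = b x"
          unfolding b_def
        proof (rule nn_integral_cong_AE)
          show "AE y in N. ennreal ((K x y powr (1/p) * (F y * inverse \<bar>h1 y\<bar>)) powr p) =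
              ennreal (K x y * (F y powr p * h1 y powr (-p)))"
            using h1
          proof eventually_elim
            case (elim y)
            have "(inverse (h1 y)) powr p = h1 y powr (-p)" using elim by (simp add: powr_minus inverse_powr)
            then show ?case
              using elim p nn by (simp add: powr_mult powr_powr)
          qed
        qed
        then show "(\<integral>\<^sup>+y. ennreal ((K x y powr (1/p) * (F y * inverse \<bar>h1 y\<bar>)) powr p) \<partial>N) \<le> ennreal \<beta>"
          using \<beta> by simp
        have "(\<integral>\<^sup>+y. ennreal ((K x y powr (1/q) * \<bar>h1 y\<bar>) powr q) \<partial>N) = (\<integral>\<^sup>+y. ennreal (K x y * h1 y powr q) \<partial>N)"
          using h1 p nn by (intro nn_integral_cong_AE) (auto elim!: eventually_mono simp: powr_mult powr_powr)
        then show "(\<integral>\<^sup>+y. ennreal ((K x y powr (1/q) * \<bar>h1 y\<bar>) powr q) \<partial>N) \<le> ennreal (C * h2 x powr q)"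
          using elim by simp
      qed (use elim \<beta> C nn in auto)
      finally have "J x \<le> \<beta> powr (1/p) * (C * h2 x powr q) powr (1/q)"
        by (simp add: ennreal_le_iff)
      then have "J x powr p \<le> (\<beta> powr (1/p) * (C * h2 x powr q) powr (1/q)) powr p"
        using p nn by (intro powr_mono2) auto
      also have "\<dots> = C powr (p/q) * h2 x powr p * \<beta>"
        using p \<beta> C elim by (simp add: powr_mult powr_powr mult_ac)
      finally show ?thesis
        using \<beta> C by (simp add: ennreal_leI flip: ennreal_mult')
    qed
  qed
  have "(\<integral>\<^sup>+x. ennreal (J x powr p) \<partial>M) \<le> (\<integral>\<^sup>+x. ennreal (C powr (p / q) * h2 x powr p) * b x \<partial>M)"
    using main by (rule nn_integral_mono_AE)
  also have "\<dots> = (\<integral>\<^sup>+x. \<integral>\<^sup>+y. ennreal (C powr (p/q)) * ennreal (F y powr p * h1 y powr (-p)) * ennreal (K x y * h2 x powr p) \<partial>N \<partial>M)"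
  proof (rule nn_integral_cong)
    fix x assume [measurable]: "x \<in> space M"
    have "ennreal (C powr (p / q) * h2 x powr p) * b x =
        (\<integral>\<^sup>+y. ennreal (C powr (p / q) * h2 x powr p) * ennreal (K x y * (F y powr p * h1 y powr (-p))) \<partial>N)"
      unfolding b_def by (rule nn_integral_cmult[symmetric]) measurable
    also have "\<dots> = (\<integral>\<^sup>+y. ennreal (C powr (p/q)) * ennreal (F y powr p * h1 y powr (-p)) * ennreal (K x y * h2 x powr p) \<partial>N)"
      using nn by (intro nn_integral_cong) (simp add: mult_ac flip: ennreal_mult')
    finally show "ennreal (C powr (p / q) * h2 x powr p) * b x = \<dots>" .
  qed
  also have "\<dots> = (\<integral>\<^sup>+y. \<integral>\<^sup>+x. ennreal (C powr (p/q)) * ennreal (F y powr p * h1 y powr (-p)) * ennreal (K x y * h2 x powr p) \<partial>M \<partial>N)"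
    by (rule Fubini'[symmetric]) measurable
  also have "\<dots> \<le> (\<integral>\<^sup>+y. ennreal (C powr (p / q) * D) * ennreal (F y powr p) \<partial>N)"
  proof (rule nn_integral_mono_AE)
    show "AE y in N. (\<integral>\<^sup>+x. ennreal (C powr (p/q)) * ennreal (F y powr p * h1 y powr (-p)) * ennreal (K x y * h2 x powr p) \<partial>M)
        \<le> ennreal (C powr (p / q) * D) * ennreal (F y powr p)"
      using K2 h1 AE_space
    proof eventually_elim
      case (elim y)
      have [measurable]: "(\<lambda>x. K x y) \<in> borel_measurable M"
        using measurable_compose[OF measurable_Pair2'[OF elim(3)], of "case_prod K" M borel] by simp
      have "(\<integral>\<^sup>+x. ennreal (C powr (p/q)) * ennreal (F y powr p * h1 y powr (-p)) * ennreal (K x y * h2 x powr p) \<partial>M)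
          = ennreal (C powr (p/q)) * ennreal (F y powr p * h1 y powr (-p)) * (\<integral>\<^sup>+x. ennreal (K x y * h2 x powr p) \<partial>M)"
        by (rule nn_integral_cmult) measurable
      also have "\<dots> \<le> ennreal (C powr (p/q)) * ennreal (F y powr p * h1 y powr (-p)) * ennreal (D * h1 y powr p)"
        by (intro mult_left_mono elim) auto
      also have "\<dots> = ennreal (C powr (p/q) * D * F y powr p * (h1 y powr (-p) * h1 y powr p))"
        using D by (simp add: mult_ac flip: ennreal_mult')
      also have "h1 y powr (-p) * h1 y powr p = 1" using elim by (simp flip: powr_add)
      finally show ?case using D by (simp add: ennreal_mult')
    qed
  qed
  also have "\<dots> = ennreal (C powr (p / q) * D) * (\<integral>\<^sup>+y. ennreal (F y powr p) \<partial>N)"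
    by (rule nn_integral_cmult) measurable
  finally show ?thesis .
qed

section \<open>The Bergman projection on the product of two discs\<close>

lemma integrable_mult_L2:
  fixes f g :: "'a \<Rightarrow> complex"
  assumes [measurable]: "f \<in> borel_measurable M" "g \<in> borel_measurable M"
    and f: "(\<integral>\<^sup>+x. ennreal (cmod (f x) powr 2) \<partial>M) < \<infinity>"
    and g: "(\<integral>\<^sup>+x. ennreal (cmod (g x) powr 2) \<partial>M) < \<infinity>"
  shows "integrable M (\<lambda>x. f x * g x)"
proof (rule integrableI_bounded)
  have "(\<integral>\<^sup>+x. ennreal (cmod (f x * g x)) \<partial>M) \<le>
      (\<integral>\<^sup>+x. ennreal (cmod (f x) powr 2) + ennreal (cmod (g x) powr 2) \<partial>M)"
  proof (rule nn_integral_mono)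
    fix x
    have "cmod (f x) * cmod (g x) \<le> (cmod (f x))\<^sup>2 + (cmod (g x))\<^sup>2"
      using sum_squares_bound[of "cmod (f x)" "cmod (g x)"]
        mult_nonneg_nonneg[OF norm_ge_zero norm_ge_zero, of "f x" "g x"] unfolding mult.assoc by linarith
    then show "ennreal (cmod (f x * g x)) \<le> ennreal (cmod (f x) powr 2) + ennreal (cmod (g x) powr 2)"
      by (simp add: norm_mult ennreal_leI flip: ennreal_plus)
  qed
  also have "\<dots> < \<infinity>" using f g by (subst nn_integral_add) auto
  finally show "(\<integral>\<^sup>+x. ennreal (cmod (f x * g x)) \<partial>M) < \<infinity>" .
qed measurable

text \<open>The Forelli-Rudin estimate at \<open>z = 0\<close> with \<open>a = 1/2\<close> dominates
  the total mass, because \<open>(1 - |\<zeta>|\<^sup>2) powr (-1/2)\<close> is at least 1 on the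
  disc.\<close>

lemma finite_measure_disc_measure:
  assumes "r > -2"
  shows "finite_measure (disc_measure r)"
proof -
  obtain C where C: "\<And>z. z \<in> ball 0 1 \<Longrightarrow>
    (\<integral>\<^sup>+\<zeta>. ennreal (1 / (cmod (1 - z * cnj \<zeta>))\<^sup>2 * (1 - (cmod \<zeta>)\<^sup>2) powr (-(1/2))) \<partial>disc_measure r)
      \<le> ennreal (C * (1 - (cmod z)\<^sup>2) powr (-(1/2)))"
    using Forelli_Rudin_disc[OF assms, of "1/2"] by auto
  have "emeasure (disc_measure r) UNIV = (\<integral>\<^sup>+\<zeta>. 1 \<partial>disc_measure r)" by simp
  also have "\<dots> \<le> (\<integral>\<^sup>+\<zeta>. ennreal (1 / (cmod (1 - 0 * cnj \<zeta>))\<^sup>2 * (1 - (cmod \<zeta>)\<^sup>2) powr (-(1/2))) \<partial>disc_measure r)"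
  proof (rule nn_integral_mono_AE)
    show "AE \<zeta> in disc_measure r. 1 \<le> ennreal (1 / (cmod (1 - 0 * cnj \<zeta>))\<^sup>2 * (1 - (cmod \<zeta>)\<^sup>2) powr (-(1/2)))"
      using AE_disc_measure
    proof eventually_elim
      case (elim \<zeta>)
      then have "0 < 1 - (cmod \<zeta>)\<^sup>2" by (simp add: abs_square_less_1)
      then show ?case using powr_mono2'[of "-(1/2)" "1 - (cmod \<zeta>)\<^sup>2" 1] by simp
    qed
  qed
  also have "\<dots> < \<infinity>" using C[of 0] by (simp add: le_less_trans)
  finally show ?thesis by (intro finite_measureI) simp
qed

lemma emeasure_disc_measure_0: "emeasure (disc_measure 0) UNIV = ennreal pi"
proof -
  have "emeasure (disc_measure 0) UNIV = (\<integral>\<^sup>+\<zeta>. (\<lambda>u. 1) ((cmod \<zeta>)\<^sup>2) \<partial>disc_measure 0)" by simp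
  also have "\<dots> = (\<integral>\<^sup>+u. ennreal (pi * indicator {0<..<1} u * u powr (0 / 2)) * 1 \<partial>lborel)"
    by (rule nn_integral_disc_measure_radial) measurable
  also have "\<dots> = (\<integral>\<^sup>+u. ennreal pi * indicator {0<..<1::real} u \<partial>lborel)"
    by (intro nn_integral_cong) (auto split: split_indicator)
  also have "\<dots> = ennreal pi" by (subst nn_integral_cmult_indicator) auto
  finally show ?thesis .
qed

text \<open>The first factor carries no weight, since all weights on the triangle and the Jacobian
  depend on the second coordinate alone.\<close>

definition bidisc_measure :: "real \<Rightarrow> (complex \<times> complex) measure" where
  "bidisc_measure r = disc_measure 0 \<Otimes>\<^sub>M disc_measure r"

lemma sets_bidisc_measure [simp, measurable_cong]: "sets (bidisc_measure r) = sets (borel \<Otimes>\<^sub>M borel)"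
  unfolding bidisc_measure_def by (rule sets_pair_measure_cong) auto

lemma space_bidisc_measure [simp]: "space (bidisc_measure r) = UNIV"
  by (simp add: bidisc_measure_def space_pair_measure)

lemma pair_sigma_finite_disc: "pair_sigma_finite (disc_measure q) (disc_measure r)"
  by (intro pair_sigma_finite.intro sigma_finite_disc_measure)

lemma sigma_finite_bidisc_measure: "sigma_finite_measure (bidisc_measure r)"
  unfolding bidisc_measure_def by (rule sigma_finite_pair_measure) (rule sigma_finite_disc_measure)+

lemma finite_measure_bidisc_measure:
  assumes "r > -2"
  shows "finite_measure (bidisc_measure r)"
  unfolding bidisc_measure_def
  by (intro finite_measure_pair_measure finite_measure_disc_measure assms) simp

lemma AE_bidisc_measure: "AE x in bidisc_measure r. x \<in> ball 0 1 \<times> (ball 0 1 - {0})"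
  unfolding bidisc_measure_def
proof (rule pair_sigma_finite.AE_pair_measure[OF pair_sigma_finite_disc])
  show "AE x in disc_measure 0. AE y in disc_measure r. (x, y) \<in> ball 0 1 \<times> (ball 0 1 - {0})"
    using AE_disc_measure[of 0]
  proof eventually_elim
    case (elim x)
    show ?case using AE_disc_measure[of r] by eventually_elim (use elim in auto)
  qed
  have "{x \<in> space (disc_measure 0 \<Otimes>\<^sub>M disc_measure r). x \<in> ball 0 1 \<times> (ball 0 1 - {0})} =
      ball 0 1 \<times> (ball 0 1 - {0})" by (auto simp: space_pair_measure)
  then show "{x \<in> space (disc_measure 0 \<Otimes>\<^sub>M disc_measure r). x \<in> ball 0 1 \<times> (ball 0 1 - {0})}
      \<in> sets (disc_measure 0 \<Otimes>\<^sub>M disc_measure r)" by simp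
qed

lemma density_bidisc_measure:
  "density (bidisc_measure r) (\<lambda>x. ennreal (cmod (snd x) powr q)) = bidisc_measure (r + q)"
proof -
  have "bidisc_measure (r + q) = density (disc_measure 0) (\<lambda>_. 1) \<Otimes>\<^sub>M density (disc_measure r) (\<lambda>z. ennreal (cmod z powr q))"
    by (simp add: bidisc_measure_def density_disc_measure density_1)
  also have "\<dots> = density (disc_measure 0 \<Otimes>\<^sub>M disc_measure r) (\<lambda>(x, y). 1 * ennreal (cmod y powr q))"
    by (rule pair_measure_density)
       (simp_all add: density_disc_measure sigma_finite_disc_measure)
  finally show ?thesis by (simp add: bidisc_measure_def case_prod_beta')
qed

lemma nn_integral_bidisc_measure_add:
  assumes [measurable]: "f \<in> borel_measurable (borel \<Otimes>\<^sub>M borel)"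
  shows "(\<integral>\<^sup>+x. f x \<partial>bidisc_measure (r + q)) = (\<integral>\<^sup>+x. ennreal (cmod (snd x) powr q) * f x \<partial>bidisc_measure r)"
  unfolding density_bidisc_measure[symmetric] by (rule nn_integral_density) measurable

lemma nn_integral_bidisc_measure_times:
  assumes [measurable]: "f \<in> borel_measurable borel" "g \<in> borel_measurable borel"
  shows "(\<integral>\<^sup>+x. f (fst x) * g (snd x) \<partial>bidisc_measure r) = (\<integral>\<^sup>+x. f x \<partial>disc_measure 0) * (\<integral>\<^sup>+x. g x \<partial>disc_measure r)"
  unfolding bidisc_measure_def
  by (subst sigma_finite_measure.nn_integral_fst[OF sigma_finite_disc_measure, symmetric])
     (simp_all add: nn_integral_cmult nn_integral_multc)

text \<open>The Bergman kernel of the product. \<open>disc_kernel 2\<close> is the unweighted kernel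
  \<open>1 / (1 - x)\<^sup>2\<close>, and each \<open>disc_kernel\<close> is \<open>pi\<close> times
  a Bergman kernel, whence the division by \<open>pi\<^sup>2\<close>.\<close>

definition bidisc_kernel :: "real \<Rightarrow> complex \<times> complex \<Rightarrow> complex \<times> complex \<Rightarrow> complex" where
  "bidisc_kernel s x y =
    disc_kernel 2 (fst x * cnj (fst y)) * disc_kernel s (snd x * cnj (snd y)) / of_real (pi\<^sup>2)"

definition bidisc_projection :: "real \<Rightarrow> (complex \<times> complex \<Rightarrow> complex) \<Rightarrow> complex \<times> complex \<Rightarrow> complex" where
  "bidisc_projection s G x = (\<integral>y. bidisc_kernel s x y * G y \<partial>bidisc_measure (s - 2))"

lemma measurable_bidisc_kernel [measurable]:
  assumes [measurable]: "f \<in> M \<rightarrow>\<^sub>M borel \<Otimes>\<^sub>M borel" "g \<in> M \<rightarrow>\<^sub>M borel \<Otimes>\<^sub>M borel"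
  shows "(\<lambda>x. bidisc_kernel s (f x) (g x)) \<in> borel_measurable M"
  unfolding bidisc_kernel_def by measurable

lemma measurable_bidisc_kernel_section [measurable]:
  "bidisc_kernel s x \<in> borel_measurable (borel \<Otimes>\<^sub>M borel)"
  by (rule measurable_bidisc_kernel) (auto simp: space_pair_measure)

lemma measurable_bidisc_projection [measurable]:
  assumes [measurable]: "G \<in> borel_measurable (borel \<Otimes>\<^sub>M borel)"
  shows "bidisc_projection s G \<in> borel_measurable (borel \<Otimes>\<^sub>M borel)"
proof -
  interpret sigma_finite_measure "bidisc_measure (s - 2)" by (rule sigma_finite_bidisc_measure)
  show ?thesis unfolding bidisc_projection_def by measurable
qed

lemma bidisc_kernel_cnj: "cnj (bidisc_kernel s x y) = bidisc_kernel s y x"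
  by (simp add: bidisc_kernel_def disc_kernel_cnj mult.commute)

lemma norm_bidisc_kernel_le_mult:
  "cmod (bidisc_kernel s x y) \<le>
    cmod (disc_kernel 2 (fst x * cnj (fst y))) * cmod (disc_kernel s (snd x * cnj (snd y)))"
proof -
  have "1 \<le> pi\<^sup>2" using pi_ge_two by (intro one_le_power) linarith
  then have "cmod (disc_kernel 2 (fst x * cnj (fst y))) * cmod (disc_kernel s (snd x * cnj (snd y))) / pi\<^sup>2 \<le>
      cmod (disc_kernel 2 (fst x * cnj (fst y))) * cmod (disc_kernel s (snd x * cnj (snd y))) / 1"
    by (intro divide_left_mono) auto
  then show ?thesis
    by (simp add: bidisc_kernel_def norm_mult norm_divide norm_power)
qed

lemma norm_bidisc_kernel_le:
  assumes s: "0 < s" "s \<le> 2" and x: "x \<in> ball 0 1 \<times> ball 0 1" and y: "y \<in> ball 0 1 \<times> ball 0 1"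
  shows "cmod (bidisc_kernel s x y) \<le>
    9 * (1 / (cmod (1 - fst x * cnj (fst y)))\<^sup>2) * (1 / (cmod (1 - snd x * cnj (snd y)))\<^sup>2)"
proof -
  have "cmod (bidisc_kernel s x y) \<le>
      cmod (disc_kernel 2 (fst x * cnj (fst y))) * cmod (disc_kernel s (snd x * cnj (snd y)))"
    by (rule norm_bidisc_kernel_le_mult)
  also have "\<dots> \<le> (3 / (cmod (1 - fst x * cnj (fst y)))\<^sup>2) * (3 / (cmod (1 - snd x * cnj (snd y)))\<^sup>2)"
    using assms by (intro mult_mono norm_disc_kernel_le norm_mult_cnj_less_1) auto
  finally show ?thesis by simp
qed

lemma norm_bidisc_kernel_le':
  assumes s: "0 < s" "s \<le> 2" and x: "x \<in> ball 0 1 \<times> ball 0 1" and y: "y \<in> ball 0 1 \<times> ball 0 1"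
  shows "cmod (bidisc_kernel s x y) \<le> 9 / ((1 - cmod (fst x))\<^sup>2 * (1 - cmod (snd x))\<^sup>2)"
proof -
  have "cmod (bidisc_kernel s x y) \<le>
      cmod (disc_kernel 2 (fst x * cnj (fst y))) * cmod (disc_kernel s (snd x * cnj (snd y)))"
    by (rule norm_bidisc_kernel_le_mult)
  also have "\<dots> \<le> (3 / (1 - cmod (fst x))\<^sup>2) * (3 / (1 - cmod (snd x))\<^sup>2)"
    using assms by (intro mult_mono norm_disc_kernel_le') auto
  finally show ?thesis by simp
qed

text \<open>The kernel is integrated with exponent \<open>s - 2\<close>, the source norm has
  exponent \<open>q\<close> and the target norm \<open>r\<close>. The Schur test is run between the
  measures of the two norms, so its kernel \<open>K\<close> carries the extra density
  \<open>cmod (snd y) powr (s - 2 - q)\<close>.\<close>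

lemma bidisc_Lp_bound:
  fixes s p q r :: real
  assumes s: "0 < s" "s \<le> 2" and p: "p > 1" and r: "r > -2"
    and q: "(s - 2 - q) * (p / (p - 1)) + q > -2"
  obtains C where "C > 0"
    "\<And>G J. G \<in> borel_measurable (borel \<Otimes>\<^sub>M borel) \<Longrightarrow> (\<And>x. 0 \<le> J x) \<Longrightarrow>
      (\<And>x. ennreal (J x) \<le> (\<integral>\<^sup>+y. ennreal (cmod (bidisc_kernel s x y * G y)) \<partial>bidisc_measure (s - 2))) \<Longrightarrow>
      (\<integral>\<^sup>+x. ennreal (J x powr p) \<partial>bidisc_measure r) \<le>
        ennreal C * (\<integral>\<^sup>+y. ennreal (cmod (G y) powr p) \<partial>bidisc_measure q)"
proof -
  define p' where "p' = p / (p - 1)"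
  have p': "p' > 1" "1 / p + 1 / p' = 1" using p by (auto simp: p'_def field_simps)
  text \<open>Both test functions contain \<open>1 - |\<zeta>|\<^sup>2\<close> to the power \<open>-a\<close> in each variable; the power \<open>c\<close> of \<open>|\<zeta>|\<close>
    compensates the difference between the weights \<open>s - 2\<close> of the kernel and \<open>q\<close> of the source.\<close>
  define a where "a = 1 / (p * p')"
  \<comment> \<open>\<open>a * p = 1 / p'\<close> and \<open>a * p' = 1 / p\<close>, so both
    exponents lie strictly between 0 and 1, as the Forelli-Rudin estimate demands.\<close>
  have ap: "0 < a * p" "a * p < 1" "0 < a * p'" "a * p' < 1"
    using p p' by (auto simp: a_def)
  define c where "c = (s - 2 - q) / p"
  \<comment> \<open>The left side is the exponent of \<open>|\<zeta>|\<close> in the first Schur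
    integral. Since \<open>1 + p' / p = p'\<close>, it is the exponent in the assumption on
    \<open>q\<close>. In the second Schur integral, \<open>c * p = s - 2 - q\<close> matches the
    density in \<open>K\<close> exactly.\<close>
  have "s - 2 + c * p' = (s - 2 - q) * p' + q"
    using p by (simp add: c_def p'_def divide_simps) (simp add: algebra_simps)
  then have cp: "s - 2 + c * p' > -2" using q by (simp add: p'_def)
  define \<phi> where "\<phi> = (\<lambda>b (z::complex) \<zeta>. 1 / (cmod (1 - z * cnj \<zeta>))\<^sup>2 * (1 - (cmod \<zeta>)\<^sup>2) powr (-b))"
  have [measurable]: "\<phi> b z \<in> borel_measurable borel" for b z unfolding \<phi>_def by measurable
  have \<phi>0: "\<phi> b z \<zeta> \<ge> 0" for b z \<zeta> by (simp add: \<phi>_def)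
  have FR: "\<exists>C>0. \<forall>z\<in>ball 0 1. (\<integral>\<^sup>+\<zeta>. ennreal (\<phi> b z \<zeta>) \<partial>disc_measure \<delta>) \<le> ennreal (C * (1 - (cmod z)\<^sup>2) powr (-b))"
    if ab: "\<delta> > -2" "0 < b" "b < 1" for \<delta> b
  proof -
    obtain C where "C > 0" "\<And>z. z \<in> ball 0 1 \<Longrightarrow>
        (\<integral>\<^sup>+\<zeta>. ennreal (\<phi> b z \<zeta>) \<partial>disc_measure \<delta>) \<le> ennreal (C * (1 - (cmod z)\<^sup>2) powr (-b))"
      unfolding \<phi>_def by (rule Forelli_Rudin_disc[OF ab]) blast
    then show ?thesis by blast
  qed
  obtain A1 where A1: "A1 > 0" "\<And>z. z \<in> ball 0 1 \<Longrightarrow> (\<integral>\<^sup>+\<zeta>. ennreal (\<phi> (a * p') z \<zeta>) \<partial>disc_measure 0) \<le> ennreal (A1 * (1 - (cmod z)\<^sup>2) powr (-(a * p')))"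
    using FR[of 0 "a * p'"] ap by auto
  obtain A2 where A2: "A2 > 0" "\<And>z. z \<in> ball 0 1 \<Longrightarrow> (\<integral>\<^sup>+\<zeta>. ennreal (\<phi> (a * p') z \<zeta>) \<partial>disc_measure (s - 2 + c * p')) \<le> ennreal (A2 * (1 - (cmod z)\<^sup>2) powr (-(a * p')))"
    using FR[of "s - 2 + c * p'" "a * p'"] ap cp by auto
  obtain B1 where B1: "B1 > 0" "\<And>z. z \<in> ball 0 1 \<Longrightarrow> (\<integral>\<^sup>+\<zeta>. ennreal (\<phi> (a * p) z \<zeta>) \<partial>disc_measure 0) \<le> ennreal (B1 * (1 - (cmod z)\<^sup>2) powr (-(a * p)))"
    using FR[of 0 "a * p"] ap by auto
  obtain B2 where B2: "B2 > 0" "\<And>z. z \<in> ball 0 1 \<Longrightarrow> (\<integral>\<^sup>+\<zeta>. ennreal (\<phi> (a * p) z \<zeta>) \<partial>disc_measure r) \<le> ennreal (B2 * (1 - (cmod z)\<^sup>2) powr (-(a * p)))"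
    using FR[of r "a * p"] ap r by auto
  define w where "w = (\<lambda>x :: complex \<times> complex. (1 - (cmod (fst x))\<^sup>2) powr (-a) * (1 - (cmod (snd x))\<^sup>2) powr (-a))"
  define h1 where "h1 = (\<lambda>x. w x * cmod (snd x) powr c)"
  define K where "K = (\<lambda>x y. cmod (bidisc_kernel s x y) * cmod (snd y) powr (s - 2 - q))"
  have [measurable]: "w \<in> borel_measurable (borel \<Otimes>\<^sub>M borel)" unfolding w_def by measurable
  have [measurable]: "h1 \<in> borel_measurable (borel \<Otimes>\<^sub>M borel)" unfolding h1_def by measurable
  have wpos: "w x > 0" if "x \<in> ball 0 1 \<times> ball 0 1" for x
  proof -
    have "(cmod (fst x))\<^sup>2 < 1" "(cmod (snd x))\<^sup>2 < 1"
      using that by (auto simp: mem_Times_iff abs_square_less_1)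
    then show ?thesis by (simp add: w_def)
  qed
  have wpow: "w x powr b = (1 - (cmod (fst x))\<^sup>2) powr (-(a * b)) * (1 - (cmod (snd x))\<^sup>2) powr (-(a * b))"
    if "x \<in> ball 0 1 \<times> ball 0 1" for x b
    using that by (auto simp: w_def mem_Times_iff abs_square_less_1 powr_mult powr_powr)
  have wnn: "w x \<ge> 0" for x by (simp add: w_def)
  have main: "(\<integral>\<^sup>+x. ennreal (J x powr p) \<partial>bidisc_measure r) \<le>
      ennreal ((9 * (A1 * A2)) powr (p / p') * (9 * (B1 * B2))) * (\<integral>\<^sup>+y. ennreal (cmod (G y) powr p) \<partial>bidisc_measure q)"
    if [measurable]: "G \<in> borel_measurable (borel \<Otimes>\<^sub>M borel)" and J0: "\<And>x. 0 \<le> J x"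
      and J: "\<And>x. ennreal (J x) \<le> (\<integral>\<^sup>+y. ennreal (cmod (bidisc_kernel s x y * G y)) \<partial>bidisc_measure (s - 2))"
    for G J
  proof (rule Schur_test[where K=K and ?h1.0=h1 and ?h2.0=w and q=p'])
    show "sigma_finite_measure (bidisc_measure r)" "sigma_finite_measure (bidisc_measure q)"
      by (rule sigma_finite_bidisc_measure)+
    show "case_prod K \<in> borel_measurable (bidisc_measure r \<Otimes>\<^sub>M bidisc_measure q)"
      unfolding K_def case_prod_beta by measurable
    show "AE y in bidisc_measure q. 0 < h1 y"
      using AE_bidisc_measure by eventually_elim (auto simp: h1_def intro!: mult_pos_pos wpos)
    show "AE x in bidisc_measure r. 0 < w x"
      using AE_bidisc_measure by eventually_elim (auto intro!: wpos)
    show "AE x in bidisc_measure r. (\<integral>\<^sup>+y. ennreal (K x y * h1 y powr p') \<partial>bidisc_measure q)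
        \<le> ennreal (9 * (A1 * A2) * w x powr p')"
      using AE_bidisc_measure
    proof eventually_elim
      case (elim x)
      then have x: "x \<in> ball 0 1 \<times> ball 0 1" by auto
      have "(\<integral>\<^sup>+y. ennreal (K x y * h1 y powr p') \<partial>bidisc_measure q) \<le>
          (\<integral>\<^sup>+y. ennreal (cmod (snd y) powr (s - 2 - q + c * p')) *
             (ennreal 9 * (ennreal (\<phi> (a * p') (fst x) (fst y)) * ennreal (\<phi> (a * p') (snd x) (snd y)))) \<partial>bidisc_measure q)"
      proof (rule nn_integral_mono_AE)
        show "AE y in bidisc_measure q. ennreal (K x y * h1 y powr p') \<le>
            ennreal (cmod (snd y) powr (s - 2 - q + c * p')) *
             (ennreal 9 * (ennreal (\<phi> (a * p') (fst x) (fst y)) * ennreal (\<phi> (a * p') (snd x) (snd y))))"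
          using AE_bidisc_measure
        proof eventually_elim
          case (elim y)
          then have y: "y \<in> ball 0 1 \<times> ball 0 1" by auto
          have "K x y * h1 y powr p' = cmod (bidisc_kernel s x y) * (cmod (snd y) powr (s - 2 - q + c * p') *
              ((1 - (cmod (fst y))\<^sup>2) powr (-(a * p')) * (1 - (cmod (snd y))\<^sup>2) powr (-(a * p'))))"
            unfolding K_def h1_def using wnn by (simp add: powr_mult wpow[OF y] powr_powr powr_add mult_ac)
          also have "\<dots> \<le> (9 * (1 / (cmod (1 - fst x * cnj (fst y)))\<^sup>2) * (1 / (cmod (1 - snd x * cnj (snd y)))\<^sup>2)) *
              (cmod (snd y) powr (s - 2 - q + c * p') *
              ((1 - (cmod (fst y))\<^sup>2) powr (-(a * p')) * (1 - (cmod (snd y))\<^sup>2) powr (-(a * p'))))"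
            by (intro mult_right_mono norm_bidisc_kernel_le s x y) simp
          also have "\<dots> = cmod (snd y) powr (s - 2 - q + c * p') *
             (9 * (\<phi> (a * p') (fst x) (fst y) * \<phi> (a * p') (snd x) (snd y)))"
            by (simp add: \<phi>_def mult_ac)
          finally show ?case
            using \<phi>0 by (simp add: ennreal_leI flip: ennreal_mult'' ennreal_numeral)
        qed
      qed
      also have "\<dots> = (\<integral>\<^sup>+y. (ennreal 9 * (ennreal (\<phi> (a * p') (fst x) (fst y)) * ennreal (\<phi> (a * p') (snd x) (snd y))))
          \<partial>bidisc_measure (q + (s - 2 - q + c * p')))"
        by (rule nn_integral_bidisc_measure_add[symmetric]) measurable
      also have "q + (s - 2 - q + c * p') = s - 2 + c * p'" by simp
      also have "(\<integral>\<^sup>+y. (ennreal 9 * (ennreal (\<phi> (a * p') (fst x) (fst y)) * ennreal (\<phi> (a * p') (snd x) (snd y))))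
          \<partial>bidisc_measure (s - 2 + c * p')) = ennreal 9 * ((\<integral>\<^sup>+\<zeta>. ennreal (\<phi> (a * p') (fst x) \<zeta>) \<partial>disc_measure 0) *
            (\<integral>\<^sup>+\<zeta>. ennreal (\<phi> (a * p') (snd x) \<zeta>) \<partial>disc_measure (s - 2 + c * p')))"
        by (subst nn_integral_cmult, measurable)
          (simp add: nn_integral_bidisc_measure_times[of "\<lambda>\<zeta>. ennreal (\<phi> (a * p') (fst x) \<zeta>)" "\<lambda>\<zeta>. ennreal (\<phi> (a * p') (snd x) \<zeta>)"])
      also have "\<dots> \<le> ennreal 9 * (ennreal (A1 * (1 - (cmod (fst x))\<^sup>2) powr (-(a * p'))) *
          ennreal (A2 * (1 - (cmod (snd x))\<^sup>2) powr (-(a * p'))))"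
        using x by (intro mult_left_mono mult_mono A1 A2) auto
      also have "\<dots> = ennreal (9 * (A1 * A2) * w x powr p')"
        unfolding wpow[OF x] using A1(1) A2(1) by (simp add: mult_ac flip: ennreal_mult'' ennreal_numeral)
      finally show ?case .
    qed
    show "AE y in bidisc_measure q. (\<integral>\<^sup>+x. ennreal (K x y * w x powr p) \<partial>bidisc_measure r)
        \<le> ennreal (9 * (B1 * B2) * h1 y powr p)"
      using AE_bidisc_measure
    proof eventually_elim
      case (elim y)
      then have y: "y \<in> ball 0 1 \<times> ball 0 1" by auto
      let ?Y = "cmod (snd y) powr (s - 2 - q)"
      have "(\<integral>\<^sup>+x. ennreal (K x y * w x powr p) \<partial>bidisc_measure r) \<le>
          (\<integral>\<^sup>+x. ennreal (9 * ?Y) * (ennreal (\<phi> (a * p) (fst y) (fst x)) * ennreal (\<phi> (a * p) (snd y) (snd x))) \<partial>bidisc_measure r)"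
      proof (rule nn_integral_mono_AE)
        show "AE x in bidisc_measure r. ennreal (K x y * w x powr p) \<le>
            ennreal (9 * ?Y) * (ennreal (\<phi> (a * p) (fst y) (fst x)) * ennreal (\<phi> (a * p) (snd y) (snd x)))"
          using AE_bidisc_measure
        proof eventually_elim
          case (elim x)
          then have x: "x \<in> ball 0 1 \<times> ball 0 1" by auto
          \<comment> \<open>Hermitian symmetry exchanges the variables, so that the integration over
            \<open>x\<close> has the form of the Forelli-Rudin estimate at \<open>y\<close>.\<close>
          have "cmod (bidisc_kernel s x y) = cmod (bidisc_kernel s y x)"
            by (metis bidisc_kernel_cnj complex_mod_cnj)
          then have "K x y * w x powr p = cmod (bidisc_kernel s y x) * (?Y *
              ((1 - (cmod (fst x))\<^sup>2) powr (-(a * p)) * (1 - (cmod (snd x))\<^sup>2) powr (-(a * p))))"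
            unfolding K_def by (simp add: wpow[OF x] mult_ac)
          also have "\<dots> \<le> (9 * (1 / (cmod (1 - fst y * cnj (fst x)))\<^sup>2) * (1 / (cmod (1 - snd y * cnj (snd x)))\<^sup>2)) *
              (?Y * ((1 - (cmod (fst x))\<^sup>2) powr (-(a * p)) * (1 - (cmod (snd x))\<^sup>2) powr (-(a * p))))"
            by (intro mult_right_mono norm_bidisc_kernel_le s x y) simp
          also have "\<dots> = (9 * ?Y) * (\<phi> (a * p) (fst y) (fst x) * \<phi> (a * p) (snd y) (snd x))"
            by (simp add: \<phi>_def mult_ac)
          finally show ?case
            using \<phi>0 by (simp add: ennreal_leI flip: ennreal_mult'')
        qed
      qed
      also have "\<dots> = ennreal (9 * ?Y) * ((\<integral>\<^sup>+\<zeta>. ennreal (\<phi> (a * p) (fst y) \<zeta>) \<partial>disc_measure 0) *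
            (\<integral>\<^sup>+\<zeta>. ennreal (\<phi> (a * p) (snd y) \<zeta>) \<partial>disc_measure r))"
        by (subst nn_integral_cmult, measurable)
          (simp add: nn_integral_bidisc_measure_times[of "\<lambda>\<zeta>. ennreal (\<phi> (a * p) (fst y) \<zeta>)" "\<lambda>\<zeta>. ennreal (\<phi> (a * p) (snd y) \<zeta>)"])
      also have "\<dots> \<le> ennreal (9 * ?Y) * (ennreal (B1 * (1 - (cmod (fst y))\<^sup>2) powr (-(a * p))) *
          ennreal (B2 * (1 - (cmod (snd y))\<^sup>2) powr (-(a * p))))"
        using y by (intro mult_left_mono mult_mono B1 B2) auto
      also have "\<dots> = ennreal (9 * (B1 * B2) * (?Y * w y powr p))"
        unfolding wpow[OF y] using B1(1) B2(1) by (simp add: mult_ac flip: ennreal_mult'')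
      also have "?Y * w y powr p = h1 y powr p"
        using p wnn by (simp add: h1_def c_def powr_mult powr_powr)
      finally show ?case .
    qed
    show "AE x in bidisc_measure r. ennreal (J x) \<le> (\<integral>\<^sup>+y. ennreal (K x y * cmod (G y)) \<partial>bidisc_measure q)"
    proof (rule AE_I2)
      fix x
      have "ennreal (J x) \<le> (\<integral>\<^sup>+y. ennreal (cmod (bidisc_kernel s x y * G y)) \<partial>bidisc_measure (q + (s - 2 - q)))"
        using J[of x] by simp
      also have "\<dots> = (\<integral>\<^sup>+y. ennreal (cmod (snd y) powr (s - 2 - q)) * ennreal (cmod (bidisc_kernel s x y * G y)) \<partial>bidisc_measure q)"
        by (rule nn_integral_bidisc_measure_add) measurable
      also have "\<dots> = (\<integral>\<^sup>+y. ennreal (K x y * cmod (G y)) \<partial>bidisc_measure q)"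
        by (intro nn_integral_cong) (simp add: K_def norm_mult mult_ac flip: ennreal_mult')
      finally show "ennreal (J x) \<le> (\<integral>\<^sup>+y. ennreal (K x y * cmod (G y)) \<partial>bidisc_measure q)" .
    qed
  qed (use p p' A1 A2 B1 B2 J0 in \<open>auto simp: K_def\<close>)
  show ?thesis
    by (rule that[OF _ main]) (use A1(1) A2(1) B1(1) B2(1) in auto)
qed

lemma integrable_L2:
  fixes f :: "'a \<Rightarrow> complex"
  assumes "finite_measure M" and [measurable]: "f \<in> borel_measurable M"
    and f: "(\<integral>\<^sup>+x. ennreal (cmod (f x) powr 2) \<partial>M) < \<infinity>"
  shows "integrable M f"
proof -
  interpret finite_measure M by fact
  have "(\<integral>\<^sup>+x. ennreal (cmod (1 :: complex) powr 2) \<partial>M) < \<infinity>" by (simp add: less_top[symmetric])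
  from integrable_mult_L2[OF assms(2) _ f this] show ?thesis by simp
qed

lemma integrable_bidisc_kernel:
  assumes s: "0 < s" "s \<le> 2" and x: "x \<in> ball 0 1 \<times> ball 0 1"
    and G: "integrable (bidisc_measure (s - 2)) G"
  shows "integrable (bidisc_measure (s - 2)) (\<lambda>y. bidisc_kernel s x y * G y)"
proof (rule Bochner_Integration.integrable_bound)
  have [measurable]: "G \<in> borel_measurable (borel \<Otimes>\<^sub>M borel)"
    using borel_measurable_integrable[OF G] by (simp cong: measurable_cong_sets)
  let ?B = "9 / ((1 - cmod (fst x))\<^sup>2 * (1 - cmod (snd x))\<^sup>2)"
  show "integrable (bidisc_measure (s - 2)) (\<lambda>y. complex_of_real ?B * G y)"
    using G by (rule integrable_mult_right)
  show "(\<lambda>y. bidisc_kernel s x y * G y) \<in> borel_measurable (bidisc_measure (s - 2))" by measurable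
  show "AE y in bidisc_measure (s - 2). cmod (bidisc_kernel s x y * G y) \<le> cmod (complex_of_real ?B * G y)"
    using AE_bidisc_measure
  proof eventually_elim
    case (elim y)
    then have "cmod (bidisc_kernel s x y) \<le> ?B" by (intro norm_bidisc_kernel_le' s x) auto
    then show ?case unfolding norm_mult norm_of_real by (intro mult_right_mono) auto
  qed
qed

section \<open>Removable singularities of square-integrable functions\<close>

lemma nn_integral_disc_measure_0:
  assumes [measurable]: "f \<in> borel_measurable borel"
  shows "(\<integral>\<^sup>+z. f z \<partial>disc_measure 0) = (\<integral>\<^sup>+z. indicator (ball 0 1) z * f z \<partial>lborel)"
proof -
  have "AE z in lborel. z \<noteq> (0::complex)" by (rule AE_lborel_singleton)
  then have "AE z in lborel. ennreal (indicator (ball 0 1) z * cmod z powr 0) * f z = indicator (ball 0 1) z * f z"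
    by eventually_elim (auto split: split_indicator)
  then show ?thesis
    unfolding nn_integral_disc_measure[OF assms] by (rule nn_integral_cong_AE)
qed

text \<open>At \<open>z = 0\<close> the kernel with \<open>s = 2\<close> is the constant 1, so the
  reproducing property becomes the mean value property over the disc.\<close>

lemma sub_mean_value_disc:
  assumes g: "g holomorphic_on ball 0 1" and [measurable]: "g \<in> borel_measurable borel"
  shows "ennreal (pi * cmod (g 0)) \<le> (\<integral>\<^sup>+\<zeta>. ennreal (cmod (g \<zeta>)) \<partial>disc_measure 0)"
proof (cases "(\<integral>\<^sup>+\<zeta>. ennreal (cmod (g \<zeta>)) \<partial>disc_measure 0) < \<infinity>")
  case True
  then have int: "integrable (disc_measure (2 - 2)) g"
    by (intro integrableI_bounded) auto
  have "ennreal (pi * cmod (g 0)) = ennreal (cmod (\<integral>\<zeta>. disc_kernel 2 (0 * cnj \<zeta>) * g \<zeta> \<partial>disc_measure (2 - 2)))"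
    by (subst disc_kernel_reproducing(2)[OF _ _ _ g int]) (auto simp: norm_mult)
  also have "\<dots> = ennreal (cmod (\<integral>\<zeta>. g \<zeta> \<partial>disc_measure (2 - 2)))"
    by (simp add: disc_kernel_def)
  also have "\<dots> \<le> (\<integral>\<^sup>+\<zeta>. ennreal (cmod (g \<zeta>)) \<partial>disc_measure (2 - 2))"
    by (rule integral_norm_bound_ennreal[OF int])
  finally show ?thesis by simp
qed (simp add: less_top[symmetric])

text \<open>The sub-mean value property on the disc of radius \<open>|c|/2\<close> around \<open>c\<close> bounds \<open>|c g(c)|\<^sup>2\<close> by the
  integral of \<open>|g|\<^sup>2\<close> over a shrinking neighbourhood of 0.\<close>

lemma L2_removable_singularity:
  assumes g: "g holomorphic_on ball 0 1 - {0}" and [measurable]: "g \<in> borel_measurable borel"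
    and fin: "(\<integral>\<^sup>+\<zeta>. ennreal (cmod (g \<zeta>) powr 2) \<partial>disc_measure 0) < \<infinity>"
  shows "\<exists>h. h holomorphic_on ball 0 1 \<and> (\<forall>z\<in>ball 0 1 - {0}. h z = g z)"
proof -
  define \<Phi> where "\<Phi> c = (\<integral>\<^sup>+w. indicator (ball 0 (3/2 * cmod c)) w * ennreal (cmod (g w) powr 2) \<partial>disc_measure 0)" for c :: complex
  have bound: "ennreal (pi / 4 * (cmod (c * g c))\<^sup>2) \<le> \<Phi> c" if c: "0 < cmod c" "cmod c < 1/2" for c
  proof -
    define \<rho> where "\<rho> = complex_of_real (cmod c / 2)"
    have \<rho>: "cmod \<rho> = cmod c / 2" "\<rho> \<noteq> 0" using c by (auto simp: \<rho>_def)
    have in_ball: "c + \<rho> * \<zeta> \<in> ball 0 1 - {0}" if "\<zeta> \<in> ball 0 1" for \<zeta>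
    proof -
      have l: "cmod (\<rho> * \<zeta>) < cmod c" using that c by (simp add: norm_mult \<rho>)
      then have "cmod (c + \<rho> * \<zeta>) < 1" using norm_triangle_ineq[of c "\<rho> * \<zeta>"] c by linarith
      moreover have "c + \<rho> * \<zeta> \<noteq> 0" using l by (metis add_eq_0_iff less_irrefl norm_minus_cancel)
      ultimately show ?thesis by simp
    qed
    \<comment> \<open>Applying the sub-mean value property to the square of \<open>g\<close>
      produces the integral of \<open>|g|\<^sup>2\<close>.\<close>
    have hol: "(\<lambda>\<zeta>. (g (c + \<rho> * \<zeta>))\<^sup>2) holomorphic_on ball 0 1"
      using in_ball
      by (intro holomorphic_intros holomorphic_on_compose_gen[OF _ g, unfolded o_def]) auto
    define F where "F = (\<lambda>w. indicator (ball 0 (cmod \<rho>)) w * ennreal ((cmod (g (c + w)))\<^sup>2))"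
    have [measurable]: "F \<in> borel_measurable borel" unfolding F_def by measurable
    have "ennreal ((cmod \<rho>)\<^sup>2) * ennreal (pi * cmod ((g (c + \<rho> * 0))\<^sup>2)) \<le>
        ennreal ((cmod \<rho>)\<^sup>2) * (\<integral>\<^sup>+\<zeta>. ennreal (cmod ((g (c + \<rho> * \<zeta>))\<^sup>2)) \<partial>disc_measure 0)"
      by (intro mult_left_mono sub_mean_value_disc[OF hol]) auto
    also have "(\<integral>\<^sup>+\<zeta>. ennreal (cmod ((g (c + \<rho> * \<zeta>))\<^sup>2)) \<partial>disc_measure 0) =
        (\<integral>\<^sup>+\<zeta>. F (\<rho> * \<zeta>) \<partial>lborel)"
    proof (subst nn_integral_disc_measure_0)
      show "(\<integral>\<^sup>+\<zeta>. indicator (ball 0 1) \<zeta> * ennreal (cmod ((g (c + \<rho> * \<zeta>))\<^sup>2)) \<partial>lborel) = (\<integral>\<^sup>+\<zeta>. F (\<rho> * \<zeta>) \<partial>lborel)"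
        using \<rho> by (intro nn_integral_cong)
          (auto simp: F_def norm_power norm_mult split: split_indicator)
    qed measurable
    also have "ennreal ((cmod \<rho>)\<^sup>2) * \<dots> = (\<integral>\<^sup>+w. F w \<partial>lborel)"
      by (rule nn_integral_lborel_complex_mult) (use \<rho> in auto)
    also have "\<dots> = (\<integral>\<^sup>+w. F w \<partial>distr lborel borel ((+) (- c)))"
      by (simp add: lborel_distr_plus)
    also have "\<dots> = (\<integral>\<^sup>+w. F (- c + w) \<partial>lborel)" by (subst nn_integral_distr) auto
    also have "\<dots> \<le> (\<integral>\<^sup>+w. indicator (ball 0 1) w * (indicator (ball 0 (3/2 * cmod c)) w * ennreal (cmod (g w) powr 2)) \<partial>lborel)"
    proof (rule nn_integral_mono)
      fix w :: complex
      \<comment> \<open>The disc of radius \<open>|c| / 2\<close> about \<open>c\<close> lies within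
        \<open>3/2 * |c|\<close> of the origin, hence inside the unit disc, as
        \<open>|c| < 1/2\<close>.\<close>
      have "w \<in> ball 0 1 \<and> w \<in> ball 0 (3/2 * cmod c)" if "cmod (- c + w) < cmod \<rho>"
        using norm_triangle_ineq[of c "- c + w"] that c \<rho> by simp
      then show "F (- c + w) \<le> indicator (ball 0 1) w * (indicator (ball 0 (3/2 * cmod c)) w * ennreal (cmod (g w) powr 2))"
        by (auto simp: F_def split: split_indicator)
    qed
    also have "\<dots> = \<Phi> c" unfolding \<Phi>_def by (rule nn_integral_disc_measure_0[symmetric]) measurable
    finally have "ennreal ((cmod \<rho>)\<^sup>2 * (pi * (cmod (g c))\<^sup>2)) \<le> \<Phi> c"
      by (simp add: ennreal_mult' norm_power)
    then show ?thesis by (simp add: \<rho> power_divide norm_mult power_mult_distrib mult_ac)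
  qed
  \<comment> \<open>Riemann's criterion: a singularity at 0 is removable once \<open>z * g z\<close>
    tends to 0.\<close>
  have "((\<lambda>z. (z - 0) * g z) \<longlongrightarrow> 0) (at 0)"
    unfolding tendsto_at_iff_sequentially
  proof (intro allI impI)
    fix X :: "nat \<Rightarrow> complex" assume X: "\<forall>i. X i \<in> UNIV - {0}" "X \<longlonglongrightarrow> 0"
    \<comment> \<open>Each \<open>w \<noteq> 0\<close> eventually leaves the shrinking balls, and
      the finite integral of \<open>|g|\<^sup>2\<close> dominates.\<close>
    have "(\<lambda>n. \<Phi> (X n)) \<longlonglongrightarrow> (\<integral>\<^sup>+w. 0 \<partial>disc_measure 0)"
      unfolding \<Phi>_def
    proof (rule nn_integral_dominated_convergence)
      show "(\<integral>\<^sup>+w. ennreal (cmod (g w) powr 2) \<partial>disc_measure 0) < \<infinity>" by (rule fin)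
      show "AE w in disc_measure 0. (\<lambda>n. indicator (ball 0 (3/2 * cmod (X n))) w * ennreal (cmod (g w) powr 2)) \<longlonglongrightarrow> 0"
        using AE_disc_measure
      proof eventually_elim
        case (elim w)
        then have "0 < 2/3 * cmod w" by simp
        then have "eventually (\<lambda>n. dist (X n) 0 < 2/3 * cmod w) sequentially"
          using X(2) by (rule tendstoD[rotated])
        then have "eventually (\<lambda>n. indicator (ball 0 (3/2 * cmod (X n))) w * ennreal (cmod (g w) powr 2) = 0) sequentially"
          by eventually_elim (auto split: split_indicator)
        then show ?case by (rule tendsto_eventually)
      qed
    qed (auto split: split_indicator)
    then have lim: "(\<lambda>n. \<Phi> (X n)) \<longlonglongrightarrow> 0" by simp
    have "eventually (\<lambda>n. dist (X n) 0 < 1/2) sequentially"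
      using X(2) by (rule tendstoD) simp
    then have ev: "eventually (\<lambda>n. ennreal (pi / 4 * (cmod (X n * g (X n)))\<^sup>2) \<le> \<Phi> (X n)) sequentially"
      by eventually_elim (use X(1) bound in auto)
    have "(\<lambda>n. ennreal (pi / 4 * (cmod (X n * g (X n)))\<^sup>2)) \<longlonglongrightarrow> 0"
      by (rule tendsto_sandwich[OF _ ev tendsto_const lim]) simp
    then have "(\<lambda>n. pi / 4 * (cmod (X n * g (X n)))\<^sup>2) \<longlonglongrightarrow> 0"
      by (subst (asm) ennreal_tendsto_0_iff) auto
    then have "(\<lambda>n. 4 / pi * (pi / 4 * (cmod (X n * g (X n)))\<^sup>2)) \<longlonglongrightarrow> 4 / pi * 0"
      by (intro tendsto_intros)
    then have "(\<lambda>n. sqrt ((cmod (X n * g (X n)))\<^sup>2)) \<longlonglongrightarrow> sqrt 0"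
      by (intro tendsto_intros) simp
    then have "(\<lambda>n. cmod (X n * g (X n))) \<longlonglongrightarrow> 0" by simp
    then show "((\<lambda>z. (z - 0) * g z) \<circ> X) \<longlonglongrightarrow> 0"
      by (simp add: o_def tendsto_norm_zero_iff)
  qed
  then show ?thesis
    using holomorphic_on_extend_lim[OF g] by auto
qed

section \<open>Reproducing property and orthogonality on the product\<close>

text \<open>The one-variable reproducing property is used twice, with parameter 2 in the first
  variable and \<open>s\<close> in the second. By Tonelli almost every slice is square-integrable;
  in the second variable the slices are only holomorphic off 0 and are first extended.\<close>

lemma bidisc_projection_reproducing:
  fixes E :: "complex \<times> complex \<Rightarrow> complex"
  assumes s: "0 < s" "s \<le> 2"
    and E [measurable]: "E \<in> borel_measurable (borel \<Otimes>\<^sub>M borel)"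
    and fin: "(\<integral>\<^sup>+x. ennreal (cmod (E x) powr 2) \<partial>bidisc_measure (s - 2)) < \<infinity>"
    and hol1: "\<And>z. z \<in> ball 0 1 - {0} \<Longrightarrow> (\<lambda>w. E (w, z)) holomorphic_on ball 0 1"
    and hol2: "\<And>w. w \<in> ball 0 1 \<Longrightarrow> (\<lambda>z. E (w, z)) holomorphic_on ball 0 1 - {0}"
  shows "AE x in bidisc_measure (s - 2). bidisc_projection s E x = E x"
proof -
  interpret P: pair_sigma_finite "disc_measure 0" "disc_measure (s - 2)" by (rule pair_sigma_finite_disc)
  have s2: "s - 2 > -2" using s by simp
  have fm: "finite_measure (disc_measure 0)" "finite_measure (disc_measure (s - 2))"
    using s2 by (auto intro: finite_measure_disc_measure)
  have [measurable]: "(\<lambda>z. E (w, z)) \<in> borel_measurable borel" "(\<lambda>w. E (w, z)) \<in> borel_measurable borel" for w z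
    by measurable
  have intE: "integrable (bidisc_measure (s - 2)) E"
    using finite_measure_bidisc_measure[OF s2] fin by (intro integrable_L2) auto
  have ae_w: "AE w in disc_measure 0. (\<integral>\<^sup>+z. ennreal (cmod (E (w, z)) powr 2) \<partial>disc_measure (s - 2)) \<noteq> \<infinity>"
  proof (rule nn_integral_PInf_AE)
    show "(\<integral>\<^sup>+w. \<integral>\<^sup>+z. ennreal (cmod (E (w, z)) powr 2) \<partial>disc_measure (s - 2) \<partial>disc_measure 0) \<noteq> \<infinity>"
      using fin unfolding bidisc_measure_def
      by (subst P.M2.nn_integral_fst[of "\<lambda>x. ennreal (cmod (E x) powr 2)"]) auto
  qed measurable
  have ae_z: "AE z in disc_measure (s - 2). (\<integral>\<^sup>+w. ennreal (cmod (E (w, z)) powr 2) \<partial>disc_measure 0) \<noteq> \<infinity>"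
  proof (rule nn_integral_PInf_AE)
    show "(\<integral>\<^sup>+z. \<integral>\<^sup>+w. ennreal (cmod (E (w, z)) powr 2) \<partial>disc_measure 0 \<partial>disc_measure (s - 2)) \<noteq> \<infinity>"
      using fin unfolding bidisc_measure_def
      by (subst P.nn_integral_snd[of "\<lambda>x. ennreal (cmod (E x) powr 2)"]) auto
  qed measurable
  \<comment> \<open>The universal quantifier over \<open>w\<close> stands inside, so that the
    exceptional null set of \<open>\<zeta>\<close> does not depend on \<open>w\<close>.\<close>
  have inner: "AE \<zeta> in disc_measure (s - 2). \<forall>w\<in>ball 0 1.
      (\<integral>\<eta>. disc_kernel 2 (w * cnj \<eta>) * E (\<eta>, \<zeta>) \<partial>disc_measure 0) = pi * E (w, \<zeta>)"
    using ae_z AE_disc_measure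
  proof eventually_elim
    case (elim \<zeta>)
    have "integrable (disc_measure (2 - 2)) (\<lambda>\<eta>. E (\<eta>, \<zeta>))"
      using elim fm by (intro integrable_L2) (auto simp: less_top)
    then show ?case
      using disc_kernel_reproducing(2)[of 2 _ "\<lambda>\<eta>. E (\<eta>, \<zeta>)"] hol1[OF elim(2)] by simp
  qed
  have outer: "(\<integral>\<zeta>. disc_kernel s (z * cnj \<zeta>) * E (w, \<zeta>) \<partial>disc_measure (s - 2)) = pi * E (w, z)"
    if w: "w \<in> ball 0 1" and z: "z \<in> ball 0 1 - {0}"
      and finw: "(\<integral>\<^sup>+z. ennreal (cmod (E (w, z)) powr 2) \<partial>disc_measure (s - 2)) \<noteq> \<infinity>" for w z
  proof -
    \<comment> \<open>As \<open>s \<le> 2\<close>, the weight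
      \<open>cmod \<zeta> powr (s - 2)\<close> is at least 1 on the punctured disc. Weighted square
      integrability thus implies the unweighted one, to which the removable singularity lemma
      applies.\<close>
    have "(\<integral>\<^sup>+\<zeta>. ennreal (cmod (E (w, \<zeta>)) powr 2) \<partial>disc_measure 0) \<le>
        (\<integral>\<^sup>+\<zeta>. ennreal (cmod \<zeta> powr (s - 2)) * ennreal (cmod (E (w, \<zeta>)) powr 2) \<partial>disc_measure 0)"
    proof (rule nn_integral_mono_AE)
      show "AE \<zeta> in disc_measure 0. ennreal (cmod (E (w, \<zeta>)) powr 2) \<le>
          ennreal (cmod \<zeta> powr (s - 2)) * ennreal (cmod (E (w, \<zeta>)) powr 2)"
        using AE_disc_measure
      proof eventually_elim
        case (elim \<zeta>)
        then have "1 \<le> cmod \<zeta> powr (s - 2)" using powr_mono2'[of "s - 2" "cmod \<zeta>" 1] s by simp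
        then have "1 * cmod (E (w, \<zeta>)) powr 2 \<le> cmod \<zeta> powr (s - 2) * cmod (E (w, \<zeta>)) powr 2"
          by (intro mult_right_mono) auto
        then show ?case by (simp add: ennreal_leI flip: ennreal_mult')
      qed
    qed
    also have "\<dots> = (\<integral>\<^sup>+\<zeta>. ennreal (cmod (E (w, \<zeta>)) powr 2) \<partial>density (disc_measure 0) (\<lambda>\<zeta>. ennreal (cmod \<zeta> powr (s - 2))))"
      by (rule nn_integral_density[symmetric]) measurable
    also have "\<dots> < \<infinity>" using finw by (simp add: density_disc_measure less_top)
    finally obtain h where h: "h holomorphic_on ball 0 1" "\<And>z. z \<in> ball 0 1 - {0} \<Longrightarrow> h z = E (w, z)"
      using L2_removable_singularity[OF hol2[OF w]] by auto
    \<comment> \<open>The extension \<open>h\<close> is controlled only on the disc. Changing the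
      slice at the single point 0 keeps it Borel measurable on the whole plane.\<close>
    define h' where "h' = (\<lambda>\<zeta>. if \<zeta> = 0 then h 0 else E (w, \<zeta>))"
    have [measurable]: "h' \<in> borel_measurable borel" unfolding h'_def by measurable
    have "h' holomorphic_on ball 0 1"
      using h(1) by (rule holomorphic_transform) (auto simp: h'_def h(2))
    moreover have eq: "AE \<zeta> in disc_measure (s - 2). E (w, \<zeta>) = h' \<zeta>"
      using AE_disc_measure by eventually_elim (auto simp: h'_def)
    moreover have "integrable (disc_measure (s - 2)) (\<lambda>\<zeta>. E (w, \<zeta>))"
      using fm finw by (intro integrable_L2) (auto simp: less_top)
    then have "integrable (disc_measure (s - 2)) h'"
      by (subst integrable_cong_AE[of _ _ "\<lambda>\<zeta>. E (w, \<zeta>)"]) (use eq in \<open>auto elim!: eventually_mono\<close>)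
    ultimately have "(\<integral>\<zeta>. disc_kernel s (z * cnj \<zeta>) * h' \<zeta> \<partial>disc_measure (s - 2)) = pi * h' z"
      using z by (intro disc_kernel_reproducing s) auto
    moreover have "(\<integral>\<zeta>. disc_kernel s (z * cnj \<zeta>) * E (w, \<zeta>) \<partial>disc_measure (s - 2)) =
        (\<integral>\<zeta>. disc_kernel s (z * cnj \<zeta>) * h' \<zeta> \<partial>disc_measure (s - 2))"
    proof (rule integral_cong_AE)
      show "AE \<zeta> in disc_measure (s - 2). disc_kernel s (z * cnj \<zeta>) * E (w, \<zeta>) = disc_kernel s (z * cnj \<zeta>) * h' \<zeta>"
        using eq by eventually_elim simp
    qed measurable
    ultimately show ?thesis using z by (simp add: h'_def)
  qed
  have point: "bidisc_projection s E (w, z) = E (w, z)"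
    if w: "w \<in> ball 0 1" and z: "z \<in> ball 0 1 - {0}"
      and finw: "(\<integral>\<^sup>+z. ennreal (cmod (E (w, z)) powr 2) \<partial>disc_measure (s - 2)) \<noteq> \<infinity>" for w z
  proof -
    have int: "integrable (disc_measure 0 \<Otimes>\<^sub>M disc_measure (s - 2)) (case_prod (\<lambda>\<eta> \<zeta>. bidisc_kernel s (w, z) (\<eta>, \<zeta>) * E (\<eta>, \<zeta>)))"
      using integrable_bidisc_kernel[OF s _ intE, of "(w, z)"] w z
      by (simp add: bidisc_measure_def case_prod_beta')
    have "bidisc_projection s E (w, z) = (\<integral>\<zeta>. (\<integral>\<eta>. bidisc_kernel s (w, z) (\<eta>, \<zeta>) * E (\<eta>, \<zeta>) \<partial>disc_measure 0) \<partial>disc_measure (s - 2))"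
      unfolding P.integral_snd[OF int] by (simp add: bidisc_projection_def bidisc_measure_def case_prod_beta')
    also have "\<dots> = (\<integral>\<zeta>. disc_kernel s (z * cnj \<zeta>) * E (w, \<zeta>) / pi \<partial>disc_measure (s - 2))"
    proof (rule integral_cong_AE)
      show "AE \<zeta> in disc_measure (s - 2). (\<integral>\<eta>. bidisc_kernel s (w, z) (\<eta>, \<zeta>) * E (\<eta>, \<zeta>) \<partial>disc_measure 0) =
          disc_kernel s (z * cnj \<zeta>) * E (w, \<zeta>) / pi"
        using inner
      proof eventually_elim
        case (elim \<zeta>)
        have "(\<integral>\<eta>. bidisc_kernel s (w, z) (\<eta>, \<zeta>) * E (\<eta>, \<zeta>) \<partial>disc_measure 0) =
            (\<integral>\<eta>. (disc_kernel s (z * cnj \<zeta>) / pi\<^sup>2) * (disc_kernel 2 (w * cnj \<eta>) * E (\<eta>, \<zeta>)) \<partial>disc_measure 0)"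
          by (simp add: bidisc_kernel_def mult_ac)
        also have "\<dots> = (disc_kernel s (z * cnj \<zeta>) / pi\<^sup>2) * (pi * E (w, \<zeta>))"
          using elim w by (simp only: integral_mult_right_zero)
        finally show ?case by (simp add: power2_eq_square)
      qed
      show "(\<lambda>\<zeta>. \<integral>\<eta>. bidisc_kernel s (w, z) (\<eta>, \<zeta>) * E (\<eta>, \<zeta>) \<partial>disc_measure 0) \<in> borel_measurable (disc_measure (s - 2))"
        using P.integrable_snd[OF int] by (rule borel_measurable_integrable)
    qed measurable
    also have "\<dots> = pi * E (w, z) / pi"
      by (simp only: integral_divide_zero outer[OF w z finw])
    finally show ?thesis by simp
  qed
  show ?thesis
    unfolding bidisc_measure_def
  proof (rule P.AE_pair_measure)
    show "{x \<in> space (disc_measure 0 \<Otimes>\<^sub>M disc_measure (s - 2)). bidisc_projection s E x = E x} \<in> sets (disc_measure 0 \<Otimes>\<^sub>M disc_measure (s - 2))"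
      by measurable
    show "AE w in disc_measure 0. AE z in disc_measure (s - 2). bidisc_projection s E (w, z) = E (w, z)"
      using ae_w AE_disc_measure[of 0]
    proof eventually_elim
      case (elim w)
      show ?case using AE_disc_measure[of "s - 2"]
        by eventually_elim (use elim point in auto)
    qed
  qed
qed

text \<open>By Hermitian symmetry the operator moves to \<open>E\<close>, which it reproduces. The
  exchange of integrals needs absolute convergence: the integral of \<open>|kernel * G|\<close> is
  in the weighted Lebesgue space with exponent 2 by the Schur bound, and pairing it with
  \<open>E\<close> is then integrable.\<close>

lemma bidisc_projection_orthogonal:
  fixes E G :: "complex \<times> complex \<Rightarrow> complex"
  assumes s: "0 < s" "s \<le> 2"
    and G [measurable]: "G \<in> borel_measurable (borel \<Otimes>\<^sub>M borel)"
    and finG: "(\<integral>\<^sup>+x. ennreal (cmod (G x) powr 2) \<partial>bidisc_measure (s - 2)) < \<infinity>"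
    and E [measurable]: "E \<in> borel_measurable (borel \<Otimes>\<^sub>M borel)"
    and finE: "(\<integral>\<^sup>+x. ennreal (cmod (E x) powr 2) \<partial>bidisc_measure (s - 2)) < \<infinity>"
    and hol1: "\<And>z. z \<in> ball 0 1 - {0} \<Longrightarrow> (\<lambda>w. E (w, z)) holomorphic_on ball 0 1"
    and hol2: "\<And>w. w \<in> ball 0 1 \<Longrightarrow> (\<lambda>z. E (w, z)) holomorphic_on ball 0 1 - {0}"
  shows "(\<integral>x. (G x - bidisc_projection s G x) * cnj (E x) \<partial>bidisc_measure (s - 2)) = 0"
proof -
  let ?P = "bidisc_measure (s - 2)"
  interpret P: sigma_finite_measure ?P by (rule sigma_finite_bidisc_measure)
  interpret PP: pair_sigma_finite ?P ?P ..
  have s2: "s - 2 > -2" using s by simp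
  have intG: "integrable ?P G"
    using finite_measure_bidisc_measure[OF s2] finG by (intro integrable_L2) auto
  \<comment> \<open>The case \<open>p = 2\<close> with source, target and kernel exponents all equal
    to \<open>s - 2\<close>; the condition reduces to \<open>s > 0\<close>.\<close>
  have c: "(2 :: real) > 1" "(s - 2 - (s - 2)) * (2 / (2 - 1)) + (s - 2) > -2" using s by auto
  obtain C where C: "C > 0" "\<And>G J. G \<in> borel_measurable (borel \<Otimes>\<^sub>M borel) \<Longrightarrow> (\<And>x. 0 \<le> J x) \<Longrightarrow>
      (\<And>x. ennreal (J x) \<le> (\<integral>\<^sup>+y. ennreal (cmod (bidisc_kernel s x y * G y)) \<partial>?P)) \<Longrightarrow>
      (\<integral>\<^sup>+x. ennreal (J x powr 2) \<partial>?P) \<le> ennreal C * (\<integral>\<^sup>+y. ennreal (cmod (G y) powr 2) \<partial>?P)"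
    by (rule bidisc_Lp_bound[OF s c(1) s2 c(2)]) blast
  \<comment> \<open>Where the integrand is not integrable, \<open>N x\<close> is the Bochner default
    0, and the domination required of \<open>J\<close> still holds.\<close>
  define N where "N x = (\<integral>y. cmod (bidisc_kernel s x y * G y) \<partial>?P)" for x
  have [measurable]: "N \<in> borel_measurable (borel \<Otimes>\<^sub>M borel)" unfolding N_def by measurable
  have N0: "0 \<le> N x" for x by (simp add: N_def)
  have "(\<integral>\<^sup>+x. ennreal (N x powr 2) \<partial>?P) \<le> ennreal C * (\<integral>\<^sup>+y. ennreal (cmod (G y) powr 2) \<partial>?P)"
  proof (rule C(2))
    show "ennreal (N x) \<le> (\<integral>\<^sup>+y. ennreal (cmod (bidisc_kernel s x y * G y)) \<partial>?P)" for x
    proof (cases "integrable ?P (\<lambda>y. bidisc_kernel s x y * G y)")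
      case True
      then show ?thesis unfolding N_def by (subst nn_integral_eq_integral) auto
    next
      case False
      then have "\<not> integrable ?P (\<lambda>y. cmod (bidisc_kernel s x y * G y))"
        by (subst integrable_norm_iff) auto
      then show ?thesis unfolding N_def by (simp add: not_integrable_integral_eq)
    qed
  qed (auto simp: N_def)
  also have "\<dots> < \<infinity>" using finG by (simp add: ennreal_mult_less_top)
  finally have finN: "(\<integral>\<^sup>+x. ennreal (cmod (complex_of_real (N x)) powr 2) \<partial>?P) < \<infinity>"
    using N0 by simp
  have finE': "(\<integral>\<^sup>+x. ennreal (cmod (cnj (E x)) powr 2) \<partial>?P) < \<infinity>" using finE by simp
  have intN: "integrable ?P (\<lambda>x. complex_of_real (N x) * cnj (E x))"
    using finN finE' by (intro integrable_mult_L2) auto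
  have int: "integrable (?P \<Otimes>\<^sub>M ?P) (case_prod (\<lambda>x y. bidisc_kernel s x y * G y * cnj (E x)))"
  proof (rule PP.Fubini_integrable)
    show "case_prod (\<lambda>x y. bidisc_kernel s x y * G y * cnj (E x)) \<in> borel_measurable (?P \<Otimes>\<^sub>M ?P)"
      unfolding case_prod_beta by measurable
    have "(\<lambda>x. \<integral>y. cmod (case_prod (\<lambda>x y. bidisc_kernel s x y * G y * cnj (E x)) (x, y)) \<partial>?P) = (\<lambda>x. cmod (complex_of_real (N x) * cnj (E x)))"
      unfolding N_def by (simp add: norm_mult[of _ "cnj _"])
    then show "integrable ?P (\<lambda>x. \<integral>y. cmod (case_prod (\<lambda>x y. bidisc_kernel s x y * G y * cnj (E x)) (x, y)) \<partial>?P)"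
      using integrable_norm[OF intN] by simp
    show "AE x in ?P. integrable ?P (\<lambda>y. case_prod (\<lambda>x y. bidisc_kernel s x y * G y * cnj (E x)) (x, y))"
      using AE_bidisc_measure
    proof eventually_elim
      case (elim x)
      then have "integrable ?P (\<lambda>y. bidisc_kernel s x y * G y)"
        by (intro integrable_bidisc_kernel s intG) auto
      then show ?case by simp
    qed
  qed
  have eq1: "(\<integral>x. bidisc_projection s G x * cnj (E x) \<partial>?P) = (\<integral>x. (\<integral>y. bidisc_kernel s x y * G y * cnj (E x) \<partial>?P) \<partial>?P)"
    unfolding bidisc_projection_def by simp
  also have "\<dots> = (\<integral>y. (\<integral>x. bidisc_kernel s x y * G y * cnj (E x) \<partial>?P) \<partial>?P)"
    by (rule PP.Fubini_integral[OF int, symmetric])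
  also have "\<dots> = (\<integral>y. G y * cnj (bidisc_projection s E y) \<partial>?P)"
  proof (rule Bochner_Integration.integral_cong[OF refl])
    fix y
    have "(\<integral>x. bidisc_kernel s x y * G y * cnj (E x) \<partial>?P) = (\<integral>x. G y * cnj (bidisc_kernel s y x * E x) \<partial>?P)"
      by (simp add: bidisc_kernel_cnj mult_ac)
    also have "\<dots> = G y * cnj (bidisc_projection s E y)"
      unfolding bidisc_projection_def by (simp only: integral_mult_right_zero Bochner_Integration.integral_cnj)
    finally show "(\<integral>x. bidisc_kernel s x y * G y * cnj (E x) \<partial>?P) = G y * cnj (bidisc_projection s E y)" .
  qed
  also have "\<dots> = (\<integral>y. G y * cnj (E y) \<partial>?P)"
  proof (rule integral_cong_AE)
    have "AE y in ?P. bidisc_projection s E y = E y"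
      by (rule bidisc_projection_reproducing[OF s E finE hol1 hol2])
    then show "AE y in ?P. G y * cnj (bidisc_projection s E y) = G y * cnj (E y)"
      by eventually_elim simp
  qed measurable
  finally have eq: "(\<integral>x. bidisc_projection s G x * cnj (E x) \<partial>?P) = (\<integral>y. G y * cnj (E y) \<partial>?P)" .
  have "integrable ?P (\<lambda>x. bidisc_projection s G x * cnj (E x))"
    using PP.integrable_fst[OF int] unfolding bidisc_projection_def by simp
  moreover have "integrable ?P (\<lambda>x. G x * cnj (E x))"
    using finG finE' by (intro integrable_mult_L2) auto
  ultimately show ?thesis using eq by (simp add: left_diff_distrib)
qed

section \<open>Holomorphic dependence on a parameter\<close>

text \<open>The normalized remainder of the first-order expansion tends to 0 pointwise and is at
  most \<open>2 * B y\<close>: one \<open>B y\<close> from the mean value inequality on the ball,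
  one from the linear term. Dominated convergence is applied along sequences.\<close>

lemma has_derivative_integral:
  fixes f :: "'a :: real_normed_vector \<Rightarrow> 'b \<Rightarrow> 'c :: {banach, second_countable_topology}"
  assumes e: "e > 0"
    and int: "\<And>x. x \<in> ball x0 e \<Longrightarrow> integrable M (f x)"
    and der: "AE y in M. \<forall>x\<in>ball x0 e. ((\<lambda>x. f x y) has_derivative f' x y) (at x)"
    and bound: "AE y in M. \<forall>x\<in>ball x0 e. \<forall>v. norm (f' x y v) \<le> B y * norm v"
    and B: "integrable M B"
    and meas: "\<And>v. (\<lambda>y. f' x0 y v) \<in> borel_measurable M"
  shows "((\<lambda>x. \<integral>y. f x y \<partial>M) has_derivative (\<lambda>v. \<integral>y. f' x0 y v \<partial>M)) (at x0)"
proof -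
  have x0: "x0 \<in> ball x0 e" using e by simp
  have int': "integrable M (\<lambda>y. f' x0 y v)" for v
  proof (rule Bochner_Integration.integrable_bound)
    show "integrable M (\<lambda>y. B y * norm v)" using B by simp
    show "AE y in M. norm (f' x0 y v) \<le> norm (B y * norm v)"
      using bound
    proof eventually_elim
      case (elim y)
      then have "norm (f' x0 y v) \<le> B y * norm v" using x0 by blast
      then show ?case unfolding real_norm_def by linarith
    qed
  qed (rule meas)
  have lin: "AE y in M. bounded_linear (f' x0 y)"
    using der by eventually_elim (use x0 in \<open>auto intro: has_derivative_bounded_linear\<close>)
  have bl: "bounded_linear (\<lambda>v. \<integral>y. f' x0 y v \<partial>M)"
  proof (rule bounded_linear_intro)
    fix v w
    have "(\<integral>y. f' x0 y (v + w) \<partial>M) = (\<integral>y. f' x0 y v + f' x0 y w \<partial>M)"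
    proof (rule integral_cong_AE)
      show "AE y in M. f' x0 y (v + w) = f' x0 y v + f' x0 y w"
        using lin by eventually_elim (simp add: bounded_linear.linear linear_add)
    qed (use meas in auto)
    then show "(\<integral>y. f' x0 y (v + w) \<partial>M) = (\<integral>y. f' x0 y v \<partial>M) + (\<integral>y. f' x0 y w \<partial>M)"
      using int' by simp
  next
    fix c v
    have "(\<integral>y. f' x0 y (c *\<^sub>R v) \<partial>M) = (\<integral>y. c *\<^sub>R f' x0 y v \<partial>M)"
    proof (rule integral_cong_AE)
      show "AE y in M. f' x0 y (c *\<^sub>R v) = c *\<^sub>R f' x0 y v"
        using lin by eventually_elim (simp add: bounded_linear.linear linear_scale)
    qed (use meas in auto)
    then show "(\<integral>y. f' x0 y (c *\<^sub>R v) \<partial>M) = c *\<^sub>R (\<integral>y. f' x0 y v \<partial>M)" by simp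
  next
    fix v
    have "norm (\<integral>y. f' x0 y v \<partial>M) \<le> (\<integral>y. norm (f' x0 y v) \<partial>M)" by (rule integral_norm_bound)
    also have "\<dots> \<le> (\<integral>y. B y * norm v \<partial>M)"
    proof (rule integral_mono_AE)
      show "AE y in M. norm (f' x0 y v) \<le> B y * norm v"
        using bound by eventually_elim (use x0 in auto)
    qed (use int' B in auto)
    finally show "norm (\<integral>y. f' x0 y v \<partial>M) \<le> norm v * (\<integral>y. B y \<partial>M)" by (simp add: mult.commute)
  qed
  have lim: "((\<lambda>x. norm ((\<integral>y. f x y \<partial>M) - (\<integral>y. f x0 y \<partial>M) - (\<integral>y. f' x0 y (x - x0) \<partial>M)) / norm (x - x0)) \<longlongrightarrow> 0) (at x0)"
    unfolding tendsto_at_iff_sequentially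
  proof (intro allI impI)
    fix X :: "nat \<Rightarrow> 'a" assume X: "\<forall>i. X i \<in> UNIV - {x0}" "X \<longlonglongrightarrow> x0"
    define r where "r n y = norm (f (X n) y - f x0 y - f' x0 y (X n - x0)) / norm (X n - x0)" for n y
    \<comment> \<open>Cutting off outside the ball makes the domination valid for every
      \<open>n\<close>, not just eventually.\<close>
    define u where "u n y = (if X n \<in> ball x0 e then r n y else 0)" for n y
    have ev: "eventually (\<lambda>n. X n \<in> ball x0 e) sequentially"
      using X(2) e by (auto dest: tendstoD simp: dist_commute)
    have "(\<lambda>n. \<integral>y. u n y \<partial>M) \<longlonglongrightarrow> (\<integral>y. 0 \<partial>M)"
    proof (rule integral_dominated_convergence)
      show "integrable M (\<lambda>y. 2 * B y)" using B by simp
      show "AE y in M. norm (u n y) \<le> 2 * B y" for n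
        using der bound
      proof eventually_elim
        case (elim y)
        have B0: "B y \<ge> 0"
        proof -
          have "X n - x0 \<noteq> 0" using X(1) by auto
          moreover have "norm (f' x0 y (X n - x0)) \<le> B y * norm (X n - x0)" using elim(2) x0 by blast
          then have "0 \<le> B y * norm (X n - x0)" by (rule order_trans[OF norm_ge_zero])
          ultimately show ?thesis by (simp add: zero_le_mult_iff)
        qed
        show ?case
        proof (cases "X n \<in> ball x0 e")
          case True
          have "norm (f (X n) y - f x0 y) \<le> B y * norm (X n - x0)"
          proof (rule differentiable_bound[of "ball x0 e" "\<lambda>x. f x y" "\<lambda>x. f' x y"])
            fix x assume x: "x \<in> ball x0 e"
            show "((\<lambda>x. f x y) has_derivative f' x y) (at x within ball x0 e)"
              using elim(1) x by (blast intro: has_derivative_at_withinI)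
            show "onorm (f' x y) \<le> B y"
              using elim(2) x B0 by (intro onorm_bound) auto
          qed (use True x0 in auto)
          moreover have "norm (f' x0 y (X n - x0)) \<le> B y * norm (X n - x0)" using elim(2) x0 by auto
          ultimately have "norm (f (X n) y - f x0 y - f' x0 y (X n - x0)) \<le> (2 * B y) * norm (X n - x0)"
            using norm_triangle_ineq4[of "f (X n) y - f x0 y" "f' x0 y (X n - x0)"] by simp
          then have "r n y \<le> 2 * B y" unfolding r_def using X(1) by (simp add: divide_le_eq)
          then show ?thesis using True by (simp add: u_def r_def)
        qed (use B0 in \<open>simp add: u_def\<close>)
      qed
      show "AE y in M. (\<lambda>n. u n y) \<longlonglongrightarrow> 0"
        using der
      proof eventually_elim
        case (elim y)
        then have "((\<lambda>x. f x y) has_derivative f' x0 y) (at x0)" using x0 by blast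
        then have "((\<lambda>x. norm (f x y - f x0 y - f' x0 y (x - x0)) / norm (x - x0)) \<longlongrightarrow> 0) (at x0)"
          by (simp add: has_derivative_iff_norm)
        then have "(\<lambda>n. r n y) \<longlonglongrightarrow> 0"
          unfolding tendsto_at_iff_sequentially r_def using X by (auto simp: o_def)
        moreover have "eventually (\<lambda>n. r n y = u n y) sequentially"
          using ev by eventually_elim (simp add: u_def)
        ultimately show ?case by (rule Lim_transform_eventually)
      qed
      show "u n \<in> borel_measurable M" for n
      proof (cases "X n \<in> ball x0 e")
        case True
        have [measurable]: "(\<lambda>y. f' x0 y (X n - x0)) \<in> borel_measurable M" by (rule meas)
        have [measurable]: "f (X n) \<in> borel_measurable M" "f x0 \<in> borel_measurable M"
          by (rule borel_measurable_integrable[OF int[OF True]], rule borel_measurable_integrable[OF int[OF x0]])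
        have "u n = r n" using True by (simp add: u_def fun_eq_iff)
        then show ?thesis unfolding r_def[abs_def] by simp
      qed (simp add: u_def[abs_def])
    qed simp
    then have lim0: "(\<lambda>n. \<integral>y. u n y \<partial>M) \<longlonglongrightarrow> 0" by simp
    have ev2: "eventually (\<lambda>n. norm ((\<integral>y. f (X n) y \<partial>M) - (\<integral>y. f x0 y \<partial>M) - (\<integral>y. f' x0 y (X n - x0) \<partial>M)) / norm (X n - x0) \<le> (\<integral>y. u n y \<partial>M)) sequentially"
      using ev
    proof eventually_elim
      case (elim n)
      have eq: "(\<integral>y. f (X n) y \<partial>M) - (\<integral>y. f x0 y \<partial>M) - (\<integral>y. f' x0 y (X n - x0) \<partial>M) =
          (\<integral>y. f (X n) y - f x0 y - f' x0 y (X n - x0) \<partial>M)"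
        by (simp only: Bochner_Integration.integral_diff Bochner_Integration.integrable_diff
            int[OF elim] int[OF x0] int')
      have "norm ((\<integral>y. f (X n) y \<partial>M) - (\<integral>y. f x0 y \<partial>M) - (\<integral>y. f' x0 y (X n - x0) \<partial>M)) / norm (X n - x0) \<le>
          (\<integral>y. norm (f (X n) y - f x0 y - f' x0 y (X n - x0)) \<partial>M) / norm (X n - x0)"
        unfolding eq by (intro divide_right_mono integral_norm_bound norm_ge_zero)
      also have "\<dots> = (\<integral>y. u n y \<partial>M)" using elim by (simp add: u_def r_def)
      finally show ?case .
    qed
    show "((\<lambda>x. norm ((\<integral>y. f x y \<partial>M) - (\<integral>y. f x0 y \<partial>M) - (\<integral>y. f' x0 y (x - x0) \<partial>M)) / norm (x - x0)) \<circ> X) \<longlonglongrightarrow> 0"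
      unfolding o_def by (rule tendsto_sandwich[OF _ ev2 tendsto_const lim0]) simp
  qed
  show ?thesis using bl lim by (simp add: has_derivative_iff_norm)
qed

definition disc_kernel_deriv :: "real \<Rightarrow> complex \<Rightarrow> complex" where
  "disc_kernel_deriv s x =
    ((1 - of_real (s / 2)) * (1 - x) + 2 * (x + of_real (s / 2) * (1 - x))) / (1 - x) ^ 3"

lemma measurable_disc_kernel_deriv [measurable]: "disc_kernel_deriv s \<in> borel_measurable borel"
  unfolding disc_kernel_deriv_def by measurable

lemma disc_kernel_has_field_derivative:
  assumes "x \<noteq> 1"
  shows "(disc_kernel s has_field_derivative disc_kernel_deriv s x) (at x)"
proof -
  define d where "d = 1 - x"
  have d: "d \<noteq> 0" "1 - x = d" using assms by (auto simp: d_def)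
  have "(disc_kernel s has_field_derivative
      ((1 - of_real (s / 2)) * d\<^sup>2 - (x + of_real (s / 2) * d) * (- (2 * d))) / (d\<^sup>2 * d\<^sup>2)) (at x)"
    unfolding disc_kernel_def using assms
    by (auto intro!: derivative_eq_intros simp: d)
  also have "((1 - of_real (s / 2)) * d\<^sup>2 - (x + of_real (s / 2) * d) * (- (2 * d))) / (d\<^sup>2 * d\<^sup>2) = disc_kernel_deriv s x"
    unfolding disc_kernel_deriv_def d(2) using d(1)
    by (simp add: divide_simps power2_eq_square power3_eq_cube) (simp add: algebra_simps)
  finally show ?thesis .
qed

text \<open>The kernel is holomorphic in \<open>x\<close>, so its derivative is complex-linear, and
  this passes to the integral. For \<open>x\<close> near \<open>x0\<close> all products
  \<open>x * cnj y\<close> stay in one compact disc inside the unit disc, where kernels and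
  derivatives are bounded; a constant times \<open>|G|\<close> therefore dominates.\<close>

lemma bidisc_projection_has_derivative:
  assumes s: "0 < s" "s \<le> 2" and G: "integrable (bidisc_measure (s - 2)) G"
    and x0: "x0 \<in> ball 0 1 \<times> ball 0 1"
  shows "\<exists>D. (bidisc_projection s G has_derivative D) (at x0) \<and> (\<forall>c v. D (c * fst v, c * snd v) = c * D v)"
proof -
  let ?P = "bidisc_measure (s - 2)"
  have [measurable]: "G \<in> borel_measurable (borel \<Otimes>\<^sub>M borel)"
    using borel_measurable_integrable[OF G] by (simp cong: measurable_cong_sets)
  define m where "m = max (cmod (fst x0)) (cmod (snd x0))"
  have m: "0 \<le> m" "m < 1" using x0 by (auto simp: m_def mem_Times_iff le_max_iff_disj)
  \<comment> \<open>Halfway between the larger coordinate modulus of \<open>x0\<close> and 1; the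
    radius \<open>e\<close> uses up exactly the gap from \<open>m\<close> to
    \<open>\<rho>\<close>.\<close>
  define \<rho> where "\<rho> = (1 + m) / 2"
  define e where "e = (1 - m) / 2"
  have \<rho>: "\<rho> < 1" "0 \<le> \<rho>" and e: "e > 0" "m + e = \<rho>" using m by (auto simp: \<rho>_def e_def field_simps)
  have fst_le: "cmod (fst v) \<le> norm v" and snd_le: "cmod (snd v) \<le> norm v" for v :: "complex \<times> complex"
    using norm_fst_le[of "fst v" "snd v"] norm_snd_le[of "snd v" "fst v"] by auto
  have xe: "cmod (fst x) \<le> \<rho>" "cmod (snd x) \<le> \<rho>" if "x \<in> ball x0 e" for x
  proof -
    have "norm (x - x0) < e" using that by (simp add: dist_norm norm_minus_commute)
    then have "cmod (fst x - fst x0) < e" "cmod (snd x - snd x0) < e"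
      using fst_le[of "x - x0"] snd_le[of "x - x0"] by auto
    moreover have "cmod (fst x0) \<le> m" "cmod (snd x0) \<le> m" by (auto simp: m_def)
    ultimately show "cmod (fst x) \<le> \<rho>" "cmod (snd x) \<le> \<rho>"
      using norm_triangle_sub[of "fst x" "fst x0"] norm_triangle_sub[of "snd x" "snd x0"] e by linarith+
  qed
  have xb: "x \<in> ball 0 1 \<times> ball 0 1" if "x \<in> ball x0 e" for x
    using xe[OF that] \<rho> by (auto simp: mem_Times_iff)
  have bdd: "\<exists>K\<ge>0. \<forall>x\<in>cball 0 \<rho>. cmod (disc_kernel t x) \<le> K \<and> cmod (disc_kernel_deriv t x) \<le> K" for t
  proof -
    have sub: "cball 0 \<rho> \<subseteq> ball (0 :: complex) 1" using \<rho> by auto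
    have "1 - x \<noteq> 0" if "x \<in> cball 0 \<rho>" for x :: complex using that \<rho> by auto
    then have "continuous_on (cball 0 \<rho>) (disc_kernel_deriv t)" "continuous_on (cball 0 \<rho>) (disc_kernel t)"
      unfolding disc_kernel_deriv_def disc_kernel_def by (intro continuous_intros; force)+
    then have "bounded (disc_kernel_deriv t ` cball 0 \<rho>)" "bounded (disc_kernel t ` cball 0 \<rho>)"
      by (auto intro!: compact_imp_bounded compact_continuous_image)
    then obtain K1 K2 where "\<forall>x\<in>cball 0 \<rho>. cmod (disc_kernel_deriv t x) \<le> K1" "\<forall>x\<in>cball 0 \<rho>. cmod (disc_kernel t x) \<le> K2"
      unfolding bounded_iff by auto
    then show ?thesis by (intro exI[of _ "max 0 (max K1 K2)"]) (auto simp: le_max_iff_disj)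
  qed
  obtain K1 where K1: "K1 \<ge> 0" "\<And>x. x \<in> cball 0 \<rho> \<Longrightarrow> cmod (disc_kernel 2 x) \<le> K1" "\<And>x. x \<in> cball 0 \<rho> \<Longrightarrow> cmod (disc_kernel_deriv 2 x) \<le> K1"
    using bdd[of 2] by auto
  obtain K2 where K2: "K2 \<ge> 0" "\<And>x. x \<in> cball 0 \<rho> \<Longrightarrow> cmod (disc_kernel s x) \<le> K2" "\<And>x. x \<in> cball 0 \<rho> \<Longrightarrow> cmod (disc_kernel_deriv s x) \<le> K2"
    using bdd[of s] by auto
  define f' where "f' x y v =
      (disc_kernel 2 (fst x * cnj (fst y)) * (disc_kernel_deriv s (snd x * cnj (snd y)) * (snd v * cnj (snd y))) +
       disc_kernel_deriv 2 (fst x * cnj (fst y)) * (fst v * cnj (fst y)) * disc_kernel s (snd x * cnj (snd y)))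
      / of_real (pi\<^sup>2) * G y" for x y and v :: "complex \<times> complex"
  have D: "((\<lambda>x. \<integral>y. bidisc_kernel s x y * G y \<partial>?P) has_derivative (\<lambda>v. \<integral>y. f' x0 y v \<partial>?P)) (at x0)"
  proof (rule has_derivative_integral[OF e(1)])
    show "integrable ?P (\<lambda>y. bidisc_kernel s x y * G y)" if "x \<in> ball x0 e" for x
      by (intro integrable_bidisc_kernel s G xb that)
    show "AE y in ?P. \<forall>x\<in>ball x0 e. ((\<lambda>x. bidisc_kernel s x y * G y) has_derivative f' x y) (at x)"
      using AE_bidisc_measure
    proof (eventually_elim, intro ballI)
      fix y x :: "complex \<times> complex" assume y: "y \<in> ball 0 1 \<times> (ball 0 1 - {0})" and x: "x \<in> ball x0 e"
      have der: "((\<lambda>x. disc_kernel t (l x * c)) has_derivative (\<lambda>v. disc_kernel_deriv t (l x * c) * (l v * c))) (at x)"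
        if "bounded_linear l" "cmod (l x * c) < 1" for t c and l :: "complex \<times> complex \<Rightarrow> complex"
      proof -
        have "(disc_kernel t has_field_derivative disc_kernel_deriv t (l x * c)) (at (l x * c))"
          using that(2) by (intro disc_kernel_has_field_derivative) auto
        then have 1: "(disc_kernel t has_derivative (*) (disc_kernel_deriv t (l x * c))) (at (l x * c))"
          by (simp add: has_field_derivative_def)
        have "((\<lambda>x. l x * c) has_derivative (\<lambda>v. l v * c)) (at x)"
          by (intro has_derivative_mult_left bounded_linear_imp_has_derivative that)
        from has_derivative_compose[OF this 1] show ?thesis .
      qed
      have n1: "cmod (fst x * cnj (fst y)) < 1" "cmod (snd x * cnj (snd y)) < 1"
        using xb[OF x] y by (auto intro!: norm_mult_cnj_less_1)
      note der1 = der[OF bounded_linear_fst n1(1), of 2]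
      note der2 = der[OF bounded_linear_snd n1(2), of s]
      show "((\<lambda>x. bidisc_kernel s x y * G y) has_derivative f' x y) (at x)"
        unfolding bidisc_kernel_def f'_def divide_inverse
        by (intro has_derivative_mult_left has_derivative_mult[OF der1 der2])
    qed
    show "AE y in ?P. \<forall>x\<in>ball x0 e. \<forall>v. cmod (f' x y v) \<le> 2 * (K1 * K2) * cmod (G y) * norm v"
      using AE_bidisc_measure
    proof (eventually_elim, intro ballI allI)
      fix y x v :: "complex \<times> complex" assume y: "y \<in> ball 0 1 \<times> (ball 0 1 - {0})" and x: "x \<in> ball x0 e"
      have y1: "cmod (fst y) \<le> 1" "cmod (snd y) \<le> 1" using y by auto
      have in\<rho>: "fst x * cnj (fst y) \<in> cball 0 \<rho>" "snd x * cnj (snd y) \<in> cball 0 \<rho>"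
        using mult_mono[OF xe(1)[OF x] y1(1)] mult_mono[OF xe(2)[OF x] y1(2)] \<rho> by (auto simp: norm_mult)
      have vy: "cmod (snd v * cnj (snd y)) \<le> norm v" "cmod (fst v * cnj (fst y)) \<le> norm v"
        using mult_mono[OF snd_le y1(2), of v] mult_mono[OF fst_le y1(1), of v] by (auto simp: norm_mult)
      have pi1: "1 \<le> pi\<^sup>2" using pi_ge_two by (intro one_le_power) linarith
      let ?A = "disc_kernel 2 (fst x * cnj (fst y)) * (disc_kernel_deriv s (snd x * cnj (snd y)) * (snd v * cnj (snd y)))"
      let ?B = "disc_kernel_deriv 2 (fst x * cnj (fst y)) * (fst v * cnj (fst y)) * disc_kernel s (snd x * cnj (snd y))"
      have "cmod ?A \<le> K1 * (K2 * norm v)"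
        unfolding norm_mult[of "disc_kernel _ _"] norm_mult[of "disc_kernel_deriv _ _"]
        using K1 K2 in\<rho> vy by (intro mult_mono) auto
      moreover have "cmod ?B \<le> (K1 * norm v) * K2"
        unfolding norm_mult[of "_ * _" "disc_kernel _ _"] norm_mult[of "disc_kernel_deriv _ _"]
        using K1 K2 in\<rho> vy by (intro mult_mono) auto
      ultimately have AB: "cmod (?A + ?B) \<le> 2 * (K1 * K2) * norm v"
        using norm_triangle_ineq[of ?A ?B] by (simp add: mult_ac)
      have "cmod ((?A + ?B) / of_real (pi\<^sup>2)) = cmod (?A + ?B) / pi\<^sup>2" by (simp add: norm_divide norm_power)
      also have "\<dots> \<le> cmod (?A + ?B) / 1" using pi1 by (intro divide_left_mono) auto
      finally have "cmod ((?A + ?B) / of_real (pi\<^sup>2)) \<le> 2 * (K1 * K2) * norm v" using AB by simp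
      then have "cmod ((?A + ?B) / of_real (pi\<^sup>2)) * cmod (G y) \<le> (2 * (K1 * K2) * norm v) * cmod (G y)"
        by (rule mult_right_mono) simp
      also have "\<dots> = 2 * (K1 * K2) * cmod (G y) * norm v" by (simp only: mult_ac)
      finally show "cmod (f' x y v) \<le> 2 * (K1 * K2) * cmod (G y) * norm v"
        unfolding f'_def norm_mult[of _ "G y"] .
    qed
    show "integrable ?P (\<lambda>y. 2 * (K1 * K2) * cmod (G y))" using G by simp
    show "(\<lambda>y. f' x0 y v) \<in> borel_measurable ?P" for v
      unfolding f'_def by measurable
  qed
  have "f' x0 y (c * fst v, c * snd v) = c * f' x0 y v" for y c v
  proof -
    have e: "x / q * g = c * (y / q * g)" if "x = c * y" for x y q g :: complex using that by simp
    show ?thesis unfolding f'_def fst_conv snd_conv by (rule e) algebra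
  qed
  then have "(\<integral>y. f' x0 y (c * fst v, c * snd v) \<partial>?P) = c * (\<integral>y. f' x0 y v \<partial>?P)" for c v
    by simp
  then show ?thesis
    using D by (intro exI[of _ "\<lambda>v. \<integral>y. f' x0 y v \<partial>?P"]) (auto simp: bidisc_projection_def[abs_def])
qed

text \<open>Rotation averages annihilate all but the constant term \<open>s / 2\<close> of the
  second kernel. The first variable contributes \<open>pi\<close>, and division by
  \<open>pi\<^sup>2\<close> leaves the factor \<open>s / (2 * pi)\<close>.\<close>

lemma bidisc_projection_radial:
  fixes \<phi> :: "real \<Rightarrow> real"
  assumes s: "0 < s" "s \<le> 2" and x: "x \<in> ball 0 1 \<times> ball 0 1"
    and [measurable]: "\<phi> \<in> borel_measurable borel"
    and int: "integrable (disc_measure (s - 2)) (\<lambda>\<zeta>. complex_of_real (\<phi> (cmod \<zeta>)))"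
  shows "bidisc_projection s (\<lambda>y. complex_of_real (\<phi> (cmod (snd y)))) x =
    of_real (s / (2 * pi)) * (\<integral>\<zeta>. complex_of_real (\<phi> (cmod \<zeta>)) \<partial>disc_measure (s - 2))"
proof -
  interpret P: pair_sigma_finite "disc_measure 0" "disc_measure (s - 2)" by (rule pair_sigma_finite_disc)
  define w z where "w = fst x" and "z = snd x"
  have wz: "w \<in> ball 0 1" "z \<in> ball 0 1" using x by (auto simp: w_def z_def mem_Times_iff)
  have "integrable (bidisc_measure (s - 2)) (\<lambda>y. complex_of_real (\<phi> (cmod (snd y))))"
  proof (rule integrableI_bounded)
    have "(\<integral>\<^sup>+y. ennreal (cmod (complex_of_real (\<phi> (cmod (snd y))))) \<partial>bidisc_measure (s - 2)) =
        (\<integral>\<^sup>+y. 1 \<partial>disc_measure 0) * (\<integral>\<^sup>+\<zeta>. ennreal (cmod (complex_of_real (\<phi> (cmod \<zeta>)))) \<partial>disc_measure (s - 2))"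
      using nn_integral_bidisc_measure_times[of "\<lambda>_. 1" "\<lambda>\<zeta>. ennreal (cmod (complex_of_real (\<phi> (cmod \<zeta>))))" "s - 2"] by simp
    also have "\<dots> < \<infinity>" using int by (simp add: emeasure_disc_measure_0 ennreal_mult_less_top integrable_iff_bounded)
    finally show "(\<integral>\<^sup>+y. ennreal (cmod (complex_of_real (\<phi> (cmod (snd y))))) \<partial>bidisc_measure (s - 2)) < \<infinity>" .
  qed measurable
  from integrable_bidisc_kernel[OF s x this]
  have int2: "integrable (disc_measure 0 \<Otimes>\<^sub>M disc_measure (s - 2))
      (case_prod (\<lambda>\<eta> \<zeta>. bidisc_kernel s x (\<eta>, \<zeta>) * complex_of_real (\<phi> (cmod \<zeta>))))"
    by (simp add: bidisc_measure_def case_prod_beta')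
  have "integrable (disc_measure (2 - 2)) (\<lambda>_. 1 :: complex)"
    using finite_measure.integrable_const[OF finite_measure_disc_measure[of 0]] by simp
  from disc_kernel_reproducing(2)[OF _ _ wz(1) _ this]
  have one: "(\<integral>\<eta>. disc_kernel 2 (w * cnj \<eta>) \<partial>disc_measure 0) = pi" by simp
  have inner: "(\<integral>\<eta>. bidisc_kernel s x (\<eta>, \<zeta>) * complex_of_real (\<phi> (cmod \<zeta>)) \<partial>disc_measure 0) =
      disc_kernel s (z * cnj \<zeta>) * complex_of_real (\<phi> (cmod \<zeta>)) / pi" for \<zeta>
  proof -
    have "(\<integral>\<eta>. bidisc_kernel s x (\<eta>, \<zeta>) * complex_of_real (\<phi> (cmod \<zeta>)) \<partial>disc_measure 0) =
        (\<integral>\<eta>. (disc_kernel s (z * cnj \<zeta>) * complex_of_real (\<phi> (cmod \<zeta>)) / pi\<^sup>2) * disc_kernel 2 (w * cnj \<eta>) \<partial>disc_measure 0)"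
      by (simp add: bidisc_kernel_def mult_ac flip: w_def z_def)
    also have "\<dots> = (disc_kernel s (z * cnj \<zeta>) * complex_of_real (\<phi> (cmod \<zeta>)) / pi\<^sup>2) * pi"
      by (simp only: integral_mult_right_zero one)
    finally show ?thesis by (simp add: power2_eq_square)
  qed
  define h where "h = (\<lambda>\<zeta>. disc_kernel s (z * cnj \<zeta>) * complex_of_real (\<phi> (cmod \<zeta>)))"
  have "integrable (disc_measure (s - 2)) (\<lambda>\<zeta>. h \<zeta> / pi)"
    using P.integrable_snd[OF int2] unfolding inner h_def .
  from integrable_mult_right[OF this, of "complex_of_real pi"]
  have ih: "integrable (disc_measure (s - 2)) h" by simp
  have "bidisc_projection s (\<lambda>y. complex_of_real (\<phi> (cmod (snd y)))) x =
      (\<integral>\<zeta>. (\<integral>\<eta>. bidisc_kernel s x (\<eta>, \<zeta>) * complex_of_real (\<phi> (cmod \<zeta>)) \<partial>disc_measure 0) \<partial>disc_measure (s - 2))"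
    unfolding P.integral_snd[OF int2] by (simp add: bidisc_projection_def bidisc_measure_def case_prod_beta')
  also have "\<dots> = (\<integral>\<zeta>. h \<zeta> \<partial>disc_measure (s - 2)) / pi" unfolding inner h_def by simp
  also have "(\<integral>\<zeta>. h \<zeta> \<partial>disc_measure (s - 2)) =
      (\<integral>\<zeta>. (\<integral>\<theta>. h (unit_cis \<theta> * \<zeta>) \<partial>unit_lborel) \<partial>disc_measure (s - 2))"
    by (rule integral_disc_measure_average(2)[OF ih])
  also have "\<dots> = (\<integral>\<zeta>. of_real (s / 2) * complex_of_real (\<phi> (cmod \<zeta>)) \<partial>disc_measure (s - 2))"
  proof (rule integral_cong_AE)
    show "AE \<zeta> in disc_measure (s - 2). (\<integral>\<theta>. h (unit_cis \<theta> * \<zeta>) \<partial>unit_lborel) = of_real (s / 2) * complex_of_real (\<phi> (cmod \<zeta>))"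
      using AE_disc_measure
    proof eventually_elim
      case (elim \<zeta>)
      have "(\<integral>\<theta>. h (unit_cis \<theta> * \<zeta>) \<partial>unit_lborel) =
          (\<integral>\<theta>. complex_of_real (\<phi> (cmod \<zeta>)) * (disc_kernel s (z * cnj (unit_cis \<theta> * \<zeta>)) * 1) \<partial>unit_lborel)"
        unfolding h_def by (intro Bochner_Integration.integral_cong refl) (simp add: norm_mult mult_ac)
      also have "\<dots> = complex_of_real (\<phi> (cmod \<zeta>)) * of_real (s / 2)"
        using disc_kernel_circle_mean[OF wz(2), of \<zeta> "\<lambda>_. 1" s] elim
        by (simp only: integral_mult_right_zero) simp
      finally show ?case by (simp add: mult.commute)
    qed
    show "(\<lambda>\<zeta>. \<integral>\<theta>. h (unit_cis \<theta> * \<zeta>) \<partial>unit_lborel) \<in> borel_measurable (disc_measure (s - 2))"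
      using integral_disc_measure_average(1)[OF ih] by (rule borel_measurable_integrable)
  qed measurable
  also have "\<dots> = of_real (s / 2) * (\<integral>\<zeta>. complex_of_real (\<phi> (cmod \<zeta>)) \<partial>disc_measure (s - 2))"
    by (rule integral_mult_right_zero)
  finally show ?thesis by simp
qed

section \<open>Transfer to the Hartogs triangle\<close>

definition vec2 :: "complex \<Rightarrow> complex \<Rightarrow> complex ^ 2" where
  "vec2 a b = (\<chi> i. if i = 1 then a else b)"

lemma vec2_nth [simp]: "vec2 a b $ 1 = a" "vec2 a b $ 2 = b"
  by (simp_all add: vec2_def)

lemma vec2_eqI: "u $ 1 = a \<Longrightarrow> u $ 2 = b \<Longrightarrow> vec2 a b = u"
  by (simp add: vec_eq_iff forall_2)

lemma measurable_vec2 [measurable]: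
  assumes [measurable]: "f \<in> borel_measurable M" "g \<in> borel_measurable M"
  shows "(\<lambda>x. vec2 (f x) (g x)) \<in> borel_measurable M"
proof -
  have "continuous_on UNIV (\<lambda>x :: complex \<times> complex. vec2 (fst x) (snd x))"
    unfolding vec2_def
  proof (rule continuous_on_vec_lambda)
    fix i :: 2
    show "continuous_on UNIV (\<lambda>x :: complex \<times> complex. if i = 1 then fst x else snd x)"
      by (cases "i = 1") (simp_all add: continuous_on_fst continuous_on_snd continuous_on_id)
  qed
  then have "(\<lambda>x :: complex \<times> complex. vec2 (fst x) (snd x)) \<in> borel_measurable (borel \<Otimes>\<^sub>M borel)"
    by (simp add: borel_prod borel_measurable_continuous_onI)
  from measurable_compose[OF measurable_Pair[OF assms] this] show ?thesis by simp
qed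

lemma measurable_vec_nth [measurable]: "(\<lambda>x :: complex ^ 2. x $ i) \<in> borel_measurable borel"
  by (intro borel_measurable_continuous_onI continuous_intros)

lemma lborel_complex_vec2:
  "(lborel :: (complex ^ 2) measure) = distr (lborel \<Otimes>\<^sub>M lborel) borel (\<lambda>x. vec2 (fst x) (snd x))"
proof (rule lborel_eqI)
  fix l u :: "complex ^ 2"
  assume le: "\<And>b. b \<in> Basis \<Longrightarrow> l \<bullet> b \<le> u \<bullet> b"
  have ax: "axis i b \<in> Basis" if "b \<in> Basis" for i :: 2 and b :: complex
    using that by (auto simp: Basis_vec_def)
  have le1: "l $ i \<bullet> b \<le> u $ i \<bullet> b" if "b \<in> Basis" for i b
    using le[OF ax[OF that, of i]] by (simp add: inner_axis)
  have box: "vec2 a b \<in> box l u \<longleftrightarrow> a \<in> box (l $ 1) (u $ 1) \<and> b \<in> box (l $ 2) (u $ 2)" for a b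
    by (auto simp: mem_box Basis_vec_def inner_axis forall_2)
  have "emeasure (distr (lborel \<Otimes>\<^sub>M lborel) borel (\<lambda>x. vec2 (fst x) (snd x))) (box l u)
      = emeasure (lborel \<Otimes>\<^sub>M lborel) (box (l $ 1) (u $ 1) \<times> box (l $ 2) (u $ 2))"
    by (subst emeasure_distr) (auto simp: space_pair_measure box intro!: arg_cong2[where f=emeasure])
  also have "\<dots> = emeasure lborel (box (l $ 1) (u $ 1)) * emeasure lborel (box (l $ 2) (u $ 2))"
    by (intro lborel.emeasure_pair_measure_Times) auto
  also have "\<dots> = ennreal ((\<Prod>b\<in>Basis. (u $ 1 - l $ 1) \<bullet> b) * (\<Prod>b\<in>Basis. (u $ 2 - l $ 2) \<bullet> b))"
    using le1 by (subst (1 2) emeasure_lborel_box)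
      (auto simp: inner_diff_left intro!: ennreal_mult[symmetric] prod_nonneg)
  also have "(\<Prod>b\<in>Basis. (u $ 1 - l $ 1) \<bullet> b) * (\<Prod>b\<in>Basis. (u $ 2 - l $ 2) \<bullet> b) = (\<Prod>b\<in>Basis. (u - l) \<bullet> b)"
  proof -
    have inj: "inj_on (axis i) (Basis :: complex set)" for i :: 2
      by (auto simp: inj_on_def axis_eq_axis)
    have B: "(Basis :: (complex ^ 2) set) = axis 1 ` Basis \<union> axis 2 ` Basis"
      unfolding Basis_vec_def by (auto simp: UNIV_2)
    have "axis 1 ` Basis \<inter> axis 2 ` Basis = ({} :: (complex ^ 2) set)"
      by (auto simp: axis_eq_axis)
    then show ?thesis
      unfolding B by (subst prod.union_disjoint) (auto simp: prod.reindex[OF inj] inner_axis o_def)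
  qed
  finally show "emeasure (distr (lborel \<Otimes>\<^sub>M lborel) borel (\<lambda>x. vec2 (fst x) (snd x))) (box l u)
    = (\<Prod>b\<in>Basis. (u - l) \<bullet> b)" .
qed simp

definition hartogs_map :: "complex \<times> complex \<Rightarrow> complex ^ 2" where
  "hartogs_map x = vec2 (fst x * snd x) (snd x)"

definition hartogs_inv :: "complex ^ 2 \<Rightarrow> complex \<times> complex" where
  "hartogs_inv u = (u $ 1 / u $ 2, u $ 2)"

lemma measurable_hartogs_map [measurable]: "hartogs_map \<in> borel \<Otimes>\<^sub>M borel \<rightarrow>\<^sub>M borel"
  unfolding hartogs_map_def by measurable

lemma measurable_hartogs_inv [measurable]: "hartogs_inv \<in> borel \<rightarrow>\<^sub>M borel \<Otimes>\<^sub>M borel"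
  unfolding hartogs_inv_def by measurable

lemma hartogs_inv_map: "snd x \<noteq> 0 \<Longrightarrow> hartogs_inv (hartogs_map x) = x"
  by (simp add: hartogs_inv_def hartogs_map_def)

lemma hartogs_map_nth [simp]: "hartogs_map x $ 1 = fst x * snd x" "hartogs_map x $ 2 = snd x"
  by (simp_all add: hartogs_map_def)

lemma hartogs_map_mem_iff:
  assumes "snd x \<noteq> 0"
  shows "hartogs_map x \<in> hartogs_triangle \<longleftrightarrow> fst x \<in> ball 0 1 \<and> snd x \<in> ball 0 1"
  using assms by (simp add: hartogs_triangle_def norm_mult)

lemma hartogs_triangleD:
  assumes "u \<in> hartogs_triangle"
  shows "u $ 2 \<noteq> 0" "hartogs_inv u \<in> ball 0 1 \<times> (ball 0 1 - {0})" "hartogs_map (hartogs_inv u) = u"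
proof -
  show 2: "u $ 2 \<noteq> 0" using assms by (auto simp: hartogs_triangle_def)
  show "hartogs_inv u \<in> ball 0 1 \<times> (ball 0 1 - {0})"
    using assms 2 by (auto simp: hartogs_triangle_def hartogs_inv_def norm_divide)
  show "hartogs_map (hartogs_inv u) = u"
    unfolding hartogs_map_def hartogs_inv_def using 2 by (intro vec2_eqI) auto
qed

lemma open_hartogs_triangle: "open hartogs_triangle"
  unfolding hartogs_triangle_def by (intro open_Collect_conj open_Collect_less continuous_intros)

lemma sets_hartogs_triangle [measurable]: "hartogs_triangle \<in> sets borel"
  using open_hartogs_triangle by simp

lemma hartogs_triangle_lebesgue [simp]: "hartogs_triangle \<inter> space lebesgue \<in> sets lebesgue"
  using sets_hartogs_triangle by auto

text \<open>For a fixed second coordinate \<open>b\<close>, the substitution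
  \<open>a = b * w\<close> has Jacobian \<open>|b|\<^sup>2\<close> and turns the slice of the
  triangle into the unit disc. This Jacobian is the exponent 2 on the right.\<close>

lemma nn_integral_hartogs:
  assumes [measurable]: "g \<in> borel_measurable borel"
  shows "(\<integral>\<^sup>+u. g u \<partial>lebesgue_on hartogs_triangle) = (\<integral>\<^sup>+x. g (hartogs_map x) \<partial>bidisc_measure 2)"
proof -
  interpret P: pair_sigma_finite "disc_measure 0" "disc_measure 2" by (rule pair_sigma_finite_disc)
  have "(\<integral>\<^sup>+u. g u \<partial>lebesgue_on hartogs_triangle) = (\<integral>\<^sup>+u. g u * indicator hartogs_triangle u \<partial>lborel)"
    by (subst nn_integral_restrict_space) (auto simp: nn_integral_completion)
  also have "\<dots> = (\<integral>\<^sup>+x. g (vec2 (fst x) (snd x)) * indicator hartogs_triangle (vec2 (fst x) (snd x)) \<partial>(lborel \<Otimes>\<^sub>M lborel))"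
    by (subst lborel_complex_vec2, subst nn_integral_distr) auto
  also have "\<dots> = (\<integral>\<^sup>+b. \<integral>\<^sup>+a. g (vec2 a b) * indicator hartogs_triangle (vec2 a b) \<partial>lborel \<partial>lborel)"
    by (subst lborel_pair.nn_integral_snd[symmetric]) auto
  also have "\<dots> = (\<integral>\<^sup>+b. ennreal (indicator (ball 0 1) b * cmod b powr 2) *
      (\<integral>\<^sup>+w. g (hartogs_map (w, b)) \<partial>disc_measure 0) \<partial>lborel)"
  proof (rule nn_integral_cong_AE)
    have "AE b in lborel. b \<noteq> (0::complex)" by (rule AE_lborel_singleton)
    then show "AE b in lborel. (\<integral>\<^sup>+a. g (vec2 a b) * indicator hartogs_triangle (vec2 a b) \<partial>lborel) =
        ennreal (indicator (ball 0 1) b * cmod b powr 2) * (\<integral>\<^sup>+w. g (hartogs_map (w, b)) \<partial>disc_measure 0)"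
    proof eventually_elim
      case (elim b)
      have "(\<integral>\<^sup>+a. g (vec2 a b) * indicator hartogs_triangle (vec2 a b) \<partial>lborel) =
          ennreal ((cmod b)\<^sup>2) * (\<integral>\<^sup>+w. g (vec2 (b * w) b) * indicator hartogs_triangle (vec2 (b * w) b) \<partial>lborel)"
        by (rule nn_integral_lborel_complex_mult[symmetric]) (use elim in auto)
      also have "(\<integral>\<^sup>+w. g (vec2 (b * w) b) * indicator hartogs_triangle (vec2 (b * w) b) \<partial>lborel) =
          (\<integral>\<^sup>+w. indicator (ball 0 1) b * (indicator (ball 0 1) w * g (hartogs_map (w, b))) \<partial>lborel)"
        using hartogs_map_mem_iff[of "(_, b)"] elim
        by (intro nn_integral_cong) (auto simp: hartogs_map_def mult.commute[of b] split: split_indicator)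
      also have "\<dots> = indicator (ball 0 1) b * (\<integral>\<^sup>+w. g (hartogs_map (w, b)) \<partial>disc_measure 0)"
        by (subst nn_integral_disc_measure_0, measurable) (rule nn_integral_cmult, measurable)
      finally show ?case by (simp add: mult.assoc split: split_indicator)
    qed
  qed
  also have "\<dots> = (\<integral>\<^sup>+b. (\<integral>\<^sup>+w. g (hartogs_map (w, b)) \<partial>disc_measure 0) \<partial>disc_measure 2)"
    by (rule nn_integral_disc_measure[symmetric]) measurable
  also have "\<dots> = (\<integral>\<^sup>+x. g (hartogs_map x) \<partial>bidisc_measure 2)"
    unfolding bidisc_measure_def by (rule P.nn_integral_snd) measurable
  finally show ?thesis .
qed

lemma measurable_lebesgue_on_borel [measurable (raw)]:
  "f \<in> borel \<rightarrow>\<^sub>M N \<Longrightarrow> f \<in> lebesgue_on S \<rightarrow>\<^sub>M N" for f :: "complex ^ 2 \<Rightarrow> 'b"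
  by (intro measurable_restrict_space1 measurable_completion) simp

text \<open>The change of variables as an equality of image measures, so that complex-valued
  integrals are transported as well.\<close>

lemma distr_hartogs:
  "distr (lebesgue_on hartogs_triangle) borel (\<lambda>u. u) = distr (bidisc_measure 2) borel hartogs_map"
proof (rule measure_eqI)
  have m: "(\<lambda>u. u) \<in> lebesgue_on hartogs_triangle \<rightarrow>\<^sub>M borel" by (rule measurable_lebesgue_on_borel) simp
  fix A :: "(complex ^ 2) set" assume "A \<in> sets (distr (lebesgue_on hartogs_triangle) borel (\<lambda>u. u))"
  then have [measurable]: "A \<in> sets borel" by simp
  have "emeasure (distr (lebesgue_on hartogs_triangle) borel (\<lambda>u. u)) A = (\<integral>\<^sup>+u. indicator A u \<partial>lebesgue_on hartogs_triangle)"
    by (subst nn_integral_indicator[symmetric], simp, subst nn_integral_distr[OF m]) auto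
  also have "\<dots> = (\<integral>\<^sup>+x. indicator A (hartogs_map x) \<partial>bidisc_measure 2)"
    by (rule nn_integral_hartogs) measurable
  also have "\<dots> = emeasure (distr (bidisc_measure 2) borel hartogs_map) A"
    by (subst nn_integral_indicator[symmetric], simp, subst nn_integral_distr) auto
  finally show "emeasure (distr (lebesgue_on hartogs_triangle) borel (\<lambda>u. u)) A = emeasure (distr (bidisc_measure 2) borel hartogs_map) A" .
qed simp

lemma nn_integral_hartogs_weight:
  assumes [measurable]: "g \<in> borel_measurable borel"
  shows "(\<integral>\<^sup>+u. ennreal (power_weight r u) * g u \<partial>lebesgue_on hartogs_triangle) =
    (\<integral>\<^sup>+x. g (hartogs_map x) \<partial>bidisc_measure (r + 2))"
proof -
  have "(\<integral>\<^sup>+u. ennreal (power_weight r u) * g u \<partial>lebesgue_on hartogs_triangle) =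
      (\<integral>\<^sup>+x. ennreal (cmod (snd x) powr r) * g (hartogs_map x) \<partial>bidisc_measure 2)"
    unfolding power_weight_def by (subst nn_integral_hartogs) auto
  also have "\<dots> = (\<integral>\<^sup>+x. g (hartogs_map x) \<partial>bidisc_measure (2 + r))"
    by (rule nn_integral_bidisc_measure_add[symmetric]) measurable
  finally show ?thesis by (simp add: add.commute)
qed

lemma integral_hartogs_weight:
  fixes g :: "complex ^ 2 \<Rightarrow> complex"
  assumes [measurable]: "g \<in> borel_measurable borel"
  shows "(\<integral>u. g u * complex_of_real (power_weight r u) \<partial>lebesgue_on hartogs_triangle) =
    (\<integral>x. g (hartogs_map x) \<partial>bidisc_measure (r + 2))"
proof -
  have m: "(\<lambda>u. u) \<in> lebesgue_on hartogs_triangle \<rightarrow>\<^sub>M borel" by (rule measurable_lebesgue_on_borel) simp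
  have [measurable]: "power_weight r \<in> borel_measurable borel" unfolding power_weight_def by measurable
  have "(\<integral>u. g u * complex_of_real (power_weight r u) \<partial>lebesgue_on hartogs_triangle) =
      (\<integral>u. g u * complex_of_real (power_weight r u) \<partial>distr (lebesgue_on hartogs_triangle) borel (\<lambda>u. u))"
    by (subst integral_distr[OF m]) auto
  also have "\<dots> = (\<integral>x. g (hartogs_map x) * complex_of_real (power_weight r (hartogs_map x)) \<partial>bidisc_measure 2)"
    unfolding distr_hartogs by (subst integral_distr) auto
  also have "\<dots> = (\<integral>x. (cmod (snd x) powr r) *\<^sub>R g (hartogs_map x) \<partial>bidisc_measure 2)"
    by (simp add: power_weight_def scaleR_conv_of_real mult.commute)
  also have "\<dots> = (\<integral>x. g (hartogs_map x) \<partial>density (bidisc_measure 2) (\<lambda>x. ennreal (cmod (snd x) powr r)))"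
    by (rule integral_density[symmetric]) auto
  also have "\<dots> = (\<integral>x. g (hartogs_map x) \<partial>bidisc_measure (r + 2))"
    by (simp add: density_bidisc_measure add.commute)
  finally show ?thesis .
qed

section \<open>Borel representatives and norms\<close>

text \<open>Elements of \<open>Lp_space\<close> are only Lebesgue measurable, whereas the change of
  variables and the product measures are Borel. Real and imaginary parts of the extension by 0 are
  replaced separately.\<close>

lemma borel_representative:
  fixes f :: "complex ^ 2 \<Rightarrow> complex"
  assumes f: "f \<in> borel_measurable (lebesgue_on hartogs_triangle)"
  obtains f0 where "f0 \<in> borel_measurable borel" "AE u in lebesgue_on hartogs_triangle. f u = f0 u"
proof -
  have m: "(\<lambda>u. indicator hartogs_triangle u *\<^sub>R f u) \<in> borel_measurable lebesgue"
    using f by (subst (asm) borel_measurable_restrict_space_iff) auto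
  have "Re \<in> borel_measurable borel" "Im \<in> borel_measurable borel" by measurable
  then have Re: "(\<lambda>u. Re (indicator hartogs_triangle u *\<^sub>R f u)) \<in> borel_measurable (completion lborel)"
    and Im: "(\<lambda>u. Im (indicator hartogs_triangle u *\<^sub>R f u)) \<in> borel_measurable (completion lborel)"
    using measurable_compose[OF m] by blast+
  obtain a where a: "a \<in> borel_measurable lborel" "AE u in lborel. Re (indicator hartogs_triangle u *\<^sub>R f u) = a u"
    using completion_ex_borel_measurable_real[OF Re] by blast
  obtain b where b: "b \<in> borel_measurable lborel" "AE u in lborel. Im (indicator hartogs_triangle u *\<^sub>R f u) = b u"
    using completion_ex_borel_measurable_real[OF Im] by blast
  have [measurable]: "a \<in> borel_measurable borel" "b \<in> borel_measurable borel" using a(1) b(1) by auto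
  have "AE u in lebesgue. u \<in> hartogs_triangle \<longrightarrow> f u = complex_of_real (a u) + \<i> * complex_of_real (b u)"
    using AE_completion[OF a(2)] AE_completion[OF b(2)]
    by eventually_elim (auto simp: complex_eq_iff)
  then have "AE u in lebesgue_on hartogs_triangle. f u = complex_of_real (a u) + \<i> * complex_of_real (b u)"
    by (subst AE_restrict_space_iff) auto
  then show ?thesis by (rule that[rotated]) measurable
qed

text \<open>Everything is reduced to one nonnegative integral: its finiteness is membership, and
  \<open>enn2real\<close> reproduces the default 0 of the Bochner integral in the norm when it is
  infinite.\<close>

lemma Lp_hartogs:
  assumes f: "f \<in> borel_measurable (lebesgue_on hartogs_triangle)"
    and [measurable]: "f0 \<in> borel_measurable borel"
    and eq: "AE u in lebesgue_on hartogs_triangle. f u = f0 u"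
  shows "f \<in> Lp_space p hartogs_triangle (power_weight r) \<longleftrightarrow>
      (\<integral>\<^sup>+x. ennreal (cmod (f0 (hartogs_map x)) powr p) \<partial>bidisc_measure (r + 2)) < \<infinity>"
    and "Lp_norm p hartogs_triangle (power_weight r) f =
      enn2real (\<integral>\<^sup>+x. ennreal (cmod (f0 (hartogs_map x)) powr p) \<partial>bidisc_measure (r + 2)) powr (1 / p)"
proof -
  let ?H = "lebesgue_on hartogs_triangle"
  have [measurable]: "power_weight r \<in> borel_measurable borel" unfolding power_weight_def by measurable
  have w: "power_weight r \<in> borel_measurable ?H" by measurable
  have m: "(\<lambda>u. cmod (f u) powr p * power_weight r u) \<in> borel_measurable ?H"
    using f w by measurable
  have nn: "0 \<le> power_weight r u" for u by (simp add: power_weight_def)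
  have "(\<integral>\<^sup>+u. ennreal (cmod (f u) powr p * power_weight r u) \<partial>?H) =
      (\<integral>\<^sup>+u. ennreal (power_weight r u) * ennreal (cmod (f0 u) powr p) \<partial>?H)"
  proof (rule nn_integral_cong_AE)
    show "AE u in ?H. ennreal (cmod (f u) powr p * power_weight r u) = ennreal (power_weight r u) * ennreal (cmod (f0 u) powr p)"
      using eq by eventually_elim (simp add: nn mult.commute flip: ennreal_mult')
  qed
  also have "\<dots> = (\<integral>\<^sup>+x. ennreal (cmod (f0 (hartogs_map x)) powr p) \<partial>bidisc_measure (r + 2))"
    by (rule nn_integral_hartogs_weight) measurable
  finally have I: "(\<integral>\<^sup>+u. ennreal (cmod (f u) powr p * power_weight r u) \<partial>?H) =
      (\<integral>\<^sup>+x. ennreal (cmod (f0 (hartogs_map x)) powr p) \<partial>bidisc_measure (r + 2))" .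
  show "f \<in> Lp_space p hartogs_triangle (power_weight r) \<longleftrightarrow>
      (\<integral>\<^sup>+x. ennreal (cmod (f0 (hartogs_map x)) powr p) \<partial>bidisc_measure (r + 2)) < \<infinity>"
    using f m nn unfolding Lp_space_def by (simp add: integrable_iff_bounded I[symmetric] abs_mult)
  show "Lp_norm p hartogs_triangle (power_weight r) f =
      enn2real (\<integral>\<^sup>+x. ennreal (cmod (f0 (hartogs_map x)) powr p) \<partial>bidisc_measure (r + 2)) powr (1 / p)"
    unfolding Lp_norm_def I[symmetric] using m nn by (subst integral_eq_nn_integral) auto
qed

section \<open>Uniqueness of the Bergman projection\<close>

lemma holomorphic_several_on_imp_continuous_on:
  "holomorphic_several_on f \<Omega> \<Longrightarrow> continuous_on \<Omega> f"
  unfolding holomorphic_several_on_def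
  by (meson continuous_at_imp_continuous_on has_derivative_continuous)

text \<open>Complex homogeneity of the Frechet derivative is what makes the restriction to a complex
  line complex differentiable, with derivative \<open>D a\<close>.\<close>

lemma holomorphic_several_on_line:
  assumes h: "holomorphic_several_on h \<Omega>" and sub: "\<And>\<zeta>. \<zeta> \<in> S \<Longrightarrow> \<zeta> *s a + b \<in> \<Omega>"
  shows "(\<lambda>\<zeta>. h (\<zeta> *s a + b)) holomorphic_on S"
  unfolding holomorphic_on_def
proof
  fix \<zeta> assume "\<zeta> \<in> S"
  then obtain D where D: "(h has_derivative D) (at (\<zeta> *s a + b))" "\<And>c v. D (c *s v) = c * D v"
    using h sub unfolding holomorphic_several_on_def by blast
  have "linear (\<lambda>\<zeta> :: complex. \<zeta> *s a)"
    by (rule linearI) (simp_all add: vec_eq_iff distrib_right)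
  then have "((\<lambda>\<zeta>. \<zeta> *s a) has_derivative (\<lambda>v. v *s a)) (at \<zeta>)"
    by (intro bounded_linear_imp_has_derivative linear_conv_bounded_linear[THEN iffD1])
  then have "((\<lambda>\<zeta>. \<zeta> *s a + b) has_derivative (\<lambda>v. v *s a)) (at \<zeta>)"
    by (auto intro!: derivative_eq_intros)
  from has_derivative_compose[OF this D(1)]
  have "((\<lambda>\<zeta>. h (\<zeta> *s a + b)) has_derivative (\<lambda>v. D a * v)) (at \<zeta>)"
    by (simp add: D(2) mult.commute)
  then have "((\<lambda>\<zeta>. h (\<zeta> *s a + b)) has_field_derivative D a) (at \<zeta>)"
    by (simp add: has_field_derivative_def)
  then show "(\<lambda>\<zeta>. h (\<zeta> *s a + b)) field_differentiable at \<zeta> within S"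
    using field_differentiable_at_within field_differentiable_def by blast
qed

lemma integrable_L2_weight:
  assumes f: "f \<in> Lp_space 2 \<Omega> \<mu>" and g: "g \<in> Lp_space 2 \<Omega> \<mu>"
    and \<mu> [measurable]: "\<mu> \<in> borel_measurable (lebesgue_on \<Omega>)" and nn: "\<And>z. 0 \<le> \<mu> z"
  shows "integrable (lebesgue_on \<Omega>) (\<lambda>z. f z * cnj (g z) * complex_of_real (\<mu> z))"
proof -
  have [measurable]: "f \<in> borel_measurable (lebesgue_on \<Omega>)" "g \<in> borel_measurable (lebesgue_on \<Omega>)"
    using f g by (auto simp: Lp_space_def)
  have fin: "(\<integral>\<^sup>+z. ennreal (cmod (h z * complex_of_real (sqrt (\<mu> z))) powr 2) \<partial>lebesgue_on \<Omega>) < \<infinity>"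
    if "integrable (lebesgue_on \<Omega>) (\<lambda>z. cmod (h z) powr 2 * \<mu> z)" for h
    using that nn by (simp add: integrable_iff_bounded norm_mult power_mult_distrib abs_mult)
  have "integrable (lebesgue_on \<Omega>) (\<lambda>z. (f z * complex_of_real (sqrt (\<mu> z))) * (cnj (g z) * complex_of_real (sqrt (\<mu> z))))"
    using f g fin[of f] fin[of "\<lambda>z. cnj (g z)"] by (intro integrable_mult_L2) (auto simp: Lp_space_def)
  moreover have "(f z * complex_of_real (sqrt (\<mu> z))) * (cnj (g z) * complex_of_real (sqrt (\<mu> z))) =
      f z * cnj (g z) * complex_of_real (\<mu> z)" for z
    using nn[of z] by (simp add: mult_ac flip: of_real_mult)
  ultimately show ?thesis by simp
qed

lemma Lp_space_2_diff:
  assumes f: "f \<in> Lp_space 2 \<Omega> \<mu>" and g: "g \<in> Lp_space 2 \<Omega> \<mu>"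
    and \<mu> [measurable]: "\<mu> \<in> borel_measurable (lebesgue_on \<Omega>)" and nn: "\<And>z. 0 \<le> \<mu> z"
  shows "(\<lambda>z. f z - g z) \<in> Lp_space 2 \<Omega> \<mu>"
proof -
  have [measurable]: "f \<in> borel_measurable (lebesgue_on \<Omega>)" "g \<in> borel_measurable (lebesgue_on \<Omega>)"
    and int: "integrable (lebesgue_on \<Omega>) (\<lambda>z. 2 * (cmod (f z) powr 2 * \<mu> z) + 2 * (cmod (g z) powr 2 * \<mu> z))"
    using f g by (auto simp: Lp_space_def)
  have "integrable (lebesgue_on \<Omega>) (\<lambda>z. cmod (f z - g z) powr 2 * \<mu> z)"
  proof (rule Bochner_Integration.integrable_bound[OF int])
    have "cmod (f z - g z) powr 2 * \<mu> z \<le> 2 * (cmod (f z) powr 2 * \<mu> z) + 2 * (cmod (g z) powr 2 * \<mu> z)" for z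
    proof -
      have "(cmod (f z - g z))\<^sup>2 \<le> (cmod (f z) + cmod (g z))\<^sup>2"
        by (intro power_mono norm_triangle_ineq4) simp
      also have "\<dots> \<le> 2 * (cmod (f z))\<^sup>2 + 2 * (cmod (g z))\<^sup>2"
        using sum_squares_bound[of "cmod (f z)" "cmod (g z)"] by (simp add: power2_sum)
      finally have "(cmod (f z - g z))\<^sup>2 * \<mu> z \<le> (2 * (cmod (f z))\<^sup>2 + 2 * (cmod (g z))\<^sup>2) * \<mu> z"
        by (intro mult_right_mono nn)
      then show ?thesis by (simp add: distrib_right mult.assoc)
    qed
    then show "AE z in lebesgue_on \<Omega>. norm (cmod (f z - g z) powr 2 * \<mu> z)
        \<le> norm (2 * (cmod (f z) powr 2 * \<mu> z) + 2 * (cmod (g z) powr 2 * \<mu> z))"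
      using nn by (intro AE_I2) (simp add: abs_mult)
  qed measurable
  then show ?thesis by (simp add: Lp_space_def)
qed

lemma holomorphic_several_on_diff:
  assumes "holomorphic_several_on f \<Omega>" "holomorphic_several_on g \<Omega>"
  shows "holomorphic_several_on (\<lambda>z. f z - g z) \<Omega>"
  unfolding holomorphic_several_on_def
proof
  fix z assume "z \<in> \<Omega>"
  then obtain D E where "(f has_derivative D) (at z)" "\<And>c v. D (c *s v) = c * D v"
    "(g has_derivative E) (at z)" "\<And>c v. E (c *s v) = c * E v"
    using assms unfolding holomorphic_several_on_def by metis
  then show "\<exists>D. ((\<lambda>z. f z - g z) has_derivative D) (at z) \<and> (\<forall>c v. D (c *s v) = c * D v)"
    by (intro exI[of _ "\<lambda>v. D v - E v"]) (auto intro: has_derivative_diff simp: right_diff_distrib)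
qed

text \<open>The candidate \<open>g\<close> shows that the choice operator has something to choose.
  The difference \<open>h\<close> between the chosen element and \<open>g\<close> lies in the
  Bergman space and is orthogonal to itself, so the integral of \<open>|h|\<^sup>2 * \<mu>\<close>
  vanishes.\<close>

lemma bergman_projection_AE_eq:
  assumes \<mu> [measurable]: "\<mu> \<in> borel_measurable (lebesgue_on \<Omega>)" and nn: "\<And>z. 0 \<le> \<mu> z"
    and pos: "\<And>z. z \<in> \<Omega> \<Longrightarrow> 0 < \<mu> z" and f: "f \<in> Lp_space 2 \<Omega> \<mu>"
    and g: "g \<in> bergman_space \<Omega> \<mu>"
    and orth: "\<And>h. h \<in> bergman_space \<Omega> \<mu> \<Longrightarrow> L2_inner \<Omega> \<mu> (\<lambda>z. f z - g z) h = 0"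
  shows "bergman_projection \<Omega> \<mu> f \<in> bergman_space \<Omega> \<mu>"
    and "AE z in lebesgue_on \<Omega>. bergman_projection \<Omega> \<mu> f z = g z"
proof -
  define b where "b = bergman_projection \<Omega> \<mu> f"
  have "\<exists>g. g \<in> bergman_space \<Omega> \<mu> \<and> (\<forall>h\<in>bergman_space \<Omega> \<mu>. L2_inner \<Omega> \<mu> (\<lambda>z. f z - g z) h = 0)"
    using g orth by blast
  from someI_ex[OF this]
  have b: "b \<in> bergman_space \<Omega> \<mu>" and orthb: "\<And>h. h \<in> bergman_space \<Omega> \<mu> \<Longrightarrow> L2_inner \<Omega> \<mu> (\<lambda>z. f z - b z) h = 0"
    unfolding b_def bergman_projection_def by blast+
  show "bergman_projection \<Omega> \<mu> f \<in> bergman_space \<Omega> \<mu>" using b by (simp add: b_def)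
  define h where "h = (\<lambda>z. b z - g z)"
  have L: "b \<in> Lp_space 2 \<Omega> \<mu>" "g \<in> Lp_space 2 \<Omega> \<mu>" using b g by (auto simp: bergman_space_def)
  have hL: "h \<in> Lp_space 2 \<Omega> \<mu>" unfolding h_def by (rule Lp_space_2_diff[OF L \<mu> nn])
  have "holomorphic_several_on h \<Omega>"
    unfolding h_def using b g by (intro holomorphic_several_on_diff) (auto simp: bergman_space_def)
  with hL have h: "h \<in> bergman_space \<Omega> \<mu>" by (simp add: bergman_space_def)
  have i1: "integrable (lebesgue_on \<Omega>) (\<lambda>z. (f z - g z) * cnj (h z) * complex_of_real (\<mu> z))"
    by (intro integrable_L2_weight Lp_space_2_diff f L hL \<mu> nn)
  have i2: "integrable (lebesgue_on \<Omega>) (\<lambda>z. (f z - b z) * cnj (h z) * complex_of_real (\<mu> z))"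
    by (intro integrable_L2_weight Lp_space_2_diff f L hL \<mu> nn)
  have eq: "(f z - g z) * cnj (h z) * complex_of_real (\<mu> z) - (f z - b z) * cnj (h z) * complex_of_real (\<mu> z) =
      complex_of_real (cmod (h z) powr 2 * \<mu> z)" for z
  proof -
    have "(f z - g z) * cnj (h z) * complex_of_real (\<mu> z) - (f z - b z) * cnj (h z) * complex_of_real (\<mu> z) =
        (h z * cnj (h z)) * complex_of_real (\<mu> z)" by (simp add: h_def algebra_simps)
    also have "\<dots> = complex_of_real ((cmod (h z))\<^sup>2) * complex_of_real (\<mu> z)" by (simp only: complex_norm_square)
    finally show ?thesis by simp
  qed
  have "complex_of_real (\<integral>z. cmod (h z) powr 2 * \<mu> z \<partial>lebesgue_on \<Omega>) =
      (\<integral>z. (f z - g z) * cnj (h z) * complex_of_real (\<mu> z) - (f z - b z) * cnj (h z) * complex_of_real (\<mu> z) \<partial>lebesgue_on \<Omega>)"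
    unfolding eq by (rule integral_complex_of_real[symmetric])
  also have "\<dots> = L2_inner \<Omega> \<mu> (\<lambda>z. f z - g z) h - L2_inner \<Omega> \<mu> (\<lambda>z. f z - b z) h"
    unfolding L2_inner_def by (rule Bochner_Integration.integral_diff[OF i1 i2])
  also have "\<dots> = 0" using orth[OF h] orthb[OF h] by simp
  finally have "(\<integral>z. cmod (h z) powr 2 * \<mu> z \<partial>lebesgue_on \<Omega>) = 0" by simp
  moreover have "integrable (lebesgue_on \<Omega>) (\<lambda>z. cmod (h z) powr 2 * \<mu> z)"
    using hL by (simp add: Lp_space_def)
  ultimately have "AE z in lebesgue_on \<Omega>. cmod (h z) powr 2 * \<mu> z = 0"
    by (subst (asm) integral_nonneg_eq_0_iff_AE) (auto simp: nn)
  moreover have "AE z in lebesgue_on \<Omega>. z \<in> \<Omega>" by (intro AE_I2) (auto simp: space_restrict_space)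
  ultimately show "AE z in lebesgue_on \<Omega>. bergman_projection \<Omega> \<mu> f z = g z"
    by eventually_elim (use pos in \<open>force simp: h_def b_def\<close>)
qed

section \<open>The explicit projection on the Hartogs triangle\<close>

lemma nn_integral_bidisc_power:
  assumes [measurable]: "g \<in> borel_measurable (borel \<Otimes>\<^sub>M borel)"
  shows "(\<integral>\<^sup>+x. ennreal (cmod (snd x ^ m * g x) powr p) \<partial>bidisc_measure q) =
    (\<integral>\<^sup>+x. ennreal (cmod (g x) powr p) \<partial>bidisc_measure (q + real m * p))"
proof -
  have "(\<integral>\<^sup>+x. ennreal (cmod (g x) powr p) \<partial>bidisc_measure (q + real m * p)) =
      (\<integral>\<^sup>+x. ennreal (cmod (snd x) powr (real m * p)) * ennreal (cmod (g x) powr p) \<partial>bidisc_measure q)"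
    by (rule nn_integral_bidisc_measure_add) measurable
  also have "\<dots> = (\<integral>\<^sup>+x. ennreal (cmod (snd x ^ m * g x) powr p) \<partial>bidisc_measure q)"
  proof (rule nn_integral_cong_AE)
    show "AE x in bidisc_measure q. ennreal (cmod (snd x) powr (real m * p)) * ennreal (cmod (g x) powr p) =
        ennreal (cmod (snd x ^ m * g x) powr p)"
      using AE_bidisc_measure
    proof eventually_elim
      case (elim x)
      then have "cmod (snd x) > 0" by auto
      then have "(cmod (snd x) ^ m) powr p = cmod (snd x) powr (real m * p)"
        by (simp add: powr_powr flip: powr_realpow)
      then show ?case by (simp add: norm_mult norm_power powr_mult flip: ennreal_mult')
    qed
  qed
  finally show ?thesis ..
qed

text \<open>The product operator conjugated by multiplication with the \<open>m\<close>-th power of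
  the second coordinate. It is defined for every \<open>f\<close>, independently of any
  integrability.\<close>

definition hartogs_projection :: "real \<Rightarrow> nat \<Rightarrow> (complex ^ 2 \<Rightarrow> complex) \<Rightarrow> complex ^ 2 \<Rightarrow> complex" where
  "hartogs_projection s m f u =
    bidisc_projection s (\<lambda>x. snd x ^ m * f (hartogs_map x)) (hartogs_inv u) / (u $ 2) ^ m"

lemma measurable_hartogs_projection [measurable]:
  assumes [measurable]: "f \<in> borel_measurable borel"
  shows "hartogs_projection s m f \<in> borel_measurable borel"
  unfolding hartogs_projection_def by measurable

lemma hartogs_projection_map:
  assumes "snd x \<noteq> 0"
  shows "snd x ^ m * hartogs_projection s m f (hartogs_map x) =
    bidisc_projection s (\<lambda>x. snd x ^ m * f (hartogs_map x)) x"
  using assms by (simp add: hartogs_projection_def hartogs_inv_map)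

lemma norm_bidisc_projection_le:
  "ennreal (cmod (bidisc_projection s G x)) \<le>
    (\<integral>\<^sup>+y. ennreal (cmod (bidisc_kernel s x y * G y)) \<partial>bidisc_measure (s - 2))"
proof (cases "integrable (bidisc_measure (s - 2)) (\<lambda>y. bidisc_kernel s x y * G y)")
  case True
  then show ?thesis unfolding bidisc_projection_def by (rule integral_norm_bound_ennreal)
next
  case False
  then show ?thesis unfolding bidisc_projection_def by (simp add: not_integrable_integral_eq)
qed

text \<open>Multiplication by the \<open>m\<close>-th power lowers both norm exponents by
  \<open>m * p\<close>. The two inequalities assumed for \<open>p\<close> become exactly the
  integrability conditions of \<open>bidisc_Lp_bound\<close>.\<close>

lemma hartogs_projection_Lp_bound:
  fixes s t p :: real and m :: nat
  assumes s: "0 < s" "s \<le> 2" and p: "p > 1" and upper: "real m * p < t + 4" and lower: "s + 2 * real m < p * (s + m)"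
  obtains C where "C > 0"
    "\<And>f. f \<in> borel_measurable borel \<Longrightarrow>
      (\<integral>\<^sup>+x. ennreal (cmod (hartogs_projection s m f (hartogs_map x)) powr p) \<partial>bidisc_measure (t + 2)) \<le>
      ennreal C * (\<integral>\<^sup>+x. ennreal (cmod (f (hartogs_map x)) powr p) \<partial>bidisc_measure (s - 2 + 2 * real m))"
proof -
  define q where "q = s - 2 + 2 * real m - real m * p"
  \<comment> \<open>Clearing the denominator \<open>p - 1\<close> in the dual condition turns it
    into the lower bound on \<open>p\<close>.\<close>
  have "(p - 1) * ((s - 2 - q) * (p / (p - 1)) + q + 2) = p * (s + m) - (s + 2 * real m)"
    using p unfolding q_def by (simp add: field_simps)
  then have "0 < (p - 1) * ((s - 2 - q) * (p / (p - 1)) + q + 2)" using lower by simp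
  then have "0 < (s - 2 - q) * (p / (p - 1)) + q + 2" using p by (simp add: zero_less_mult_iff)
  then have q: "(s - 2 - q) * (p / (p - 1)) + q > -2" by simp
  have r: "t + 2 - real m * p > -2" using upper by simp
  obtain C where C: "C > 0" "\<And>G J. G \<in> borel_measurable (borel \<Otimes>\<^sub>M borel) \<Longrightarrow> (\<And>x. 0 \<le> J x) \<Longrightarrow>
      (\<And>x. ennreal (J x) \<le> (\<integral>\<^sup>+y. ennreal (cmod (bidisc_kernel s x y * G y)) \<partial>bidisc_measure (s - 2))) \<Longrightarrow>
      (\<integral>\<^sup>+x. ennreal (J x powr p) \<partial>bidisc_measure (t + 2 - real m * p)) \<le>
        ennreal C * (\<integral>\<^sup>+y. ennreal (cmod (G y) powr p) \<partial>bidisc_measure q)"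
    by (rule bidisc_Lp_bound[OF s p r q]) blast
  show ?thesis
  proof (rule that[OF C(1)])
    fix f :: "complex ^ 2 \<Rightarrow> complex" assume [measurable]: "f \<in> borel_measurable borel"
    define G where "G = (\<lambda>x. snd x ^ m * f (hartogs_map x))"
    have [measurable]: "G \<in> borel_measurable (borel \<Otimes>\<^sub>M borel)" unfolding G_def by measurable
    have "(\<integral>\<^sup>+x. ennreal (cmod (hartogs_projection s m f (hartogs_map x)) powr p) \<partial>bidisc_measure (t + 2)) =
        (\<integral>\<^sup>+x. ennreal (cmod (snd x ^ m * hartogs_projection s m f (hartogs_map x)) powr p) \<partial>bidisc_measure (t + 2 - real m * p))"
      by (subst nn_integral_bidisc_power) simp_all
    also have "\<dots> = (\<integral>\<^sup>+x. ennreal (cmod (bidisc_projection s G x) powr p) \<partial>bidisc_measure (t + 2 - real m * p))"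
    proof (rule nn_integral_cong_AE)
      show "AE x in bidisc_measure (t + 2 - real m * p). ennreal (cmod (snd x ^ m * hartogs_projection s m f (hartogs_map x)) powr p) =
          ennreal (cmod (bidisc_projection s G x) powr p)"
        using AE_bidisc_measure by eventually_elim (subst hartogs_projection_map, auto simp: G_def)
    qed
    also have "\<dots> \<le> ennreal C * (\<integral>\<^sup>+y. ennreal (cmod (G y) powr p) \<partial>bidisc_measure q)"
      by (intro C norm_bidisc_projection_le) auto
    also have "(\<integral>\<^sup>+y. ennreal (cmod (G y) powr p) \<partial>bidisc_measure q) =
        (\<integral>\<^sup>+x. ennreal (cmod (f (hartogs_map x)) powr p) \<partial>bidisc_measure (s - 2 + 2 * real m))"
      unfolding G_def by (subst nn_integral_bidisc_power) (auto simp: q_def)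
    finally show "(\<integral>\<^sup>+x. ennreal (cmod (hartogs_projection s m f (hartogs_map x)) powr p) \<partial>bidisc_measure (t + 2)) \<le>
      ennreal C * (\<integral>\<^sup>+x. ennreal (cmod (f (hartogs_map x)) powr p) \<partial>bidisc_measure (s - 2 + 2 * real m))" .
  qed
qed

text \<open>On the triangle the second coordinate does not vanish, so \<open>hartogs_inv\<close> and
  the division by its power are holomorphic. Square integrability gives integrability of
  \<open>G\<close>, because the measure with exponent \<open>s - 2 > -2\<close> is finite.\<close>

lemma hartogs_projection_holomorphic:
  assumes s: "0 < s" "s \<le> 2" and [measurable]: "f \<in> borel_measurable borel"
    and fin: "(\<integral>\<^sup>+x. ennreal (cmod (f (hartogs_map x)) powr 2) \<partial>bidisc_measure (s - 2 + 2 * real m)) < \<infinity>"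
  shows "holomorphic_several_on (hartogs_projection s m f) hartogs_triangle"
  unfolding holomorphic_several_on_def
proof
  fix u assume u: "u \<in> hartogs_triangle"
  have u2: "u $ 2 \<noteq> 0" using hartogs_triangleD(1)[OF u] .
  define G where "G = (\<lambda>x. snd x ^ m * f (hartogs_map x))"
  have [measurable]: "G \<in> borel_measurable (borel \<Otimes>\<^sub>M borel)" unfolding G_def by measurable
  have "(\<integral>\<^sup>+x. ennreal (cmod (G x) powr 2) \<partial>bidisc_measure (s - 2)) < \<infinity>"
    unfolding G_def using fin by (subst nn_integral_bidisc_power) (auto simp: mult.commute)
  then have "integrable (bidisc_measure (s - 2)) G"
    using s by (intro integrable_L2 finite_measure_bidisc_measure) auto
  moreover have "hartogs_inv u \<in> ball 0 1 \<times> ball 0 1" using hartogs_triangleD(2)[OF u] by auto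
  ultimately obtain D where D: "(bidisc_projection s G has_derivative D) (at (hartogs_inv u))"
    "\<And>c v. D (c * fst v, c * snd v) = c * D v"
    using bidisc_projection_has_derivative[OF s] by metis
  define L where "L = (\<lambda>v :: complex ^ 2. (- (u $ 1) * (inverse (u $ 2) * v $ 2 * inverse (u $ 2)) + v $ 1 / u $ 2, v $ 2))"
  have nth: "((\<lambda>u :: complex ^ 2. u $ i) has_derivative (\<lambda>v. v $ i)) (at u)" for i
    by (rule bounded_linear_imp_has_derivative) (rule bounded_linear_vec_nth)
  have "(hartogs_inv has_derivative L) (at u)"
    unfolding hartogs_inv_def L_def
    by (intro has_derivative_Pair nth has_derivative_divide[OF nth nth u2])
  from has_derivative_compose[OF this D(1)]
  have d1: "((\<lambda>u. bidisc_projection s G (hartogs_inv u)) has_derivative (\<lambda>v. D (L v))) (at u)" .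
  have "(\<lambda>z :: complex. inverse (z ^ m)) field_differentiable at (u $ 2)"
    using u2 by (intro derivative_intros) auto
  then obtain d where "((\<lambda>z. inverse (z ^ m)) has_field_derivative d) (at (u $ 2))"
    by (auto simp: field_differentiable_def)
  then have "((\<lambda>z. inverse (z ^ m)) has_derivative (*) d) (at (u $ 2))" by (simp add: has_field_derivative_def)
  from has_derivative_compose[OF nth this]
  have d2: "((\<lambda>u. inverse ((u $ 2) ^ m)) has_derivative (\<lambda>v. d * v $ 2)) (at u)" .
  define E where "E = (\<lambda>v. bidisc_projection s G (hartogs_inv u) * (d * v $ 2) + D (L v) * inverse ((u $ 2) ^ m))"
  have "(hartogs_projection s m f has_derivative E) (at u)"
    unfolding hartogs_projection_def[abs_def] E_def divide_inverse G_def[symmetric]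
    by (rule has_derivative_mult[OF d1 d2])
  moreover have "E (c *s v) = c * E v" for c v
  proof -
    have "L (c *s v) = (c * fst (L v), c * snd (L v))"
      by (simp add: L_def algebra_simps)
    then show ?thesis by (simp add: E_def D(2) algebra_simps)
  qed
  ultimately show "\<exists>D. (hartogs_projection s m f has_derivative D) (at u) \<and> (\<forall>c v. D (c *s v) = c * D v)"
    by blast
qed

text \<open>In the relation between \<open>s'\<close> and \<open>s\<close>, the 2 on the left is the
  Jacobian and \<open>2 * m\<close> is the squared modulus of the multiplier. The explicit operator
  maps into the Bergman space and leaves an orthogonal remainder, so uniqueness identifies
  it.\<close>

lemma bergman_projection_hartogs:
  fixes s s' :: real and m :: nat
  assumes s: "0 < s" "s \<le> 2" and s': "s' + 2 = s - 2 + 2 * real m"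
    and f: "f \<in> Lp_space 2 hartogs_triangle (power_weight s')"
    and f0 [measurable]: "f0 \<in> borel_measurable borel"
    and ff0: "AE u in lebesgue_on hartogs_triangle. f u = f0 u"
  defines "b \<equiv> bergman_projection hartogs_triangle (power_weight s') f"
  shows "b \<in> borel_measurable (lebesgue_on hartogs_triangle)"
    and "AE u in lebesgue_on hartogs_triangle. b u = hartogs_projection s m f0 u"
proof -
  let ?H = "lebesgue_on hartogs_triangle" and ?g = "hartogs_projection s m f0"
  have [measurable]: "power_weight s' \<in> borel_measurable borel" unfolding power_weight_def by measurable
  have mw: "power_weight s' \<in> borel_measurable ?H" by measurable
  have mf: "f \<in> borel_measurable ?H" using f by (simp add: Lp_space_def)
  have fin0: "(\<integral>\<^sup>+x. ennreal (cmod (f0 (hartogs_map x)) powr 2) \<partial>bidisc_measure (s - 2 + 2 * real m)) < \<infinity>"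
    using f Lp_hartogs(1)[OF mf f0 ff0, of 2 s'] by (simp add: s')
  define G where "G = (\<lambda>x. snd x ^ m * f0 (hartogs_map x))"
  have G [measurable]: "G \<in> borel_measurable (borel \<Otimes>\<^sub>M borel)" unfolding G_def by measurable
  have finG: "(\<integral>\<^sup>+x. ennreal (cmod (G x) powr 2) \<partial>bidisc_measure (s - 2)) < \<infinity>"
    unfolding G_def using fin0 by (subst nn_integral_bidisc_power) (auto simp: mult.commute)
  have mg: "?g \<in> borel_measurable ?H" by measurable
  have gL: "?g \<in> Lp_space 2 hartogs_triangle (power_weight s')"
  proof -
    \<comment> \<open>For \<open>p = 2\<close> and \<open>t = s'\<close>, both conditions reduce to
      \<open>s > 0\<close>.\<close>
    have c: "real m * 2 < s' + 4" "s + 2 * real m < 2 * (s + real m)" using s s' by auto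
    have two: "(2 :: real) > 1" by simp
    obtain C where C: "C > 0" "\<And>f. f \<in> borel_measurable borel \<Longrightarrow>
        (\<integral>\<^sup>+x. ennreal (cmod (hartogs_projection s m f (hartogs_map x)) powr 2) \<partial>bidisc_measure (s' + 2)) \<le>
        ennreal C * (\<integral>\<^sup>+x. ennreal (cmod (f (hartogs_map x)) powr 2) \<partial>bidisc_measure (s - 2 + 2 * real m))"
      by (rule hartogs_projection_Lp_bound[OF s two c]) blast
    have "(\<integral>\<^sup>+x. ennreal (cmod (?g (hartogs_map x)) powr 2) \<partial>bidisc_measure (s' + 2)) \<le>
        ennreal C * (\<integral>\<^sup>+x. ennreal (cmod (f0 (hartogs_map x)) powr 2) \<partial>bidisc_measure (s - 2 + 2 * real m))"
      by (rule C(2)[OF f0])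
    also have "\<dots> < \<infinity>" using fin0 by (simp add: ennreal_mult_less_top)
    finally show ?thesis using Lp_hartogs(1)[OF mg measurable_hartogs_projection[OF f0], of s m 2 s'] by simp
  qed
  have g: "?g \<in> bergman_space hartogs_triangle (power_weight s')"
    using gL hartogs_projection_holomorphic[OF s f0 fin0] by (simp add: bergman_space_def)
  have orth: "L2_inner hartogs_triangle (power_weight s') (\<lambda>u. f u - ?g u) h = 0"
    if h: "h \<in> bergman_space hartogs_triangle (power_weight s')" for h
  proof -
    \<comment> \<open>Cutting off a continuous function on an open set yields a Borel representative
      that agrees with \<open>h\<close> everywhere on the triangle. An almost everywhere
      representative would lose the holomorphy of the slices.\<close>
    define h0 where "h0 = (\<lambda>u. indicator hartogs_triangle u *\<^sub>R h u)"
    have hol: "holomorphic_several_on h hartogs_triangle" and hL: "h \<in> Lp_space 2 hartogs_triangle (power_weight s')"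
      using h by (auto simp: bergman_space_def)
    have h0 [measurable]: "h0 \<in> borel_measurable borel"
      unfolding h0_def
      by (intro borel_measurable_continuous_on_indicator holomorphic_several_on_imp_continuous_on hol sets_hartogs_triangle)
    have mh: "h \<in> borel_measurable ?H" using hL by (simp add: Lp_space_def)
    have hh0: "AE u in ?H. h u = h0 u"
      by (intro AE_I2) (auto simp: h0_def space_restrict_space)
    define E where "E = (\<lambda>x. snd x ^ m * h0 (hartogs_map x))"
    have E [measurable]: "E \<in> borel_measurable (borel \<Otimes>\<^sub>M borel)" unfolding E_def by measurable
    have "(\<integral>\<^sup>+x. ennreal (cmod (h0 (hartogs_map x)) powr 2) \<partial>bidisc_measure (s - 2 + 2 * real m)) < \<infinity>"
      using hL Lp_hartogs(1)[OF mh h0 hh0, of 2 s'] by (simp add: s')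
    then have finE: "(\<integral>\<^sup>+x. ennreal (cmod (E x) powr 2) \<partial>bidisc_measure (s - 2)) < \<infinity>"
      unfolding E_def by (subst nn_integral_bidisc_power) (auto simp: mult.commute)
    have Eh: "E (w, z) = z ^ m * h (vec2 (w * z) z)" if "w \<in> ball 0 1" "z \<in> ball 0 1 - {0}" for w z
      using that hartogs_map_mem_iff[of "(w, z)"] by (auto simp: E_def h0_def hartogs_map_def)
    have hol1: "(\<lambda>w. E (w, z)) holomorphic_on ball 0 1" if z: "z \<in> ball 0 1 - {0}" for z
    proof -
      have v: "w *s vec2 z 0 + vec2 0 z = vec2 (w * z) z" for w by (simp add: vec_eq_iff forall_2)
      have "(\<lambda>w. h (w *s vec2 z 0 + vec2 0 z)) holomorphic_on ball 0 1"
        using z hartogs_map_mem_iff[of "(_, z)"]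
        by (intro holomorphic_several_on_line[OF hol]) (auto simp: v hartogs_map_def)
      then have "(\<lambda>w. z ^ m * h (vec2 (w * z) z)) holomorphic_on ball 0 1"
        unfolding v by (intro holomorphic_intros)
      then show ?thesis by (rule holomorphic_transform) (use Eh z in auto)
    qed
    have hol2: "(\<lambda>z. E (w, z)) holomorphic_on ball 0 1 - {0}" if w: "w \<in> ball 0 1" for w
    proof -
      have v: "z *s vec2 w 1 = vec2 (w * z) z" for z by (simp add: vec_eq_iff forall_2 mult.commute)
      have "(\<lambda>z. h (z *s vec2 w 1 + 0)) holomorphic_on ball 0 1 - {0}"
        using w hartogs_map_mem_iff[of "(w, _)"]
        by (intro holomorphic_several_on_line[OF hol]) (auto simp: v hartogs_map_def)
      then have "(\<lambda>z. z ^ m * h (vec2 (w * z) z)) holomorphic_on ball 0 1 - {0}"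
        unfolding v add_0_right by (intro holomorphic_intros)
      then show ?thesis by (rule holomorphic_transform) (use Eh w in auto)
    qed
    have "L2_inner hartogs_triangle (power_weight s') (\<lambda>u. f u - ?g u) h =
        (\<integral>u. ((f0 u - ?g u) * cnj (h0 u)) * complex_of_real (power_weight s' u) \<partial>?H)"
      unfolding L2_inner_def
    proof (rule integral_cong_AE)
      show "AE u in ?H. (f u - ?g u) * cnj (h u) * complex_of_real (power_weight s' u) =
          ((f0 u - ?g u) * cnj (h0 u)) * complex_of_real (power_weight s' u)"
        using ff0 hh0 by eventually_elim simp
    qed (use mf mg mh mw in measurable)
    also have "\<dots> = (\<integral>x. (f0 (hartogs_map x) - ?g (hartogs_map x)) * cnj (h0 (hartogs_map x)) \<partial>bidisc_measure (s' + 2))"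
      by (rule integral_hartogs_weight) measurable
    also have "bidisc_measure (s' + 2) = density (bidisc_measure (s - 2)) (\<lambda>x. ennreal (cmod (snd x) powr (2 * real m)))"
      by (simp add: density_bidisc_measure s')
    also have "(\<integral>x. (f0 (hartogs_map x) - ?g (hartogs_map x)) * cnj (h0 (hartogs_map x)) \<partial>\<dots>) =
        (\<integral>x. (cmod (snd x) powr (2 * real m)) *\<^sub>R ((f0 (hartogs_map x) - ?g (hartogs_map x)) * cnj (h0 (hartogs_map x))) \<partial>bidisc_measure (s - 2))"
      by (rule integral_density) auto
    also have "\<dots> = (\<integral>x. (G x - bidisc_projection s G x) * cnj (E x) \<partial>bidisc_measure (s - 2))"
    proof (rule integral_cong_AE)
      show "AE x in bidisc_measure (s - 2). (cmod (snd x) powr (2 * real m)) *\<^sub>R ((f0 (hartogs_map x) - ?g (hartogs_map x)) * cnj (h0 (hartogs_map x)))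
          = (G x - bidisc_projection s G x) * cnj (E x)"
        using AE_bidisc_measure
      proof eventually_elim
        case (elim x)
        then have x: "snd x \<noteq> 0" by auto
        \<comment> \<open>The weight splits as a power times its conjugate: one factor goes to
          \<open>f0\<close> minus its projection, the conjugate one to \<open>h0\<close>.\<close>
        have "complex_of_real (cmod (snd x) powr (2 * real m)) = complex_of_real (((cmod (snd x))\<^sup>2) ^ m)"
          using x powr_realpow[of "cmod (snd x)" "2 * m"] by (simp add: power_mult)
        also have "\<dots> = (snd x * cnj (snd x)) ^ m"
          unfolding complex_norm_square[symmetric] by (rule of_real_power)
        also have "\<dots> = snd x ^ m * cnj (snd x ^ m)" by (simp add: power_mult_distrib)
        finally have P: "complex_of_real (cmod (snd x) powr (2 * real m)) = snd x ^ m * cnj (snd x ^ m)" .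
        have "bidisc_projection s G x = snd x ^ m * ?g (hartogs_map x)"
          using hartogs_projection_map[OF x] by (simp add: G_def)
        then show ?case
          unfolding scaleR_conv_of_real P by (simp add: G_def E_def algebra_simps)
      qed
    qed measurable
    also have "\<dots> = 0"
      by (rule bidisc_projection_orthogonal[OF s G finG E finE hol1 hol2])
    finally show ?thesis .
  qed
  have pos: "0 < power_weight s' u" if "u \<in> hartogs_triangle" for u
    using hartogs_triangleD(1)[OF that] by (simp add: power_weight_def)
  note B = bergman_projection_AE_eq[OF mw _ pos f g orth]
  show "AE u in ?H. b u = ?g u" unfolding b_def by (rule B(2)) (auto simp: power_weight_def)
  have "b \<in> bergman_space hartogs_triangle (power_weight s')" unfolding b_def by (rule B(1)) (auto simp: power_weight_def)
  then show "b \<in> borel_measurable ?H" by (simp add: bergman_space_def Lp_space_def)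
qed

text \<open>The estimate for the explicit operator compares \<open>p\<close>-th powers of norms of
  Borel representatives, so the operator constant is the \<open>p\<close>-th root of
  \<open>C\<close>.\<close>

lemma bergman_projection_bounded_hartogs:
  fixes s s' p t :: real and m :: nat
  assumes s: "0 < s" "s \<le> 2" and s': "s' + 2 = s - 2 + 2 * real m"
    and p: "p > 1" and upper: "real m * p < t + 4" and lower: "s + 2 * real m < p * (s + m)"
  shows "bergman_projection_bounded p hartogs_triangle (power_weight s') (power_weight t)"
proof -
  obtain C where C: "C > 0" "\<And>f. f \<in> borel_measurable borel \<Longrightarrow>
      (\<integral>\<^sup>+x. ennreal (cmod (hartogs_projection s m f (hartogs_map x)) powr p) \<partial>bidisc_measure (t + 2)) \<le>
      ennreal C * (\<integral>\<^sup>+x. ennreal (cmod (f (hartogs_map x)) powr p) \<partial>bidisc_measure (s - 2 + 2 * real m))"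
    by (rule hartogs_projection_Lp_bound[OF s p upper lower]) blast
  show ?thesis
    unfolding bergman_projection_bounded_def
  proof (intro exI[of _ "C powr (1 / p)"] ballI)
    fix f assume f: "f \<in> Lp_space p hartogs_triangle (power_weight s') \<inter> Lp_space 2 hartogs_triangle (power_weight s')"
    then have mf: "f \<in> borel_measurable (lebesgue_on hartogs_triangle)" by (simp add: Lp_space_def)
    obtain f0 where f0 [measurable]: "f0 \<in> borel_measurable borel" and ff0: "AE u in lebesgue_on hartogs_triangle. f u = f0 u"
      using borel_representative[OF mf] .
    let ?b = "bergman_projection hartogs_triangle (power_weight s') f"
    note b = bergman_projection_hartogs[OF s s' _ f0 ff0]
    have mb: "?b \<in> borel_measurable (lebesgue_on hartogs_triangle)"
      and eqb: "AE u in lebesgue_on hartogs_triangle. ?b u = hartogs_projection s m f0 u"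
      using b f by auto
    define A where "A = (\<integral>\<^sup>+x. ennreal (cmod (f0 (hartogs_map x)) powr p) \<partial>bidisc_measure (s' + 2))"
    define B where "B = (\<integral>\<^sup>+x. ennreal (cmod (hartogs_projection s m f0 (hartogs_map x)) powr p) \<partial>bidisc_measure (t + 2))"
    have BA: "B \<le> ennreal C * A" unfolding A_def B_def s' by (rule C(2)) measurable
    have A: "A < \<infinity>" using f Lp_hartogs(1)[OF mf f0 ff0, of p s'] by (simp add: A_def)
    have "ennreal C * A < \<infinity>" using A by (simp add: ennreal_mult_less_top)
    with BA have B: "B < \<infinity>" by (rule le_less_trans)
    have mh: "hartogs_projection s m f0 \<in> borel_measurable borel" by measurable
    have "?b \<in> Lp_space p hartogs_triangle (power_weight t)"
      using B Lp_hartogs(1)[OF mb mh eqb, of p t] by (simp add: B_def)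
    moreover have "Lp_norm p hartogs_triangle (power_weight t) ?b \<le> C powr (1 / p) * Lp_norm p hartogs_triangle (power_weight s') f"
    proof -
      have "enn2real B \<le> enn2real (ennreal C * A)"
        using BA \<open>ennreal C * A < \<infinity>\<close> by (intro enn2real_mono) auto
      also have "\<dots> = C * enn2real A" using C(1) by (simp add: enn2real_mult)
      finally have "enn2real B powr (1 / p) \<le> (C * enn2real A) powr (1 / p)"
        using p by (intro powr_mono2) auto
      also have "\<dots> = C powr (1 / p) * enn2real A powr (1 / p)" using C(1) by (simp add: powr_mult)
      finally show ?thesis
        using Lp_hartogs(2)[OF mb mh eqb, of p t] Lp_hartogs(2)[OF mf f0 ff0, of p s']
        by (simp add: A_def B_def)
    qed
    ultimately show "?b \<in> Lp_space p hartogs_triangle (power_weight t) \<and>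
        Lp_norm p hartogs_triangle (power_weight t) ?b \<le> C powr (1 / p) * Lp_norm p hartogs_triangle (power_weight s') f"
      by blast
  qed
qed

section \<open>Necessity of the conditions on \<open>p\<close>\<close>

lemma nn_integral_disc_measure_add:
  assumes [measurable]: "f \<in> borel_measurable borel"
  shows "(\<integral>\<^sup>+z. ennreal (cmod z powr q) * f z \<partial>disc_measure r) = (\<integral>\<^sup>+z. f z \<partial>disc_measure (r + q))"
  unfolding density_disc_measure[symmetric] by (rule nn_integral_density[symmetric]) measurable

text \<open>Multiplying the density by the power \<open>-r\<close> gives the unweighted disc, whose
  mass is \<open>pi\<close>; a null measure would stay null.\<close>

lemma emeasure_disc_measure_pos: "0 < emeasure (disc_measure r) UNIV"
proof (rule ccontr)
  assume "\<not> 0 < emeasure (disc_measure r) UNIV"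
  then have "emeasure (disc_measure r) (space (disc_measure r)) = 0" by simp
  then have "AE z in disc_measure r. False" by (subst AE_iff_measurable[of "space (disc_measure r)"]) auto
  then have "(\<integral>\<^sup>+z. ennreal (cmod z powr (- r)) * 1 \<partial>disc_measure r) = (\<integral>\<^sup>+z. 0 \<partial>disc_measure r)"
    by (intro nn_integral_cong_AE) (auto elim!: eventually_mono)
  then have "emeasure (disc_measure 0) UNIV = 0"
    using nn_integral_disc_measure_add[where f="\<lambda>_. 1" and q="- r" and r=r] by simp
  then show False by (simp add: emeasure_disc_measure_0)
qed

text \<open>Removing the disc of radius \<open>\<epsilon>\<close> keeps the mass finite for every
  \<open>r\<close>, so that divergence at the origin can be approached through admissible test
  functions.\<close>

definition annulus_mass :: "real \<Rightarrow> real \<Rightarrow> ennreal" where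
  "annulus_mass r \<epsilon> = (\<integral>\<^sup>+z. indicator {\<epsilon>..} (cmod z) \<partial>disc_measure r)"

lemma annulus_mass_finite:
  assumes "0 < \<epsilon>" "\<epsilon> \<le> 1"
  shows "annulus_mass r \<epsilon> < \<infinity>"
proof -
  have "annulus_mass r \<epsilon> = (\<integral>\<^sup>+z. ennreal (cmod z powr r) * indicator {\<epsilon>..} (cmod z) \<partial>disc_measure 0)"
    unfolding annulus_mass_def by (subst nn_integral_disc_measure_add) auto
  also have "\<dots> \<le> (\<integral>\<^sup>+z. ennreal (max 1 (\<epsilon> powr r)) \<partial>disc_measure 0)"
  proof (rule nn_integral_mono_AE)
    show "AE z in disc_measure 0. ennreal (cmod z powr r) * indicator {\<epsilon>..} (cmod z) \<le> ennreal (max 1 (\<epsilon> powr r))"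
      using AE_disc_measure
    proof eventually_elim
      case (elim z)
      have "cmod z powr r \<le> max 1 (\<epsilon> powr r)" if "\<epsilon> \<le> cmod z"
      proof (cases "r \<ge> 0")
        case True
        then have "cmod z powr r \<le> 1" using elim powr_mono2[of r "cmod z" 1] by auto
        then show ?thesis by simp
      next
        case False
        then have "cmod z powr r \<le> \<epsilon> powr r" using that assms by (intro powr_mono2') auto
        then show ?thesis by simp
      qed
      then show ?case by (auto simp: ennreal_leI split: split_indicator)
    qed
  qed
  also have "\<dots> < \<infinity>" by (simp add: emeasure_disc_measure_0 ennreal_mult_less_top)
  finally show ?thesis .
qed

text \<open>In \<open>u = |z|\<^sup>2\<close> the density is \<open>pi * u powr (r / 2)\<close>, at
  least \<open>pi / u\<close> for \<open>r \<le> -2\<close> and \<open>0 < u < 1\<close>; its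
  integral diverges logarithmically at 0.\<close>

lemma annulus_mass_unbounded:
  assumes r: "r \<le> -2"
  obtains \<epsilon> where "0 < \<epsilon>" "\<epsilon> \<le> 1" "ennreal X \<le> annulus_mass r \<epsilon>"
proof -
  \<comment> \<open>Chosen so that \<open>ln (1/2) - ln a\<close> is exactly
    \<open>\<bar>X\<bar>\<close>.\<close>
  define a where "a = exp (- \<bar>X\<bar>) / 2"
  have a: "0 < a" "a \<le> 1/2" by (auto simp: a_def)
  define \<epsilon> where "\<epsilon> = sqrt a"
  have \<epsilon>: "0 < \<epsilon>" "\<epsilon> \<le> 1" using a by (auto simp: \<epsilon>_def)
  have "ennreal X \<le> ennreal (pi * \<bar>X\<bar>)"
    using pi_gt3 mult_right_mono[of 1 pi "\<bar>X\<bar>"] by (intro ennreal_leI) auto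
  also have "pi * \<bar>X\<bar> = pi * ln (1/2) - pi * ln a"
    by (simp add: a_def ln_div algebra_simps)
  also have "ennreal \<dots> = (\<integral>\<^sup>+u. ennreal (pi / u) * indicator {a..1/2} u \<partial>lborel)"
    using a by (intro nn_integral_FTC_Icc[symmetric]) (auto intro!: derivative_eq_intros)
  also have "\<dots> \<le> (\<integral>\<^sup>+u. ennreal (pi * indicator {0<..<1} u * u powr (r / 2)) * indicator {\<epsilon>..} (sqrt u) \<partial>lborel)"
  proof (rule nn_integral_mono)
    fix u :: real
    show "ennreal (pi / u) * indicator {a..1/2} u \<le>
        ennreal (pi * indicator {0<..<1} u * u powr (r / 2)) * indicator {\<epsilon>..} (sqrt u)"
    proof (cases "u \<in> {a..1/2}")
      case True
      then have u: "0 < u" "u < 1" "\<epsilon> \<le> sqrt u" using a by (auto simp: \<epsilon>_def)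
      have "u powr (-1) \<le> u powr (r / 2)" using u r by (intro powr_mono') auto
      then have "pi * (1 / u) \<le> pi * u powr (r / 2)" using u by (intro mult_left_mono) (auto simp: powr_minus_divide)
      then show ?thesis using u True by (simp add: ennreal_leI)
    qed simp
  qed
  also have "\<dots> = (\<integral>\<^sup>+z. indicator {\<epsilon>..} (sqrt ((cmod z)\<^sup>2)) \<partial>disc_measure r)"
    by (rule nn_integral_disc_measure_radial[symmetric]) measurable
  also have "\<dots> = annulus_mass r \<epsilon>" by (simp add: annulus_mass_def)
  finally show ?thesis using that \<epsilon> by blast
qed

lemma emeasure_disc_measure_infinite:
  assumes "r \<le> -2"
  shows "emeasure (disc_measure r) UNIV = \<infinity>"
proof (rule ccontr)
  assume "emeasure (disc_measure r) UNIV \<noteq> \<infinity>"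
  then obtain x where x: "emeasure (disc_measure r) UNIV = ennreal x" "0 \<le> x" by (cases "emeasure (disc_measure r) UNIV") auto
  obtain \<epsilon> where "ennreal (x + 1) \<le> annulus_mass r \<epsilon>" using annulus_mass_unbounded[OF assms, of "x + 1"] by blast
  also have "\<dots> \<le> (\<integral>\<^sup>+z. 1 \<partial>disc_measure r)"
    unfolding annulus_mass_def by (intro nn_integral_mono) (auto split: split_indicator)
  also have "\<dots> = ennreal x" using x by simp
  finally show False using x by (simp add: ennreal_le_iff)
qed

definition radial_test :: "nat \<Rightarrow> (real \<Rightarrow> real) \<Rightarrow> complex ^ 2 \<Rightarrow> complex" where
  "radial_test m \<phi> u = complex_of_real (\<phi> (cmod (u $ 2))) / (u $ 2) ^ m"

lemma measurable_radial_test [measurable]: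
  assumes [measurable]: "\<phi> \<in> borel_measurable borel"
  shows "radial_test m \<phi> \<in> borel_measurable borel"
  unfolding radial_test_def by measurable

lemma nn_integral_radial_test:
  assumes [measurable]: "\<phi> \<in> borel_measurable borel"
  shows "(\<integral>\<^sup>+x. ennreal (cmod (radial_test m \<phi> (hartogs_map x)) powr p) \<partial>bidisc_measure q) =
    ennreal pi * (\<integral>\<^sup>+z. ennreal (\<bar>\<phi> (cmod z)\<bar> powr p) \<partial>disc_measure (q - real m * p))"
proof -
  have "(\<integral>\<^sup>+x. ennreal (cmod (radial_test m \<phi> (hartogs_map x)) powr p) \<partial>bidisc_measure q) =
      (\<integral>\<^sup>+x. ennreal (cmod (snd x ^ m * radial_test m \<phi> (hartogs_map x)) powr p) \<partial>bidisc_measure (q - real m * p))"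
    by (subst nn_integral_bidisc_power) simp_all
  also have "\<dots> = (\<integral>\<^sup>+x. 1 * ennreal (\<bar>\<phi> (cmod (snd x))\<bar> powr p) \<partial>bidisc_measure (q - real m * p))"
  proof (rule nn_integral_cong_AE)
    show "AE x in bidisc_measure (q - real m * p). ennreal (cmod (snd x ^ m * radial_test m \<phi> (hartogs_map x)) powr p) =
        1 * ennreal (\<bar>\<phi> (cmod (snd x))\<bar> powr p)"
      using AE_bidisc_measure by eventually_elim (auto simp: radial_test_def)
  qed
  also have "\<dots> = (\<integral>\<^sup>+x. 1 \<partial>disc_measure 0) * (\<integral>\<^sup>+z. ennreal (\<bar>\<phi> (cmod z)\<bar> powr p) \<partial>disc_measure (q - real m * p))"
    by (rule nn_integral_bidisc_measure_times) measurable
  finally show ?thesis by (simp add: emeasure_disc_measure_0)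
qed

text \<open>The multiplier cancels the denominator of the test function. What remains is radial in
  the second variable, and its projection is a constant.\<close>

lemma hartogs_projection_radial_test:
  assumes s: "0 < s" "s \<le> 2" and [measurable]: "\<phi> \<in> borel_measurable borel" and nn: "\<And>x. 0 \<le> \<phi> x"
    and N: "(\<integral>\<^sup>+z. ennreal (\<phi> (cmod z)) \<partial>disc_measure (s - 2)) = ennreal N" "0 \<le> N"
    and u: "u \<in> hartogs_triangle"
  shows "hartogs_projection s m (radial_test m \<phi>) u = radial_test m (\<lambda>_. s / (2 * pi) * N) u"
proof -
  have int: "integrable (disc_measure (s - 2)) (\<lambda>z. \<phi> (cmod z))"
    using N nn by (intro integrableI_bounded) (auto simp: N(1))
  have I: "(\<integral>z. \<phi> (cmod z) \<partial>disc_measure (s - 2)) = N"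
    using N nn by (subst integral_eq_nn_integral) auto
  have "bidisc_projection s (\<lambda>x. snd x ^ m * radial_test m \<phi> (hartogs_map x)) (hartogs_inv u) =
      bidisc_projection s (\<lambda>x. complex_of_real (\<phi> (cmod (snd x)))) (hartogs_inv u)"
    unfolding bidisc_projection_def
  proof (rule integral_cong_AE)
    show "AE x in bidisc_measure (s - 2). bidisc_kernel s (hartogs_inv u) x * (snd x ^ m * radial_test m \<phi> (hartogs_map x)) =
        bidisc_kernel s (hartogs_inv u) x * complex_of_real (\<phi> (cmod (snd x)))"
      using AE_bidisc_measure by eventually_elim (auto simp: radial_test_def)
  qed measurable
  also have "\<dots> = of_real (s / (2 * pi)) * (\<integral>z. complex_of_real (\<phi> (cmod z)) \<partial>disc_measure (s - 2))"
    using hartogs_triangleD(2)[OF u] int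
    by (intro bidisc_projection_radial s) (auto simp: complex_of_real_integrable_eq)
  also have "\<dots> = complex_of_real (s / (2 * pi) * N)"
    by (simp only: integral_complex_of_real I of_real_mult)
  finally show ?thesis by (simp add: hartogs_projection_def radial_test_def)
qed

text \<open>What boundedness says about the functions \<open>\<phi>(|z\<^sub>2|) / z\<^sub>2\<^sup>m\<close>, whose projections are
  multiples of the basis function \<open>z\<^sub>2\<^sup>-\<^sup>m\<close> of lowest degree.\<close>

lemma bergman_projection_bounded_radial_test:
  fixes s s' p t :: real and m :: nat
  assumes s: "0 < s" "s \<le> 2" and s': "s' + 2 = s - 2 + 2 * real m" and p: "p > 1"
    and bdd: "bergman_projection_bounded p hartogs_triangle (power_weight s') (power_weight t)"
  obtains K where "\<And>\<phi> N A. \<phi> \<in> borel_measurable borel \<Longrightarrow> (\<And>x. 0 \<le> \<phi> x) \<Longrightarrow>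
      (\<integral>\<^sup>+z. ennreal (\<phi> (cmod z)) \<partial>disc_measure (s - 2)) = ennreal N \<Longrightarrow> 0 < N \<Longrightarrow>
      (\<integral>\<^sup>+z. ennreal (\<phi> (cmod z) powr 2) \<partial>disc_measure (s - 2)) < \<infinity> \<Longrightarrow>
      (\<integral>\<^sup>+z. ennreal (\<phi> (cmod z) powr p) \<partial>disc_measure (s - 2 + 2 * real m - real m * p)) = ennreal A \<Longrightarrow> 0 \<le> A \<Longrightarrow>
      emeasure (disc_measure (t + 2 - real m * p)) UNIV < \<infinity> \<and> N \<le> K * A powr (1 / p)"
proof -
  let ?H = "lebesgue_on hartogs_triangle"
  let ?V = "emeasure (disc_measure (t + 2 - real m * p)) UNIV"
  obtain C where C: "\<And>f. f \<in> Lp_space p hartogs_triangle (power_weight s') \<inter> Lp_space 2 hartogs_triangle (power_weight s') \<Longrightarrow>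
        bergman_projection hartogs_triangle (power_weight s') f \<in> Lp_space p hartogs_triangle (power_weight t) \<and>
        Lp_norm p hartogs_triangle (power_weight t) (bergman_projection hartogs_triangle (power_weight s') f) \<le>
          C * Lp_norm p hartogs_triangle (power_weight s') f"
    using bdd unfolding bergman_projection_bounded_def by blast
  define V where "V = enn2real ?V"
  \<comment> \<open>\<open>D * N\<close> will be the target norm of the projection. \<open>V\<close>
    represents the true mass only once that mass is known to be finite, which is shown before
    \<open>D\<close> is used.\<close>
  define D where "D = (s / (2 * pi)) * (pi * V) powr (1 / p)"
  have main: "?V < \<infinity> \<and> N \<le> (C * pi powr (1 / p) / D) * A powr (1 / p)"
    if \<phi> [measurable]: "\<phi> \<in> borel_measurable borel" and nn: "\<And>x. 0 \<le> \<phi> x"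
      and N: "(\<integral>\<^sup>+z. ennreal (\<phi> (cmod z)) \<partial>disc_measure (s - 2)) = ennreal N" "0 < N"
      and fin2: "(\<integral>\<^sup>+z. ennreal (\<phi> (cmod z) powr 2) \<partial>disc_measure (s - 2)) < \<infinity>"
      and A: "(\<integral>\<^sup>+z. ennreal (\<phi> (cmod z) powr p) \<partial>disc_measure (s - 2 + 2 * real m - real m * p)) = ennreal A" "0 \<le> A"
    for \<phi> N A
  proof -
    let ?f = "radial_test m \<phi>"
    let ?b = "bergman_projection hartogs_triangle (power_weight s') ?f"
    define c where "c = s / (2 * pi) * N"
    have c: "0 < c" using s N by (simp add: c_def)
    have f0: "?f \<in> borel_measurable borel" by measurable
    have mf: "?f \<in> borel_measurable ?H" by (rule measurable_lebesgue_on_borel[OF f0])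
    have rr: "AE u in ?H. ?f u = ?f u" by simp
    have If: "(\<integral>\<^sup>+x. ennreal (cmod (?f (hartogs_map x)) powr r) \<partial>bidisc_measure (s' + 2)) =
        ennreal pi * (\<integral>\<^sup>+z. ennreal (\<phi> (cmod z) powr r) \<partial>disc_measure (s - 2 + 2 * real m - real m * r))" for r
      unfolding s' using nn by (subst nn_integral_radial_test) auto
    have Ifp: "(\<integral>\<^sup>+x. ennreal (cmod (?f (hartogs_map x)) powr p) \<partial>bidisc_measure (s' + 2)) = ennreal (pi * A)"
      unfolding If A using A by (simp add: ennreal_mult')
    have f2: "?f \<in> Lp_space 2 hartogs_triangle (power_weight s')"
      using fin2 by (subst Lp_hartogs(1)[OF mf f0 rr], subst If) (simp add: ennreal_mult_less_top mult.commute)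
    have fp: "?f \<in> Lp_space p hartogs_triangle (power_weight s')"
      by (subst Lp_hartogs(1)[OF mf f0 rr], subst Ifp) simp
    note b = bergman_projection_hartogs[OF s s' f2 f0 rr]
    have cc: "(\<lambda>_ :: real. c) \<in> borel_measurable borel" by simp
    have g0: "radial_test m (\<lambda>_. c) \<in> borel_measurable borel" by (rule measurable_radial_test[OF cc])
    have "AE u in ?H. u \<in> hartogs_triangle" by (intro AE_I2) (auto simp: space_restrict_space)
    with b(2) have eqb: "AE u in ?H. ?b u = radial_test m (\<lambda>_. c) u"
      by eventually_elim (use N in \<open>simp add: c_def hartogs_projection_radial_test[OF s \<phi> nn N(1)]\<close>)
    have Ib: "(\<integral>\<^sup>+x. ennreal (cmod (radial_test m (\<lambda>_. c) (hartogs_map x)) powr p) \<partial>bidisc_measure (t + 2)) =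
        ennreal (pi * c powr p) * ?V"
      using c by (subst nn_integral_radial_test[OF cc]) (simp add: ennreal_mult' mult.assoc)
    have C': "?b \<in> Lp_space p hartogs_triangle (power_weight t)"
        "Lp_norm p hartogs_triangle (power_weight t) ?b \<le> C * Lp_norm p hartogs_triangle (power_weight s') ?f"
      using C[of ?f] f2 fp by auto
    \<comment> \<open>The projection is a nonzero multiple of the inverse power of the second
      coordinate; its membership in the target space is finiteness of this mass.\<close>
    have Vfin: "?V < \<infinity>"
    proof -
      have "ennreal (pi * c powr p) \<noteq> 0" using c by (simp add: ennreal_eq_0_iff not_le)
      then show ?thesis
        using C'(1) unfolding Lp_hartogs(1)[OF b(1) g0 eqb] Ib infinity_ennreal_def ennreal_mult_less_top by auto
    qed
    then have V: "?V = ennreal V" "0 < V"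
      using emeasure_disc_measure_pos[of "t + 2 - real m * p"] by (auto simp: V_def enn2real_positive_iff)
    have D: "0 < D" using s V by (simp add: D_def)
    have "Lp_norm p hartogs_triangle (power_weight t) ?b = (pi * c powr p * V) powr (1 / p)"
      unfolding Lp_hartogs(2)[OF b(1) g0 eqb] Ib V(1) using V by (simp add: enn2real_mult)
    also have "pi * c powr p * V = c powr p * (pi * V)" by simp
    also have "(c powr p * (pi * V)) powr (1 / p) = c * (pi * V) powr (1 / p)"
      using c p V by (simp add: powr_mult powr_powr)
    also have "\<dots> = D * N" by (simp add: c_def D_def mult_ac)
    finally have "D * N \<le> C * (pi * A) powr (1 / p)"
      using C'(2) Ifp A unfolding Lp_hartogs(2)[OF mf f0 rr] by simp
    also have "\<dots> = C * pi powr (1 / p) * A powr (1 / p)" using A by (simp add: powr_mult)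
    finally show ?thesis using Vfin D by (simp add: field_simps)
  qed
  show ?thesis by (rule that[OF main])
qed

text \<open>With \<open>\<phi> x = x powr m\<close> the test function has modulus 1 off
  \<open>z\<^sub>2 = 0\<close> and lies in every source space, as the weight has finite mass. Its
  projection misses the target space: the exponent \<open>t + 2 - m * p\<close> is at most
  -2.\<close>

lemma bergman_projection_unbounded_upper:
  fixes s s' p t :: real and m :: nat
  assumes s: "0 < s" "s \<le> 2" and s': "s' + 2 = s - 2 + 2 * real m" and p: "p > 1"
    and upper: "t + 4 \<le> real m * p"
  shows "\<not> bergman_projection_bounded p hartogs_triangle (power_weight s') (power_weight t)"
proof
  assume bdd: "bergman_projection_bounded p hartogs_triangle (power_weight s') (power_weight t)"
  define \<phi> :: "real \<Rightarrow> real" where "\<phi> = (\<lambda>x. x powr real m)"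
  have [measurable]: "\<phi> \<in> borel_measurable borel" unfolding \<phi>_def by measurable
  have I: "(\<integral>\<^sup>+z. ennreal (\<phi> (cmod z) powr r) \<partial>disc_measure q) = emeasure (disc_measure (q + real m * r)) UNIV" for q r
    unfolding \<phi>_def powr_powr using nn_integral_disc_measure_add[where f="\<lambda>_. 1" and q="real m * r" and r=q] by simp
  have fin: "emeasure (disc_measure q) UNIV < \<infinity>" if "q > -2" for q
    using finite_measure.emeasure_finite[OF finite_measure_disc_measure[OF that], of UNIV] by (simp add: less_top)
  obtain K where K: "\<And>\<phi> N A. \<phi> \<in> borel_measurable borel \<Longrightarrow> (\<And>x. 0 \<le> \<phi> x) \<Longrightarrow>
      (\<integral>\<^sup>+z. ennreal (\<phi> (cmod z)) \<partial>disc_measure (s - 2)) = ennreal N \<Longrightarrow> 0 < N \<Longrightarrow>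
      (\<integral>\<^sup>+z. ennreal (\<phi> (cmod z) powr 2) \<partial>disc_measure (s - 2)) < \<infinity> \<Longrightarrow>
      (\<integral>\<^sup>+z. ennreal (\<phi> (cmod z) powr p) \<partial>disc_measure (s - 2 + 2 * real m - real m * p)) = ennreal A \<Longrightarrow> 0 \<le> A \<Longrightarrow>
      emeasure (disc_measure (t + 2 - real m * p)) UNIV < \<infinity> \<and> N \<le> K * A powr (1 / p)"
    by (rule bergman_projection_bounded_radial_test[OF s s' p bdd]) blast
  have e: "ennreal (enn2real (emeasure (disc_measure q) UNIV)) = emeasure (disc_measure q) UNIV"
    "0 < enn2real (emeasure (disc_measure q) UNIV)" if "q > -2" for q
    using fin[OF that] emeasure_disc_measure_pos[of q] by (auto simp: enn2real_positive_iff)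
  have q: "s - 2 + real m > -2" "s - 2 + 2 * real m > -2" using s by auto
  have "emeasure (disc_measure (t + 2 - real m * p)) UNIV < \<infinity> \<and>
      enn2real (emeasure (disc_measure (s - 2 + real m)) UNIV) \<le>
      K * enn2real (emeasure (disc_measure (s - 2 + 2 * real m)) UNIV) powr (1 / p)"
  proof (rule K[of \<phi>])
    show "(\<integral>\<^sup>+z. ennreal (\<phi> (cmod z)) \<partial>disc_measure (s - 2)) = ennreal (enn2real (emeasure (disc_measure (s - 2 + real m)) UNIV))"
      using I[where q="s - 2" and r=1] e(1)[OF q(1)] by (simp add: \<phi>_def)
    show "(\<integral>\<^sup>+z. ennreal (\<phi> (cmod z) powr 2) \<partial>disc_measure (s - 2)) < \<infinity>"
      unfolding I using fin[OF q(2)] by (simp add: mult.commute)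
    show "(\<integral>\<^sup>+z. ennreal (\<phi> (cmod z) powr p) \<partial>disc_measure (s - 2 + 2 * real m - real m * p)) =
        ennreal (enn2real (emeasure (disc_measure (s - 2 + 2 * real m)) UNIV))"
      unfolding I using e(1)[OF q(2)] by simp
  qed (use e(2)[OF q(1)] in \<open>auto simp: \<phi>_def\<close>)
  moreover have "emeasure (disc_measure (t + 2 - real m * p)) UNIV = \<infinity>"
    using upper by (intro emeasure_disc_measure_infinite) simp
  ultimately show False by simp
qed

text \<open>Truncated powers serve as extremals of the duality pairing. When both integrals equal
  \<open>N\<close>, boundedness gives \<open>N \<le> K * N powr (1 / p)\<close>, which bounds
  \<open>N\<close> by a power of the constant, while \<open>N\<close> can be made arbitrarily large
  by shrinking \<open>\<epsilon>\<close>.\<close>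

lemma bergman_projection_unbounded_lower:
  fixes s s' p t :: real and m :: nat
  assumes s: "0 < s" "s \<le> 2" and s': "s' + 2 = s - 2 + 2 * real m" and p: "p > 1"
    and lower: "p * (s + real m) \<le> s + 2 * real m"
  shows "\<not> bergman_projection_bounded p hartogs_triangle (power_weight s') (power_weight t)"
proof
  assume bdd: "bergman_projection_bounded p hartogs_triangle (power_weight s') (power_weight t)"
  obtain K where K: "\<And>\<phi> N A. \<phi> \<in> borel_measurable borel \<Longrightarrow> (\<And>x. 0 \<le> \<phi> x) \<Longrightarrow>
      (\<integral>\<^sup>+z. ennreal (\<phi> (cmod z)) \<partial>disc_measure (s - 2)) = ennreal N \<Longrightarrow> 0 < N \<Longrightarrow>
      (\<integral>\<^sup>+z. ennreal (\<phi> (cmod z) powr 2) \<partial>disc_measure (s - 2)) < \<infinity> \<Longrightarrow>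
      (\<integral>\<^sup>+z. ennreal (\<phi> (cmod z) powr p) \<partial>disc_measure (s - 2 + 2 * real m - real m * p)) = ennreal A \<Longrightarrow> 0 \<le> A \<Longrightarrow>
      emeasure (disc_measure (t + 2 - real m * p)) UNIV < \<infinity> \<and> N \<le> K * A powr (1 / p)"
    by (rule bergman_projection_bounded_radial_test[OF s s' p bdd]) blast
  text \<open>This exponent makes \<open>\<integral>\<phi>\<close> and \<open>\<integral>\<phi>\<^sup>p\<close>, with their respective weights, the same
    divergent integral.\<close>
  define a where "a = real m * (p - 2) / (p - 1)"
  have ap: "s - 2 + 2 * real m - real m * p + a * p = s - 2 + a"
  proof -
    have "a * (p - 1) = real m * (p - 2)" using p by (simp add: a_def)
    then show ?thesis by (simp add: algebra_simps)
  qed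
  \<comment> \<open>The hypothesis on \<open>p\<close> is thus equivalent to
    \<open>s - 2 + a \<le> -2\<close>, the divergence of the common integral.\<close>
  have "(p - 1) * (s + a) = p * (s + real m) - (s + 2 * real m)"
    using p by (simp add: a_def field_simps)
  then have "(p - 1) * (s + a) \<le> 0" using lower by simp
  then have "s + a \<le> 0" using p by (simp add: mult_le_0_iff)
  then have r: "s - 2 + a \<le> -2" by simp
  \<comment> \<open>One more than the largest \<open>N\<close> compatible with boundedness;
    \<open>\<bar>K\<bar> + 1\<close> replaces \<open>K\<close> to have a positive base.\<close>
  define X where "X = (\<bar>K\<bar> + 1) powr (p / (p - 1)) + 1"
  obtain \<epsilon> where \<epsilon>: "0 < \<epsilon>" "\<epsilon> \<le> 1" "ennreal X \<le> annulus_mass (s - 2 + a) \<epsilon>"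
    using annulus_mass_unbounded[OF r, of X] by blast
  define N where "N = enn2real (annulus_mass (s - 2 + a) \<epsilon>)"
  have N: "ennreal N = annulus_mass (s - 2 + a) \<epsilon>"
    using annulus_mass_finite[OF \<epsilon>(1,2), of "s - 2 + a"] by (simp add: N_def)
  have "X \<le> N" using \<epsilon>(3) unfolding N[symmetric] by (simp add: ennreal_le_iff N_def)
  moreover have "0 < X" by (simp add: X_def add_nonneg_pos)
  ultimately have N0: "0 < N" by linarith
  define \<phi> where "\<phi> = (\<lambda>x :: real. indicator {\<epsilon>..} x * x powr a)"
  have [measurable]: "\<phi> \<in> borel_measurable borel" unfolding \<phi>_def by measurable
  have I: "(\<integral>\<^sup>+z. ennreal (\<phi> (cmod z) powr r) \<partial>disc_measure q) = annulus_mass (q + a * r) \<epsilon>" if "r > 0" for q r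
  proof -
    have "(\<integral>\<^sup>+z. ennreal (\<phi> (cmod z) powr r) \<partial>disc_measure q) =
        (\<integral>\<^sup>+z. ennreal (cmod z powr (a * r)) * indicator {\<epsilon>..} (cmod z) \<partial>disc_measure q)"
      by (intro nn_integral_cong) (auto simp: \<phi>_def powr_powr split: split_indicator)
    also have "\<dots> = annulus_mass (q + a * r) \<epsilon>"
      unfolding annulus_mass_def by (rule nn_integral_disc_measure_add) measurable
    finally show ?thesis .
  qed
  have "emeasure (disc_measure (t + 2 - real m * p)) UNIV < \<infinity> \<and> N \<le> K * N powr (1 / p)"
  proof (rule K[of \<phi>])
    show "(\<integral>\<^sup>+z. ennreal (\<phi> (cmod z)) \<partial>disc_measure (s - 2)) = ennreal N"
      using I[of 1 "s - 2"] by (simp add: N \<phi>_def)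
    show "(\<integral>\<^sup>+z. ennreal (\<phi> (cmod z) powr 2) \<partial>disc_measure (s - 2)) < \<infinity>"
      using annulus_mass_finite[OF \<epsilon>(1,2)] by (subst I) auto
    show "(\<integral>\<^sup>+z. ennreal (\<phi> (cmod z) powr p) \<partial>disc_measure (s - 2 + 2 * real m - real m * p)) = ennreal N"
      using p by (subst I) (auto simp: ap N)
  qed (use N0 in \<open>auto simp: \<phi>_def\<close>)
  then have "N \<le> K * N powr (1 / p)" by simp
  also have "\<dots> \<le> (\<bar>K\<bar> + 1) * N powr (1 / p)" by (intro mult_right_mono) auto
  finally have "N * N powr (- (1 / p)) \<le> (\<bar>K\<bar> + 1) * (N powr (1 / p) * N powr (- (1 / p)))"
    by (simp add: mult_right_mono flip: mult.assoc)
  also have "N powr (1 / p) * N powr (- (1 / p)) = 1" using N0 by (simp flip: powr_add)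
  also have "N * N powr (- (1 / p)) = N powr ((p - 1) / p)"
  proof -
    have "(p - 1) / p = 1 + - (1 / p)" using p by (simp add: field_simps)
    then have "N powr ((p - 1) / p) = N powr 1 * N powr (- (1 / p))" by (simp only: powr_add)
    then show ?thesis using N0 by simp
  qed
  finally have "(N powr ((p - 1) / p)) powr (p / (p - 1)) \<le> (\<bar>K\<bar> + 1) powr (p / (p - 1))"
    using p by (intro powr_mono2) auto
  then have "N \<le> (\<bar>K\<bar> + 1) powr (p / (p - 1))" using p N0 by (simp add: powr_powr)
  then show False using \<open>X \<le> N\<close> by (simp add: X_def)
qed

theorem theorem1p8:
  fixes s' s p t :: real and k :: int
  assumes "s' = s + 2 * of_int k"
    and "0 < s" and "s \<le> 2"
    and "p > 1"
    and "k \<ge> -1"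
  shows
    "(p \<in> {(s + 2 * of_int k + 4) / (s + of_int k + 2) <..< (t + 4) / (of_int k + 2)} \<longrightarrow>
        bergman_projection_bounded p hartogs_triangle (power_weight s') (power_weight t)) \<and>
     (t - s' \<le> (2 - s) * p \<longrightarrow>
        (bergman_projection_bounded p hartogs_triangle (power_weight s') (power_weight t) \<longleftrightarrow>
         p \<in> {(s + 2 * of_int k + 4) / (s + of_int k + 2) <..< (t + 4) / (of_int k + 2)})) \<and>
     (p \<le> (s + 2 * of_int k + 4) / (s + of_int k + 2) \<longrightarrow>
        (\<forall>t' :: real.
           \<not> bergman_projection_bounded p hartogs_triangle (power_weight s') (power_weight t')))"
proof -
  \<comment> \<open>Since \<open>k \<ge> -1\<close>, \<open>k + 2\<close> is a natural number and at
    least 1, so \<open>m\<close> is a genuine exponent and a positive denominator.\<close>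
  define m where "m = nat (k + 2)"
  have m: "of_int k + 2 = real m" "1 \<le> real m" using assms(5) by (auto simp: m_def)
  then have k: "of_int k = real m - 2" by simp
  have s': "s' + 2 = s - 2 + 2 * real m" using assms(1) by (simp add: k)
  \<comment> \<open>The bounds on \<open>p\<close> are restated without division;
    \<open>s > 0\<close> and \<open>m \<ge> 1\<close> make both denominators positive.\<close>
  have lower: "p \<le> (s + 2 * of_int k + 4) / (s + of_int k + 2) \<longleftrightarrow> p * (s + real m) \<le> s + 2 * real m"
    using assms(2) m(2) by (simp add: k pos_le_divide_eq)
  then have lower': "(s + 2 * of_int k + 4) / (s + of_int k + 2) < p \<longleftrightarrow> s + 2 * real m < p * (s + real m)"
    by (meson not_le)
  have upper: "p < (t + 4) / (of_int k + 2) \<longleftrightarrow> real m * p < t + 4"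
    using m by (simp add: pos_less_divide_eq mult.commute)
  have "bergman_projection_bounded p hartogs_triangle (power_weight s') (power_weight t) \<longleftrightarrow>
      p \<in> {(s + 2 * of_int k + 4) / (s + of_int k + 2) <..< (t + 4) / (of_int k + 2)}"
    unfolding greaterThanLessThan_iff upper lower'
    using bergman_projection_bounded_hartogs[OF assms(2,3) s' assms(4), of t]
      bergman_projection_unbounded_upper[OF assms(2,3) s' assms(4), of t]
      bergman_projection_unbounded_lower[OF assms(2,3) s' assms(4), of t]
    by (meson not_le)
  then show ?thesis
    using bergman_projection_unbounded_lower[OF assms(2,3) s' assms(4)] lower by blast
qed

end
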